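(* Let $S\subseteq\mathbb R^2$ be a semialgebraic set which has exactly one tentacle and whose tentacle is regular, and let $f_S$ be the last key form of $\delta^*_S$. Then the following are equivalent: (1) $\bar\delta_S$ is a semidegree; (2) $\delta^*_S$ is non-negative on $\mathbb R[x,y]\setminus\{0\}$; (3) $\delta^*_S(f_S)\ge 0$.
   Context: For $S\subseteq\mathbb R^2$ and $d\in\mathbb N=\{0,1,\dots\}$, $\mathcal B_d(S)=\{p\in\mathbb R[x,y] : \exists q\in\mathbb R[x,y],\ \deg(q)\le 2d,\ p^2\le q \text{ on } S\}$. For $0\ne f\in\mathbb R[x,y]$, $\delta_S(f)$ is the smallest $d\in\mathbb N$ with $f\in\mathcal B_d(S)$, and $\bar\delta_S(f)=\lim_{k\to\infty}\delta_S(f^k)/k$. A function $\delta:\mathbb R[x,y]\setminus\{0\}\to\mathbb R$ is a semidegree if $\delta(f+g)\le\max\{\delta(f),\delta(g)\}$ (when $f+g\neq 0$), with equality if $\delta(f)\ne\delta(g)$, and $\delta(fg)=\delta(f)+\delta(g)$. Tentacles. For a semialgebraic $S\subseteq\mathbb R^2$, let $B_r$ be the ball of radius $r$ about the origin. For $r$ large the number of connected components of $S\setminus B_r$ is stable; these components (for $r$ large) are the tentacles of $S$. A tentacle is regular if it contains a dense open subset (i.e. it has a subset that is open in $\mathbb R^2$ and dense in it). Definition of $\delta^*_S$ (for $S$ with exactly one tentacle, which is regular). Let $\bar S$ be the closure of $S$ in $\mathbb{RP}^2$ and $L_\infty$ the line at infinity. If $\bar S\cap L_\infty$ has more than one point,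 put $\delta^*_S=\deg$, $(u,v)=(x,y)$, $\phi=0$, $\omega=1$. If $\bar S\cap L_\infty$ is a single point $P$, choose linear coordinates $(u,v)$ on $\mathbb R^2$ such that $P$ is not on the closure of the line $u=0$ and $u\to+\infty$ along the tentacle. For $u$ large, $S$ is (up to boundary points) the region between two curve branches $v=\phi_1(u)$ and $v=\phi_2(u)$, where $\phi_1\neq\phi_2$ are real Puiseux series in $1/u$ (descending rational exponents with common denominator, all $\le 1$). Let $\omega\in\mathbb Q$ be the smallest number such that the coefficients of $u^{\omega'}$ in $\phi_1$ and $\phi_2$ agree for all $\omega'>\omega$, and let $\phi(u)$ be the (finite) sum of the common terms with exponent $>\omega$. With a new indeterminate $\xi$, $\delta^*_S(f)=\deg_u\big(f(u,\phi(u)+\xi u^\omega)\big)$ for $f\in\mathbb R[x,y]\setminus\{0\}=\mathbb R[u,v]\setminus\{0\}$, where $f$ is written in the coordinates $(u,v)$. In both cases $\delta^*_S(f)=\deg_u f(u,\phi(u)+\xi u^\omega)$, and this formula extends $\delta^*_S$ to $\mathbb C[u,u^{-1},v]\setminus\{0\}$. Key forms. For $\delta(f)=\deg_u f(u,\phi(u)+\xi u^\omega)$ on $\mathbb C[u,u^{-1},v]\setminus\{0\}$, the sequence of key forms of $\delta$ is the unique finite sequence $f_0=u,\ f_1=v,\ f_2,\dots,f_l\in\mathbb C[u,u^{-1},v]$, $l\ge1$, such that, with $\omega_j=\delta(f_j)$: (i) for $1\le j\le l-1$, letting $\alpha_j$ be the smallest positive integer with $\alpha_j\omega_j\in\mathbb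 Z\omega_0+\dots+\mathbb Z\omega_{j-1}$ and writing (uniquely) $\alpha_j\omega_j=\sum_{i=0}^{j-1}\beta_{j,i}\omega_i$ with $\beta_{j,i}\in\mathbb Z$ and $0\le\beta_{j,i}<\alpha_i$ for $1\le i<j$, one has $f_{j+1}=f_j^{\alpha_j}-\theta_j\prod_{i=0}^{j-1}f_i^{\beta_{j,i}}$ for some $\theta_j\in\mathbb C\setminus\{0\}$, and $\omega_{j+1}<\alpha_j\omega_j$; (ii) for every $0\neq g\in\mathbb C[u,u^{-1},v]$, $\delta(g)=\min\{\eta(G) : G\in\mathbb C[u,u^{-1},y_1,\dots,y_l],\ G(u,f_1,\dots,f_l)=g\}$, where $\eta$ is the weighted degree with weight $\omega_0$ for $u$ and $\omega_j$ for $y_j$. The last key form is $f_l$; for $\delta=\delta^*_S$ it is denoted $f_S$. *)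

theory Defs
  imports
    "HOL-Analysis.Analysis"
    "HOL-Library.Poly_Mapping"
    "HOL-Computational_Algebra.Polynomial"
begin

section \<open>Bivariate real polynomials and growth on a set\<close>

text \<open>
  \<open>\<real>[x,y]\<close> is rendered as \<^typ>\<open>real poly poly\<close>: the outer variable is \<open>y\<close>, the inner one \<open>x\<close>.
\<close>

definition eval2 :: "real poly poly \<Rightarrow> real \<times> real \<Rightarrow> real" where
  "eval2 f z = poly (poly f [:snd z:]) (fst z)"

text \<open>As for \<^const>\<open>Polynomial.degree\<close>, the zero polynomial gets degree 0.\<close>

definition total_degree :: "real poly poly \<Rightarrow> nat" where
  "total_degree f = Max (insert 0 {i + j | i j. coeff (coeff f i) j \<noteq> 0})"

definition growth_space :: "(real \<times> real) set \<Rightarrow> nat \<Rightarrow> real poly poly set" where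
  "growth_space S d =
     {p. \<exists>q. total_degree q \<le> 2 * d \<and> (\<forall>z\<in>S. (eval2 p z)\<^sup>2 \<le> eval2 q z)}"

definition growth_degree :: "(real \<times> real) set \<Rightarrow> real poly poly \<Rightarrow> nat" where
  "growth_degree S f = (LEAST d. f \<in> growth_space S d)"

definition stable_growth_degree :: "(real \<times> real) set \<Rightarrow> real poly poly \<Rightarrow> real" where
  "stable_growth_degree S f = lim (\<lambda>k. real (growth_degree S (f ^ k)) / real k)"

text \<open>The values of \<open>\<delta>\<close> at zero polynomials are irrelevant: \<open>\<delta>\<close> lives on \<open>\<real>[x,y] - {0}\<close>.\<close>

definition semidegree :: "(real poly poly \<Rightarrow> real) \<Rightarrow> bool" where
  "semidegree \<delta> \<longleftrightarrow>
     (\<forall>f g. f \<noteq> 0 \<longrightarrow> g \<noteq> 0 \<longrightarrow>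
        (f + g \<noteq> 0 \<longrightarrow>
           \<delta> (f + g) \<le> max (\<delta> f) (\<delta> g) \<and>
           (\<delta> f \<noteq> \<delta> g \<longrightarrow> \<delta> (f + g) = max (\<delta> f) (\<delta> g))) \<and>
        \<delta> (f * g) = \<delta> f + \<delta> g)"


section \<open>Semialgebraic sets and tentacles\<close>

definition semialgebraic :: "(real \<times> real) set \<Rightarrow> bool" where
  "semialgebraic S \<longleftrightarrow>
     (\<exists>F :: (real poly poly set \<times> real poly poly set) set.
        finite F \<and> (\<forall>(P, Q)\<in>F. finite P \<and> finite Q) \<and>
        S = (\<Union>(P, Q)\<in>F. {z. (\<forall>f\<in>P. eval2 f z = 0) \<and> (\<forall>g\<in>Q. eval2 g z > 0)}))"

text \<open>For a semialgebraic set the tentacles are the elements of this set for all large \<open>r\<close>.\<close>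

definition tentacles_at :: "(real \<times> real) set \<Rightarrow> real \<Rightarrow> (real \<times> real) set set" where
  "tentacles_at S r = components (S - ball 0 r)"

definition one_tentacle :: "(real \<times> real) set \<Rightarrow> bool" where
  "one_tentacle S \<longleftrightarrow> (\<forall>\<^sub>F r in at_top. card (tentacles_at S r) = 1)"

definition regular_tentacle :: "(real \<times> real) set \<Rightarrow> bool" where
  "regular_tentacle T \<longleftrightarrow> (\<exists>U\<subseteq>T. open U \<and> T \<subseteq> closure U)"

definition all_tentacles_regular :: "(real \<times> real) set \<Rightarrow> bool" where
  "all_tentacles_regular S \<longleftrightarrow> (\<forall>\<^sub>F r in at_top. \<forall>T\<in>tentacles_at S r. regular_tentacle T)"


section \<open>The real projective plane\<close>

text \<open>
  Points are the lines through the origin of \<open>\<real>\<^sup>3\<close>, the topology is the quotient topology of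
  \<open>\<real>\<^sup>3 - {0}\<close>, and the affine plane is embedded by \<open>(x,y) \<mapsto> [1:x:y]\<close>.
\<close>

definition rp2 :: "(real \<times> real \<times> real) set set" where
  "rp2 = {span {w} | w. w \<noteq> 0}"

definition rp2_topology :: "(real \<times> real \<times> real) set topology" where
  "rp2_topology = topology (\<lambda>U. U \<subseteq> rp2 \<and> open {w. w \<noteq> 0 \<and> span {w} \<in> U})"

lemma openin_rp2_topology:
  "openin rp2_topology U \<longleftrightarrow> U \<subseteq> rp2 \<and> open {w. w \<noteq> 0 \<and> span {w} \<in> U}"
proof -
  have *: "{w. w \<noteq> 0 \<and> span {w} \<in> \<Union>K} = (\<Union>U\<in>K. {w. w \<noteq> 0 \<and> span {w} \<in> U})"
    for K :: "(real \<times> real \<times> real) set set set"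
    by auto
  have **: "{w. w \<noteq> 0 \<and> span {w} \<in> U \<inter> V} = {w. w \<noteq> 0 \<and> span {w} \<in> U} \<inter> {w. w \<noteq> 0 \<and> span {w} \<in> V}"
    for U V :: "(real \<times> real \<times> real) set set"
    by auto
  have "istopology (\<lambda>U. U \<subseteq> rp2 \<and> open {w. w \<noteq> 0 \<and> span {w} \<in> U})"
    unfolding istopology_def * ** by (auto intro!: open_Int open_UN)
  then show ?thesis
    by (simp add: rp2_topology_def topology_inverse')
qed

definition affine_to_rp2 :: "real \<times> real \<Rightarrow> (real \<times> real \<times> real) set" where
  "affine_to_rp2 z = span {(1, fst z, snd z)}"

definition line_at_infinity :: "(real \<times> real \<times> real) set set" where
  "line_at_infinity = {span {(0, a, b)} | a b. (a, b) \<noteq> (0, 0)}"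

definition rp2_closure :: "(real \<times> real) set \<Rightarrow> (real \<times> real \<times> real) set set" where
  "rp2_closure S = rp2_topology closure_of (affine_to_rp2 ` S)"


section \<open>The semidegree \<open>\<delta>\<^sup>*\<close> attached to a tentacle\<close>

text \<open>
  A real Puiseux series in \<open>1/u\<close> with exponents \<open>\<le> 1\<close> is given by its coefficient function
  \<open>c\<close>: the coefficient of \<open>u\<^sup>q\<close> is \<open>c q\<close>.
\<close>

definition puiseux :: "(rat \<Rightarrow> real) \<Rightarrow> bool" where
  "puiseux c \<longleftrightarrow> (\<exists>n::nat. n > 0 \<and> (\<forall>q. c q \<noteq> 0 \<longrightarrow> q \<le> 1 \<and> of_nat n * q \<in> \<int>))"

definition puiseux_sums :: "(rat \<Rightarrow> real) \<Rightarrow> real \<Rightarrow> real \<Rightarrow> bool" where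
  "puiseux_sums c u v \<longleftrightarrow> ((\<lambda>q. c q * u powr real_of_rat q) has_sum v) UNIV"

text \<open>
  A coordinate system is a linear automorphism \<open>\<tau>\<close> of \<open>\<real>\<^sup>2\<close>, with \<open>(u,v) = \<tau> (x,y)\<close>.
  The following condition says that for large \<open>u\<close>, the set \<open>S\<close> in these coordinates is, up to
  boundary points, the region between the branches \<open>v = \<phi>\<^sub>1(u)\<close> and \<open>v = \<phi>\<^sub>2(u)\<close>.
  Open and closed segments make it symmetric in the two branches.
\<close>

definition bounded_by_branches ::
  "(real \<times> real) set \<Rightarrow> (real \<times> real \<Rightarrow> real \<times> real) \<Rightarrow> (rat \<Rightarrow> real) \<Rightarrow> (rat \<Rightarrow> real) \<Rightarrow> bool"
where
  "bounded_by_branches S \<tau> c1 c2 \<longleftrightarrow>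
     (\<forall>\<^sub>F u in at_top. \<exists>v1 v2.
        puiseux_sums c1 u v1 \<and> puiseux_sums c2 u v2 \<and>
        open_segment v1 v2 \<subseteq> {v. (u, v) \<in> \<tau> ` S} \<and>
        {v. (u, v) \<in> \<tau> ` S} \<subseteq> closed_segment v1 v2)"

definition branching_data ::
  "(rat \<Rightarrow> real) \<Rightarrow> (rat \<Rightarrow> real) \<Rightarrow> (rat \<Rightarrow>\<^sub>0 real) \<Rightarrow> rat \<Rightarrow> bool"
where
  "branching_data c1 c2 \<phi> \<omega> \<longleftrightarrow>
     (\<forall>q>\<omega>. c1 q = c2 q) \<and> (\<forall>w. (\<forall>q>w. c1 q = c2 q) \<longrightarrow> \<omega> \<le> w) \<and>
     (\<forall>q. Poly_Mapping.lookup \<phi> q = (if q > \<omega> then c1 q else 0))"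

text \<open>
  The admissible choices of coordinates \<open>\<tau>\<close> together with the resulting \<open>\<phi>\<close> and \<open>\<omega>\<close>.
  In the first case the data make \<open>\<delta>\<^sup>*\<close> the total degree.
  Since \<open>S\<close> has only one tentacle, ``along the tentacle'' means along the points of \<open>S\<close>
  tending to infinity.
\<close>

definition delta_star_data ::
  "(real \<times> real) set \<Rightarrow> (real \<times> real \<Rightarrow> real \<times> real) \<Rightarrow> (rat \<Rightarrow>\<^sub>0 real) \<Rightarrow> rat \<Rightarrow> bool"
where
  "delta_star_data S \<tau> \<phi> \<omega> \<longleftrightarrow>
     (\<exists>P Q. P \<noteq> Q \<and> {P, Q} \<subseteq> rp2_closure S \<inter> line_at_infinity) \<and>
       \<tau> = id \<and> \<phi> = 0 \<and> \<omega> = 1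
   \<or> (\<exists>P. rp2_closure S \<inter> line_at_infinity = {P} \<and>
       linear \<tau> \<and> bij \<tau> \<and>
       P \<notin> rp2_closure {z. fst (\<tau> z) = 0} \<and>
       filterlim (\<lambda>z. fst (\<tau> z)) at_top (inf at_infinity (principal S)) \<and>
       (\<exists>c1 c2. puiseux c1 \<and> puiseux c2 \<and> c1 \<noteq> c2 \<and>
          bounded_by_branches S \<tau> c1 c2 \<and> branching_data c1 c2 \<phi> \<omega>))"

text \<open>
  \<open>\<complex>[u,u\<^sup>-\<^sup>1,v]\<close> is rendered as polynomials in \<open>v\<close> over the Laurent polynomial ring
  \<^typ>\<open>int \<Rightarrow>\<^sub>0 complex\<close> in \<open>u\<close>.  The substituted \<open>f(u, \<phi>(u) + \<xi> u\<^sup>\<omega>)\<close> lives in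
  \<^typ>\<open>rat \<Rightarrow>\<^sub>0 complex poly\<close>: Laurent polynomials with rational exponents in \<open>u\<close> over \<open>\<complex>[\<xi>]\<close>.
\<close>

type_synonym laurent = "(int \<Rightarrow>\<^sub>0 complex) poly"

definition laurent_monom :: "complex \<Rightarrow> int \<Rightarrow> laurent" where
  "laurent_monom a k = [:Poly_Mapping.single k a:]"

definition var_u :: laurent where "var_u = laurent_monom 1 1"

definition var_v :: laurent where "var_v = [:0, 1:]"

definition rational_exponents :: "(int \<Rightarrow>\<^sub>0 complex) \<Rightarrow> (rat \<Rightarrow>\<^sub>0 complex poly)" where
  "rational_exponents p =
     (\<Sum>k\<in>Poly_Mapping.keys p. Poly_Mapping.single (of_int k) [:Poly_Mapping.lookup p k:])"

definition subst_branch :: "(rat \<Rightarrow>\<^sub>0 real) \<Rightarrow> rat \<Rightarrow> laurent \<Rightarrow> (rat \<Rightarrow>\<^sub>0 complex poly)" where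
  "subst_branch \<phi> \<omega> f =
     poly (map_poly rational_exponents f)
       (Poly_Mapping.map (\<lambda>a. [:complex_of_real a:]) \<phi> + Poly_Mapping.single \<omega> [:0, 1:])"

text \<open>Meaningful for nonzero \<open>f\<close> only.\<close>

definition branch_degree :: "(rat \<Rightarrow>\<^sub>0 real) \<Rightarrow> rat \<Rightarrow> laurent \<Rightarrow> rat" where
  "branch_degree \<phi> \<omega> f = Max (Poly_Mapping.keys (subst_branch \<phi> \<omega> f))"

text \<open>
  Writing \<open>f \<in> \<real>[x,y]\<close> in the coordinates \<open>(u,v)\<close>, i.e. substituting the components of
  \<open>\<tau>\<^sup>-\<^sup>1 (u,v) = u \<tau>\<^sup>-\<^sup>1 (1,0) + v \<tau>\<^sup>-\<^sup>1 (0,1)\<close> for \<open>x\<close> and \<open>y\<close>.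
\<close>

definition in_coords :: "(real \<times> real \<Rightarrow> real \<times> real) \<Rightarrow> real poly poly \<Rightarrow> laurent" where
  "in_coords \<tau> f =
     (let const = (\<lambda>a. laurent_monom (complex_of_real a) 0);
          e1 = inv \<tau> (1, 0);
          e2 = inv \<tau> (0, 1);
          X = const (fst e1) * var_u + const (fst e2) * var_v;
          Y = const (snd e1) * var_u + const (snd e2) * var_v
      in poly (map_poly (\<lambda>p. poly (map_poly const p) X) f) Y)"

definition delta_star ::
  "(real \<times> real \<Rightarrow> real \<times> real) \<Rightarrow> (rat \<Rightarrow>\<^sub>0 real) \<Rightarrow> rat \<Rightarrow> real poly poly \<Rightarrow> rat"
where
  "delta_star \<tau> \<phi> \<omega> f = branch_degree \<phi> \<omega> (in_coords \<tau> f)"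


section \<open>Key forms\<close>

text \<open>
  \<open>\<complex>[u,u\<^sup>-\<^sup>1,y\<^sub>1,\<dots>,y\<^sub>l]\<close> is rendered as the elements of \<^typ>\<open>(nat \<Rightarrow>\<^sub>0 nat) \<Rightarrow>\<^sub>0 (int \<Rightarrow>\<^sub>0 complex)\<close>
  (exponent vectors of the \<open>y\<^sub>j\<close>, with coefficients that are Laurent polynomials in \<open>u\<close>) in which
  only the indices \<open>1,\<dots>,l\<close> occur.
\<close>

type_synonym laurent_y = "(nat \<Rightarrow>\<^sub>0 nat) \<Rightarrow>\<^sub>0 (int \<Rightarrow>\<^sub>0 complex)"

definition polys_in_y :: "nat \<Rightarrow> laurent_y set" where
  "polys_in_y l = {G. \<forall>m\<in>Poly_Mapping.keys G. Poly_Mapping.keys m \<subseteq> {1..l}}"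

definition subst_y :: "laurent list \<Rightarrow> laurent_y \<Rightarrow> laurent" where
  "subst_y fs G =
     (\<Sum>m\<in>Poly_Mapping.keys G. [:Poly_Mapping.lookup G m:] *
        (\<Prod>j\<in>Poly_Mapping.keys m. (fs ! j) ^ Poly_Mapping.lookup m j))"

definition weighted_degree :: "(nat \<Rightarrow> rat) \<Rightarrow> laurent_y \<Rightarrow> rat" where
  "weighted_degree w G =
     Max {of_int k * w 0 + (\<Sum>j\<in>Poly_Mapping.keys m. of_nat (Poly_Mapping.lookup m j) * w j) | m k.
            m \<in> Poly_Mapping.keys G \<and> k \<in> Poly_Mapping.keys (Poly_Mapping.lookup G m)}"

definition key_alpha :: "(nat \<Rightarrow> rat) \<Rightarrow> nat \<Rightarrow> nat" where
  "key_alpha w j =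
     (LEAST a. a > 0 \<and> (\<exists>\<beta>::nat \<Rightarrow> int. of_nat a * w j = (\<Sum>i<j. of_int (\<beta> i) * w i)))"

text \<open>
  The list is \<open>[f\<^sub>0, \<dots>, f\<^sub>l]\<close>.  In the product, the factor for \<open>i = 0\<close> is the Laurent
  monomial \<open>u\<^bsup>\<beta>\<^sub>0\<^esup>\<close>; it is the only one whose exponent may be negative.
\<close>

definition key_forms :: "(laurent \<Rightarrow> rat) \<Rightarrow> laurent list \<Rightarrow> bool" where
  "key_forms \<delta> fs \<longleftrightarrow>
     (\<exists>l\<ge>1. length fs = Suc l \<and> 0 \<notin> set fs \<and> fs ! 0 = var_u \<and> fs ! 1 = var_v \<and>
       (let w = (\<lambda>j. \<delta> (fs ! j)); \<alpha> = key_alpha w in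
         (\<forall>j\<in>{1..<l}. \<exists>(\<beta>::nat \<Rightarrow> int) \<theta>.
            of_nat (\<alpha> j) * w j = (\<Sum>i<j. of_int (\<beta> i) * w i) \<and>
            (\<forall>i\<in>{1..<j}. 0 \<le> \<beta> i \<and> \<beta> i < int (\<alpha> i)) \<and>
            \<theta> \<noteq> 0 \<and>
            fs ! Suc j = (fs ! j) ^ \<alpha> j - laurent_monom \<theta> (\<beta> 0) * (\<Prod>i\<in>{1..<j}. (fs ! i) ^ nat (\<beta> i)) \<and>
            w (Suc j) < of_nat (\<alpha> j) * w j) \<and>
         (\<forall>g. g \<noteq> 0 \<longrightarrow>
            (\<exists>G\<in>polys_in_y l. subst_y fs G = g \<and> weighted_degree w G = \<delta> g) \<and>
            (\<forall>G\<in>polys_in_y l. subst_y fs G = g \<longrightarrow> \<delta> g \<le> weighted_degree w G))))"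

end

theory Submission
  imports Defs "HOL-Computational_Algebra.Fundamental_Theorem_Algebra"
begin

text \<open>
  A polynomial lies in \<open>\<B>\<^sub>d(S)\<close> iff it is \<open>O((1 + \<bar>z\<bar>)\<^sup>d)\<close> on \<open>S\<close>, and along the tentacle a nonzero \<open>f\<close>
  grows exactly like \<open>u\<close> to the power \<open>\<delta>\<^sup>*(f)\<close>. Hence \<open>\<delta>\<^sub>S(f) = max 0 \<lceil>\<delta>\<^sup>*(f)\<rceil>\<close>, its stable version is
  \<open>max 0 \<delta>\<^sup>*\<close>, and this is additive iff \<open>\<delta>\<^sup>* \<ge> 0\<close>. If \<open>S\<close> has several points at infinity, connectedness of
  the tentacle forces \<open>S\<close> to meet infinitely many lines through the origin in unbounded sets,
  so that \<open>\<delta>\<^sub>S\<close> is the total degree.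

  For the key forms, the monomials in \<open>f\<^sub>1, \<dots>, f\<^sub>l\<close> with exponents below \<open>\<alpha>\<^sub>1, \<dots>, \<alpha>\<^bsub>l-1\<^esub>\<close> form a basis \<open>e\<^sub>i\<close> of
  \<open>\<complex>[u,u\<^sup>-\<^sup>1,v]\<close>, with \<open>e\<^sub>i\<close> monic of degree \<open>i\<close> in \<open>v\<close>, and every element of negative degree is a combination
  of terms \<open>u\<^sup>k e\<^sub>i\<close> of negative weight. If \<open>\<delta>\<^sup>*(f\<^sub>l) \<ge> 0\<close>, then all \<open>e\<^sub>i\<close> have nonnegative weight, so the
  leading coefficient in \<open>v\<close> of such a combination involves a negative power of \<open>u\<close>: it is no polynomial.
  If \<open>\<delta>\<^sup>*(f\<^sub>l) < 0\<close>, the weights of the \<open>e\<^sub>i\<close> tend to \<open>-\<infinity>\<close>, and a dimension count (Riemann-Roch for a vector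
  bundle on the projective line) produces a polynomial of negative degree.
\<close>

section \<open>Ring homomorphisms and evaluation along a branch\<close>

text \<open>Formal exponents and numerical growth are compared by evaluating at real
  \<open>u\<close> and real \<open>\<xi>\<close>. The coefficient of the highest power of
  \<open>u\<close> is a nonzero polynomial in \<open>\<xi>\<close>, so this power is visible along
  the curve \<open>v = \<phi>(u) + \<xi> u^\<omega>\<close> for all but finitely many
  \<open>\<xi>\<close>. As \<open>\<omega>\<close> is the first exponent at which the two branches
  disagree, the tentacle contains, for large \<open>u\<close>, such curves for a whole open interval
  of \<open>\<xi>\<close>, and one of them avoids the roots.

  With several points at infinity there are no branches to follow. Points of \<open>S\<close> on
  prescribed lines then come from an intermediate value argument for a product of two linear forms;
  a single linear form has no sign at a point at infinity.

  Key forms have complex coefficients while (2) speaks of real polynomials. A complex polynomial of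
  negative degree is therefore split into real and imaginary parts, and evaluation at real points
  shows that neither part grows faster than the whole.\<close>

definition ring_morphism :: "('a::comm_ring_1 \<Rightarrow> 'b::comm_ring_1) \<Rightarrow> bool" where
  "ring_morphism h \<longleftrightarrow>
     h 0 = 0 \<and> h 1 = 1 \<and> (\<forall>x y. h (x + y) = h x + h y) \<and> (\<forall>x y. h (x * y) = h x * h y)"

lemma ring_morphismD:
  assumes "ring_morphism h"
  shows "h 0 = 0" "h 1 = 1" "h (x + y) = h x + h y" "h (x * y) = h x * h y"
  using assms by (auto simp: ring_morphism_def)

lemma ring_morphism_sum: "ring_morphism h \<Longrightarrow> h (sum f I) = (\<Sum>i\<in>I. h (f i))"
  by (induction I rule: infinite_finite_induct) (auto simp: ring_morphism_def)

lemma ring_morphism_power: "ring_morphism h \<Longrightarrow> h (x ^ n) = h x ^ n"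
  by (induction n) (auto simp: ring_morphism_def)

lemma ring_morphism_prod: "ring_morphism h \<Longrightarrow> h (prod f I) = (\<Prod>i\<in>I. h (f i))"
  by (induction I rule: infinite_finite_induct) (auto simp: ring_morphism_def)

lemma ring_morphism_compose:
  "ring_morphism g \<Longrightarrow> ring_morphism h \<Longrightarrow> ring_morphism (\<lambda>x. g (h x))"
  by (auto simp: ring_morphism_def)

lemma ring_morphism_poly: "ring_morphism (\<lambda>p. poly p x)"
  by (auto simp: ring_morphism_def)

lemma ring_morphism_map_poly:
  assumes h: "ring_morphism h"
  shows "ring_morphism (map_poly h)"
proof -
  note [simp] = ring_morphismD[OF h] ring_morphism_sum[OF h]
  show ?thesis
    unfolding ring_morphism_def
    by (auto intro!: poly_eqI simp: coeff_map_poly coeff_mult map_poly_pCons)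
qed

lemma ring_morphism_pCons:
  assumes h: "ring_morphism (h :: 'a::comm_ring_1 poly \<Rightarrow> 'b::comm_ring_1)"
  shows "h (pCons a p) = h [:a:] + h [:0, 1:] * h p"
proof -
  have "pCons a p = [:a:] + [:0, 1:] * p"
    by simp
  then show ?thesis
    using h by (metis ring_morphismD(3,4))
qed

lemma ring_morphism_poly_eqI:
  assumes "ring_morphism h" "ring_morphism k"
    and "\<And>c. h [:c:] = k [:c:]" "h [:0, 1:] = k [:0, 1:]"
  shows "h p = k p"
proof (induction p)
  case 0
  then show ?case
    using ring_morphismD(1)[OF assms(1)] ring_morphismD(1)[OF assms(2)] by metis
next
  case (pCons a p)
  then show ?case
    using ring_morphism_pCons[OF assms(1), of a p] ring_morphism_pCons[OF assms(2), of a p] assms(3,4)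
    by metis
qed

text \<open>The uniqueness half of the universal property of a polynomial ring in two variables: a
  formal substitution and a pointwise evaluation need only be compared on constants and
  variables.\<close>

lemma ring_morphism_poly_poly_eqI:
  assumes "ring_morphism h" "ring_morphism k"
    and "\<And>c. h [:[:c:]:] = k [:[:c:]:]" "h [:[:0, 1:]:] = k [:[:0, 1:]:]" "h [:0, 1:] = k [:0, 1:]"
  shows "h p = k p"
proof (rule ring_morphism_poly_eqI[OF assms(1,2) _ assms(5)])
  fix c
  have *: "ring_morphism (\<lambda>p. [:p:])"
    by (simp add: ring_morphism_def one_pCons)
  show "h [:c:] = k [:c:]"
    using ring_morphism_poly_eqI[OF ring_morphism_compose[OF assms(1) *] ring_morphism_compose[OF assms(2) *]]
      assms(3,4) by blast
qed

lemma ring_morphism_poly_map_poly: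
  assumes "ring_morphism h"
  shows "ring_morphism (\<lambda>p. poly (map_poly h p) x)"
  using ring_morphism_compose[OF ring_morphism_poly ring_morphism_map_poly[OF assms]] .

lemma ring_morphism_poly_apply:
  assumes h: "ring_morphism h"
  shows "h (poly p x) = poly (map_poly h p) (h x)"
  using ring_morphism_poly_eqI[OF ring_morphism_compose[OF h ring_morphism_poly] ring_morphism_poly_map_poly[OF h]]
  by (simp add: map_poly_pCons ring_morphismD[OF h])


section \<open>Termwise evaluation of finitely supported functions\<close>

definition keys_sum :: "('k \<Rightarrow> 'a::zero \<Rightarrow> 'b::comm_monoid_add) \<Rightarrow> ('k \<Rightarrow>\<^sub>0 'a) \<Rightarrow> 'b" where
  "keys_sum h F = (\<Sum>k\<in>Poly_Mapping.keys F. h k (Poly_Mapping.lookup F k))"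

lemma keys_sum_superset:
  assumes "finite K" "Poly_Mapping.keys F \<subseteq> K" "\<And>k. h k 0 = 0"
  shows "keys_sum h F = (\<Sum>k\<in>K. h k (Poly_Mapping.lookup F k))"
  unfolding keys_sum_def
  by (rule sum.mono_neutral_left) (use assms in \<open>auto simp: in_keys_iff\<close>)

lemma keys_sum_zero [simp]: "keys_sum h 0 = 0"
  by (simp add: keys_sum_def)

lemma keys_sum_single: "h k 0 = 0 \<Longrightarrow> keys_sum h (Poly_Mapping.single k a) = h k a"
  by (simp add: keys_sum_def)

lemma keys_sum_add:
  assumes "\<And>k. h k 0 = 0" "\<And>k a b. h k (a + b) = h k a + h k b"
  shows "keys_sum h (F + G) = keys_sum h F + keys_sum h G"
proof -
  let ?K = "Poly_Mapping.keys F \<union> Poly_Mapping.keys G"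
  have "keys_sum h H = (\<Sum>k\<in>?K. h k (Poly_Mapping.lookup H k))"
    if "Poly_Mapping.keys H \<subseteq> ?K" for H
    using that assms by (intro keys_sum_superset) auto
  then show ?thesis
    using Poly_Mapping.keys_add[of F G] by (simp add: lookup_add assms sum.distrib)
qed

lemma poly_mapping_sum_single:
  "F = (\<Sum>k\<in>Poly_Mapping.keys F. Poly_Mapping.single k (Poly_Mapping.lookup F k))"
  by (rule poly_mapping_eqI)
     (auto simp: lookup_sum lookup_single when_def in_keys_iff)

lemma times_poly_mapping_sum:
  fixes F G :: "'k::monoid_add \<Rightarrow>\<^sub>0 'a::semiring_0"
  shows "F * G = (\<Sum>i\<in>Poly_Mapping.keys F. \<Sum>j\<in>Poly_Mapping.keys G.
      Poly_Mapping.single (i + j) (Poly_Mapping.lookup F i * Poly_Mapping.lookup G j))"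
proof -
  have "F * G = (\<Sum>i\<in>Poly_Mapping.keys F. Poly_Mapping.single i (Poly_Mapping.lookup F i)) *
      (\<Sum>j\<in>Poly_Mapping.keys G. Poly_Mapping.single j (Poly_Mapping.lookup G j))"
    using poly_mapping_sum_single[of F] poly_mapping_sum_single[of G] by simp
  then show ?thesis
    by (simp add: sum_product mult_single)
qed

text \<open>The universal property of a monoid algebra. Both \<open>rational_exponents\<close> and
  \<open>branch_eval\<close> are extensions of this kind.\<close>

lemma ring_morphism_keys_sum:
  fixes h :: "'k::comm_monoid_add \<Rightarrow> 'a::comm_ring_1 \<Rightarrow> 'b::comm_ring_1"
  assumes 0: "\<And>k. h k 0 = 0" and add: "\<And>k a b. h k (a + b) = h k a + h k b"
    and 1: "h 0 1 = 1" and mult: "\<And>k l a b. h (k + l) (a * b) = h k a * h l b"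
  shows "ring_morphism (keys_sum h)"
proof -
  have plus: "keys_sum h (F + G) = keys_sum h F + keys_sum h G" for F G
    by (rule keys_sum_add) (rule 0, rule add)
  have sum: "keys_sum h (sum f I) = (\<Sum>i\<in>I. keys_sum h (f i))" for f :: "_ \<Rightarrow> _" and I :: "'k set"
    by (induction I rule: infinite_finite_induct) (auto simp: plus)
  have "keys_sum h (F * G) = keys_sum h F * keys_sum h G" for F G
    by (subst times_poly_mapping_sum)
       (simp add: sum keys_sum_single 0 mult keys_sum_def[of h F] keys_sum_def[of h G] sum_product)
  moreover have "keys_sum h 1 = 1"
    using keys_sum_single[of h 0 1] 0 1 by simp
  ultimately show ?thesis
    unfolding ring_morphism_def using plus by auto
qed

lemma rational_exponents_conv:
  "rational_exponents = keys_sum (\<lambda>k c. Poly_Mapping.single (of_int k) [:c:])"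
  by (simp add: rational_exponents_def keys_sum_def fun_eq_iff)

lemma ring_morphism_rational_exponents: "ring_morphism rational_exponents"
  unfolding rational_exponents_conv
  by (rule ring_morphism_keys_sum) (auto simp: mult_single mult.commute simp flip: single_add one_pCons)

lemma rational_exponents_single:
  "rational_exponents (Poly_Mapping.single k c) = Poly_Mapping.single (of_int k) [:c:]"
  by (simp add: rational_exponents_conv keys_sum_single)

lemma ring_morphism_subst_branch: "ring_morphism (subst_branch \<phi> \<omega>)"
  using ring_morphism_poly_map_poly[OF ring_morphism_rational_exponents]
  by (simp add: subst_branch_def[abs_def])

lemma subst_branch_laurent_monom:
  "subst_branch \<phi> \<omega> (laurent_monom c k) = Poly_Mapping.single (of_int k) [:c:]"
  by (simp add: subst_branch_def laurent_monom_def map_poly_pCons rational_exponents_single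
      ring_morphismD[OF ring_morphism_rational_exponents])

lemma subst_branch_var_v:
  "subst_branch \<phi> \<omega> var_v =
     Poly_Mapping.map (\<lambda>a. [:complex_of_real a:]) \<phi> + Poly_Mapping.single \<omega> [:0, 1:]"
  by (simp add: subst_branch_def var_v_def map_poly_pCons
      ring_morphismD[OF ring_morphism_rational_exponents])

abbreviation const_laurent :: "real \<Rightarrow> laurent" where
  "const_laurent a \<equiv> laurent_monom (complex_of_real a) 0"

lemma ring_morphism_const_laurent: "ring_morphism const_laurent"
  by (auto simp: ring_morphism_def laurent_monom_def single_add mult_single one_pCons mult.commute)

lemma in_coords_conv:
  "in_coords \<tau> = (\<lambda>f. poly (map_poly (\<lambda>p. poly (map_poly const_laurent p)
      (const_laurent (fst (inv \<tau> (1, 0))) * var_u + const_laurent (fst (inv \<tau> (0, 1))) * var_v)) f)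
      (const_laurent (snd (inv \<tau> (1, 0))) * var_u + const_laurent (snd (inv \<tau> (0, 1))) * var_v))"
  by (simp add: in_coords_def Let_def fun_eq_iff)

lemma ring_morphism_in_coords: "ring_morphism (in_coords \<tau>)"
  unfolding in_coords_conv
  by (intro ring_morphism_poly_map_poly ring_morphism_const_laurent)

lemma in_coords_simps:
  "in_coords \<tau> [:[:c:]:] = const_laurent c"
  "in_coords \<tau> [:[:0, 1:]:] =
     const_laurent (fst (inv \<tau> (1, 0))) * var_u + const_laurent (fst (inv \<tau> (0, 1))) * var_v"
  "in_coords \<tau> [:0, 1:] =
     const_laurent (snd (inv \<tau> (1, 0))) * var_u + const_laurent (snd (inv \<tau> (0, 1))) * var_v"
  using ring_morphismD[OF ring_morphism_const_laurent]
    ring_morphismD[OF ring_morphism_poly_map_poly[OF ring_morphism_const_laurent]]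
  by (auto simp: in_coords_conv map_poly_pCons)

text \<open>For \<open>u > 0\<close> the map from \<open>r\<close> to \<open>u powr r\<close> turns
  sums of exponents into products, so formal expressions in powers of \<open>u\<close> and in
  \<open>\<xi>\<close> acquire values compatible with the ring operations.\<close>

definition branch_eval :: "real \<Rightarrow> real \<Rightarrow> (rat \<Rightarrow>\<^sub>0 complex poly) \<Rightarrow> complex" where
  "branch_eval u \<xi> =
     keys_sum (\<lambda>r p. poly p (complex_of_real \<xi>) * complex_of_real (u powr real_of_rat r))"

lemma ring_morphism_branch_eval: "u > 0 \<Longrightarrow> ring_morphism (branch_eval u \<xi>)"
  unfolding branch_eval_def
  by (rule ring_morphism_keys_sum) (auto simp: algebra_simps of_rat_add powr_add)

lemma branch_eval_single:
  "branch_eval u \<xi> (Poly_Mapping.single r p) =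
     poly p (complex_of_real \<xi>) * complex_of_real (u powr real_of_rat r)"
  by (simp add: branch_eval_def keys_sum_single)

definition branch_sum :: "(rat \<Rightarrow>\<^sub>0 real) \<Rightarrow> real \<Rightarrow> real" where
  "branch_sum \<phi> u = (\<Sum>q\<in>Poly_Mapping.keys \<phi>. Poly_Mapping.lookup \<phi> q * u powr real_of_rat q)"

lemma keys_map_const:
  "Poly_Mapping.keys (Poly_Mapping.map (\<lambda>a. [:complex_of_real a:]) \<phi>) = Poly_Mapping.keys \<phi>"
  by (auto simp: in_keys_iff Poly_Mapping.map.rep_eq when_def)

lemma lookup_map_const:
  "Poly_Mapping.lookup (Poly_Mapping.map (\<lambda>a. [:complex_of_real a:]) \<phi>) q =
     [:complex_of_real (Poly_Mapping.lookup \<phi> q):]"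
  by (auto simp: Poly_Mapping.map.rep_eq when_def)

lemma branch_eval_var_v:
  assumes "u > 0"
  shows "branch_eval u \<xi> (subst_branch \<phi> \<omega> var_v) =
    complex_of_real (branch_sum \<phi> u + \<xi> * u powr real_of_rat \<omega>)"
  by (simp add: subst_branch_var_v ring_morphismD[OF ring_morphism_branch_eval[OF assms]]
      branch_eval_single)
     (simp add: branch_eval_def keys_sum_def keys_map_const lookup_map_const branch_sum_def)

lemma branch_eval_laurent_monom:
  "u > 0 \<Longrightarrow> branch_eval u \<xi> (subst_branch \<phi> \<omega> (laurent_monom c k)) =
    c * complex_of_real (u powr of_int k)"
  by (simp add: subst_branch_laurent_monom branch_eval_single)

lemma ring_morphism_eval2: "ring_morphism (\<lambda>f. eval2 f z)"
  unfolding eval2_def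
  by (rule ring_morphism_compose[OF ring_morphism_poly ring_morphism_poly])

lemma ring_morphism_of_real: "ring_morphism complex_of_real"
  by (auto simp: ring_morphism_def)

text \<open>The link between the formal side and the plane. Each of the substitutions is a ring
  homomorphism, so both sides are determined by their values on constants, \<open>x\<close> and
  \<open>y\<close>.\<close>

lemma branch_eval_in_coords:
  assumes \<tau>: "linear \<tau>" "bij \<tau>" and u: "u > 0"
  shows "branch_eval u \<xi> (subst_branch \<phi> \<omega> (in_coords \<tau> f)) =
    complex_of_real (eval2 f (inv \<tau> (u, branch_sum \<phi> u + \<xi> * u powr real_of_rat \<omega>)))"
proof (rule ring_morphism_poly_poly_eqI[where h = "\<lambda>f. branch_eval u \<xi> (subst_branch \<phi> \<omega> (in_coords \<tau> f))"])
  define v where "v = branch_sum \<phi> u + \<xi> * u powr real_of_rat \<omega>"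
  have lin: "linear (inv \<tau>)"
    using inj_linear_imp_inv_linear[of \<tau>] \<tau> by (simp add: bij_is_inj linear_linear)
  have "inv \<tau> (u, v) = inv \<tau> (u *\<^sub>R (1, 0) + v *\<^sub>R (0, 1))"
    by simp
  then have *: "inv \<tau> (u, v) = u *\<^sub>R inv \<tau> (1, 0) + v *\<^sub>R inv \<tau> (0, 1)"
    by (simp only: linear_add[OF lin] linear_scale[OF lin])
  let ?h = "\<lambda>g. branch_eval u \<xi> (subst_branch \<phi> \<omega> g)"
  have h: "ring_morphism ?h"
    by (intro ring_morphism_compose[OF ring_morphism_branch_eval] ring_morphism_subst_branch u)
  show "ring_morphism (\<lambda>f. ?h (in_coords \<tau> f))"
    by (rule ring_morphism_compose[OF h ring_morphism_in_coords])
  show "ring_morphism (\<lambda>f. complex_of_real (eval2 f (inv \<tau> (u, branch_sum \<phi> u + \<xi> * u powr real_of_rat \<omega>))))"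
    by (rule ring_morphism_compose[OF ring_morphism_of_real ring_morphism_eval2])
  have uv: "?h var_u = u" "?h var_v = v" "?h (const_laurent c) = c" for c
    using u by (auto simp: var_u_def branch_eval_laurent_monom branch_eval_var_v v_def)
  show "?h (in_coords \<tau> [:[:c:]:]) = complex_of_real (eval2 [:[:c:]:] (inv \<tau> (u, branch_sum \<phi> u + \<xi> * u powr real_of_rat \<omega>)))" for c
    by (simp add: in_coords_simps uv eval2_def)
  show "?h (in_coords \<tau> [:[:0, 1:]:]) = complex_of_real (eval2 [:[:0, 1:]:] (inv \<tau> (u, branch_sum \<phi> u + \<xi> * u powr real_of_rat \<omega>)))"
    unfolding v_def[symmetric] * by (simp add: in_coords_simps uv eval2_def ring_morphismD[OF h])
  show "?h (in_coords \<tau> [:0, 1:]) = complex_of_real (eval2 [:0, 1:] (inv \<tau> (u, branch_sum \<phi> u + \<xi> * u powr real_of_rat \<omega>)))"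
    unfolding v_def[symmetric] * by (simp add: in_coords_simps uv eval2_def ring_morphismD[OF h])
qed


section \<open>Leading exponents\<close>

text \<open>In an ordered group, exponents bounded by \<open>a\<close> and \<open>b\<close> add up
  to \<open>a + b\<close> only if both bounds are attained, so a single product of coefficients
  remains.\<close>

lemma lookup_times_top:
  fixes F G :: "'k::linordered_ab_group_add \<Rightarrow>\<^sub>0 'a::comm_ring_1"
  assumes F: "\<And>i. i \<in> Poly_Mapping.keys F \<Longrightarrow> i \<le> a" and G: "\<And>j. j \<in> Poly_Mapping.keys G \<Longrightarrow> j \<le> b"
  shows "Poly_Mapping.lookup (F * G) (a + b) = Poly_Mapping.lookup F a * Poly_Mapping.lookup G b"
proof -
  let ?c = "\<lambda>i j. Poly_Mapping.lookup F i * Poly_Mapping.lookup G j"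
  have eq: "i + j = a + b \<longleftrightarrow> i = a \<and> j = b"
    if "i \<in> Poly_Mapping.keys F" "j \<in> Poly_Mapping.keys G" for i j
    using F[OF that(1)] G[OF that(2)] add_less_le_mono[of i a j b] add_le_less_mono[of i a j b]
    by (auto simp: order_le_less)
  have "Poly_Mapping.lookup (F * G) (a + b) = (\<Sum>i\<in>Poly_Mapping.keys F. \<Sum>j\<in>Poly_Mapping.keys G.
      ?c i j when i + j = a + b)"
    by (subst times_poly_mapping_sum) (simp add: lookup_sum lookup_single)
  also have "\<dots> = (\<Sum>i\<in>Poly_Mapping.keys F. \<Sum>j\<in>Poly_Mapping.keys G.
      if i = a then if j = b then ?c a b else 0 else 0)"
    by (intro sum.cong refl) (auto simp: when_def eq)
  also have "\<dots> = (\<Sum>i\<in>Poly_Mapping.keys F. if i = a then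
      \<Sum>j\<in>Poly_Mapping.keys G. if j = b then ?c a b else 0 else 0)"
    by (intro sum.cong refl) auto
  also have "\<dots> = ?c a b"
    by (simp add: in_keys_iff)
  finally show ?thesis .
qed

definition top_key :: "('k::linorder \<Rightarrow>\<^sub>0 'a::zero) \<Rightarrow> 'k" where
  "top_key F = Max (Poly_Mapping.keys F)"

lemma top_key_in: "F \<noteq> 0 \<Longrightarrow> top_key F \<in> Poly_Mapping.keys F"
  unfolding top_key_def by (rule Max_in) auto

lemma top_key_ge: "k \<in> Poly_Mapping.keys F \<Longrightarrow> k \<le> top_key F"
  by (simp add: top_key_def)

lemma top_key_times:
  fixes F G :: "'k::linordered_ab_group_add \<Rightarrow>\<^sub>0 'a::idom"
  assumes "F \<noteq> 0" "G \<noteq> 0"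
  shows "top_key (F * G) = top_key F + top_key G"
  unfolding top_key_def[of "F * G"]
proof (rule Max_eqI)
  show "finite (Poly_Mapping.keys (F * G))"
    by simp
  have "Poly_Mapping.lookup (F * G) (top_key F + top_key G) =
      Poly_Mapping.lookup F (top_key F) * Poly_Mapping.lookup G (top_key G)"
    by (rule lookup_times_top) (auto intro: top_key_ge)
  then show "top_key F + top_key G \<in> Poly_Mapping.keys (F * G)"
    using top_key_in[OF assms(1)] top_key_in[OF assms(2)] by (simp add: in_keys_iff)
  show "k \<le> top_key F + top_key G" if k: "k \<in> Poly_Mapping.keys (F * G)" for k
  proof -
    obtain i j where "i \<in> Poly_Mapping.keys F" "j \<in> Poly_Mapping.keys G" "k = i + j"
      using k Poly_Mapping.keys_mult[of F G] by blast
    then show ?thesis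
      by (auto intro!: add_mono top_key_ge)
  qed
qed

lemma top_key_add_le:
  fixes F G :: "'k::linorder \<Rightarrow>\<^sub>0 'a::monoid_add"
  assumes "F + G \<noteq> 0"
  shows "top_key (F + G) \<le> max (top_key F) (top_key G)"
proof -
  have "top_key (F + G) \<in> Poly_Mapping.keys F \<union> Poly_Mapping.keys G"
    using top_key_in[OF assms] Poly_Mapping.keys_add[of F G] by blast
  then show ?thesis
    by (auto simp: le_max_iff_disj intro: top_key_ge)
qed

lemma top_key_add_less:
  fixes F G :: "'k::linorder \<Rightarrow>\<^sub>0 'a::comm_monoid_add"
  assumes "F + G \<noteq> 0" "F \<noteq> 0" "top_key G < top_key F"
  shows "top_key (F + G) = top_key F"
proof -
  have "Poly_Mapping.lookup G (top_key F) = 0"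
    using assms(3) top_key_ge[of "top_key F" G] by (metis in_keys_iff linorder_not_less)
  then have "top_key F \<in> Poly_Mapping.keys (F + G)"
    using top_key_in[OF assms(2)] by (simp add: in_keys_iff lookup_add)
  then have "top_key F \<le> top_key (F + G)"
    by (rule top_key_ge)
  then show ?thesis
    using top_key_add_le[OF assms(1)] assms(3) by auto
qed

lemma top_key_add_eq:
  fixes F G :: "'k::linorder \<Rightarrow>\<^sub>0 'a::comm_monoid_add"
  assumes "F + G \<noteq> 0" "F \<noteq> 0" "G \<noteq> 0" "top_key F \<noteq> top_key G"
  shows "top_key (F + G) = max (top_key F) (top_key G)"
  using top_key_add_less[of F G] top_key_add_less[of G F] assms
  by (cases "top_key F < top_key G") (auto simp: add.commute max_def)

lemma branch_degree_conv: "branch_degree \<phi> \<omega> f = top_key (subst_branch \<phi> \<omega> f)"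
  by (simp add: branch_degree_def top_key_def)

section \<open>Injectivity of the substitution along a branch\<close>

lemma eval2_eq_0_imp:
  assumes "infinite I" "infinite J" and vanish: "\<And>x y. x \<in> I \<Longrightarrow> y \<in> J \<Longrightarrow> eval2 f (x, y) = 0"
  shows "f = 0"
proof -
  have "poly (coeff f i) x = 0" if x: "x \<in> I" for i x
  proof -
    have "poly (map_poly (\<lambda>p. poly p x) f) y = eval2 f (x, y)" for y
      using ring_morphism_poly_apply[OF ring_morphism_poly, of f "[:y:]" x] by (simp add: eval2_def)
    then have "J \<subseteq> {y. poly (map_poly (\<lambda>p. poly p x) f) y = 0}"
      using vanish x by auto
    then have "map_poly (\<lambda>p. poly p x) f = 0"
      using assms(2) poly_roots_finite finite_subset by blast
    then have "coeff (map_poly (\<lambda>p. poly p x) f) i = 0"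
      by simp
    then show ?thesis
      by (simp add: coeff_map_poly)
  qed
  then have "I \<subseteq> {x. poly (coeff f i) x = 0}" for i
    by blast
  then have "coeff f i = 0" for i
    using assms(1) poly_roots_finite finite_subset by blast
  then show ?thesis
    by (auto intro: poly_eqI)
qed

lemma eval2_open_eq_0_imp:
  assumes "open U" "U \<noteq> {}" "\<And>z. z \<in> U \<Longrightarrow> eval2 f z = 0"
  shows "f = 0"
proof -
  obtain z where "z \<in> U"
    using assms(2) by blast
  then obtain A B where AB: "open A" "open B" "z \<in> A \<times> B" "A \<times> B \<subseteq> U"
    using assms(1) open_prod_elim by blast
  have "infinite A" "infinite B"
    using AB finite_imp_not_open by (metis empty_iff mem_Times_iff)+
  then show ?thesis
    using assms(3) AB(4) by (intro eval2_eq_0_imp[of A B]) auto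
qed

text \<open>Every point with \<open>u > 0\<close> lies on a curve with some parameter
  \<open>\<xi>\<close>, so a vanishing substitution would make \<open>f\<close> vanish on an open
  half plane.\<close>

lemma subst_branch_in_coords_neq_0:
  assumes \<tau>: "linear \<tau>" "bij \<tau>" and f: "f \<noteq> 0"
  shows "subst_branch \<phi> \<omega> (in_coords \<tau> f) \<noteq> 0"
proof
  assume *: "subst_branch \<phi> \<omega> (in_coords \<tau> f) = 0"
  have "f = 0"
  proof (rule eval2_open_eq_0_imp)
    have "continuous_on UNIV \<tau>"
      using \<tau>(1) by (simp add: linear_continuous_on linear_conv_bounded_linear)
    then show "open {z. 0 < fst (\<tau> z)}"
      by (intro open_Collect_less continuous_intros)
    have "\<tau> (inv \<tau> (1, 0)) = (1, 0)"
      using \<tau>(2) by (simp add: bij_is_surj surj_f_inv_f)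
    then show "{z. 0 < fst (\<tau> z)} \<noteq> {}"
      by (metis (mono_tags, lifting) empty_Collect_eq fst_conv zero_less_one)
    fix z assume "z \<in> {z. 0 < fst (\<tau> z)}"
    then have u: "fst (\<tau> z) > 0"
      by simp
    define u v where "u = fst (\<tau> z)" and "v = snd (\<tau> z)"
    define \<xi> where "\<xi> = (v - branch_sum \<phi> u) / u powr real_of_rat \<omega>"
    have "inv \<tau> (u, branch_sum \<phi> u + \<xi> * u powr real_of_rat \<omega>) = z"
      using u \<tau>(2) by (simp add: \<xi>_def u_def v_def inv_f_f bij_is_inj)
    moreover have "u > 0"
      using u by (simp add: u_def)
    ultimately show "eval2 f z = 0"
      using branch_eval_in_coords[OF \<tau> \<open>u > 0\<close>, of \<xi> \<phi> \<omega> f] *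
      by (simp add: branch_eval_def)
  qed
  then show False
    using f by simp
qed

section \<open>\<open>delta_star\<close> as a degree function on real polynomials\<close>

lemma delta_star_mult:
  assumes \<tau>: "linear \<tau>" "bij \<tau>" and "f \<noteq> 0" "g \<noteq> 0"
  shows "delta_star \<tau> \<phi> \<omega> (f * g) = delta_star \<tau> \<phi> \<omega> f + delta_star \<tau> \<phi> \<omega> g"
  using subst_branch_in_coords_neq_0[OF \<tau>] assms(3,4)
  by (simp add: delta_star_def branch_degree_conv top_key_times ring_morphismD[OF ring_morphism_in_coords]
      ring_morphismD[OF ring_morphism_subst_branch])

lemma delta_star_add:
  assumes \<tau>: "linear \<tau>" "bij \<tau>" and "f \<noteq> 0" "g \<noteq> 0" "f + g \<noteq> 0"
  shows "delta_star \<tau> \<phi> \<omega> (f + g) \<le> max (delta_star \<tau> \<phi> \<omega> f) (delta_star \<tau> \<phi> \<omega> g)"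
    and "delta_star \<tau> \<phi> \<omega> f \<noteq> delta_star \<tau> \<phi> \<omega> g \<Longrightarrow>
      delta_star \<tau> \<phi> \<omega> (f + g) = max (delta_star \<tau> \<phi> \<omega> f) (delta_star \<tau> \<phi> \<omega> g)"
proof -
  let ?s = "\<lambda>f. subst_branch \<phi> \<omega> (in_coords \<tau> f)"
  have "?s (f + g) = ?s f + ?s g"
    by (simp add: ring_morphismD[OF ring_morphism_in_coords] ring_morphismD[OF ring_morphism_subst_branch])
  moreover have "?s f \<noteq> 0" "?s g \<noteq> 0" "?s (f + g) \<noteq> 0"
    using subst_branch_in_coords_neq_0[OF \<tau>] assms(3-5) by auto
  ultimately show "delta_star \<tau> \<phi> \<omega> (f + g) \<le> max (delta_star \<tau> \<phi> \<omega> f) (delta_star \<tau> \<phi> \<omega> g)"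
    and "delta_star \<tau> \<phi> \<omega> f \<noteq> delta_star \<tau> \<phi> \<omega> g \<Longrightarrow>
      delta_star \<tau> \<phi> \<omega> (f + g) = max (delta_star \<tau> \<phi> \<omega> f) (delta_star \<tau> \<phi> \<omega> g)"
    using top_key_add_le[of "?s f" "?s g"] top_key_add_eq[of "?s f" "?s g"]
    by (auto simp: delta_star_def branch_degree_conv)
qed

lemma branch_degree_1: "branch_degree \<phi> \<omega> 1 = 0"
  by (simp add: branch_degree_def ring_morphismD[OF ring_morphism_subst_branch])

lemma delta_star_power:
  assumes \<tau>: "linear \<tau>" "bij \<tau>" and "f \<noteq> 0"
  shows "delta_star \<tau> \<phi> \<omega> (f ^ k) = of_nat k * delta_star \<tau> \<phi> \<omega> f"
proof (induction k)
  case 0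
  then show ?case
    by (simp add: delta_star_def branch_degree_1 ring_morphismD[OF ring_morphism_in_coords])
next
  case (Suc k)
  then show ?case
    using assms by (simp add: delta_star_mult algebra_simps)
qed

lemma branch_degree_var_u: "branch_degree \<phi> \<omega> var_u = 1"
  by (simp add: branch_degree_def var_u_def subst_branch_laurent_monom)

definition linear_form :: "real \<Rightarrow> real \<Rightarrow> real poly poly" where
  "linear_form a b = [:[:a:]:] * [:[:0, 1:]:] + [:[:b:]:] * [:0, 1:]"

lemma in_coords_linear_form:
  fixes \<tau> :: "real \<times> real \<Rightarrow> real \<times> real"
  shows "in_coords \<tau> (linear_form a b) =
    const_laurent (a * fst (inv \<tau> (1, 0)) + b * snd (inv \<tau> (1, 0))) * var_u +
    const_laurent (a * fst (inv \<tau> (0, 1)) + b * snd (inv \<tau> (0, 1))) * var_v"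
  unfolding linear_form_def
  by (simp only: ring_morphismD[OF ring_morphism_in_coords] in_coords_simps
      ring_morphismD[OF ring_morphism_const_laurent])
     (simp only: algebra_simps)

text \<open>The coordinates \<open>u\<close> and \<open>v\<close> are themselves linear forms in
  \<open>x\<close> and \<open>y\<close>. \<open>U\<close> later serves as an element of degree 1,
  and \<open>U\<close>, \<open>V\<close> together produce all monomials in \<open>u\<close> and
  \<open>v\<close>.\<close>

lemma coordinate_forms:
  fixes \<tau> :: "real \<times> real \<Rightarrow> real \<times> real"
  assumes \<tau>: "linear \<tau>" "bij \<tau>"
  obtains U V where "in_coords \<tau> U = var_u" "in_coords \<tau> V = var_v"
proof -
  have expand: "\<tau> z = fst z *\<^sub>R \<tau> (1, 0) + snd z *\<^sub>R \<tau> (0, 1)" for z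
  proof -
    have "\<tau> z = \<tau> (fst z *\<^sub>R (1, 0) + snd z *\<^sub>R (0, 1))"
      by simp
    then show ?thesis
      by (simp only: linear_add[OF \<tau>(1)] linear_scale[OF \<tau>(1)])
  qed
  have coords: "fst z * fst (\<tau> (1, 0)) + snd z * fst (\<tau> (0, 1)) = fst (\<tau> z)"
    "fst z * snd (\<tau> (1, 0)) + snd z * snd (\<tau> (0, 1)) = snd (\<tau> z)" for z
    using arg_cong[OF expand[of z], of fst] arg_cong[OF expand[of z], of snd] by simp_all
  have inv: "\<tau> (inv \<tau> z) = z" for z
    using \<tau>(2) by (simp add: bij_is_surj surj_f_inv_f)
  show ?thesis
  proof
    show "in_coords \<tau> (linear_form (fst (\<tau> (1, 0))) (fst (\<tau> (0, 1)))) = var_u"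
      "in_coords \<tau> (linear_form (snd (\<tau> (1, 0))) (snd (\<tau> (0, 1)))) = var_v"
      unfolding in_coords_linear_form
      by (simp_all only: mult.commute[of "fst (\<tau> _)"] mult.commute[of "snd (\<tau> _)"] coords inv)
         (simp_all add: ring_morphismD(1,2)[OF ring_morphism_const_laurent, simplified])
  qed
qed


section \<open>Growth on a set and Puiseux asymptotics\<close>

lemma finite_total_degrees: "finite {i + j | i j. coeff (coeff f i) j \<noteq> 0}"
proof (rule finite_subset)
  show "{i + j | i j. coeff (coeff f i) j \<noteq> 0} \<subseteq>
      (\<lambda>(i, j). i + j) ` Sigma {..degree f} (\<lambda>i. {..degree (coeff f i)})"
    by (force simp: le_degree intro: le_degree)
qed auto

lemma total_degree_le_iff:
  "total_degree f \<le> n \<longleftrightarrow> (\<forall>i j. coeff (coeff f i) j \<noteq> 0 \<longrightarrow> i + j \<le> n)"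
  unfolding total_degree_def using finite_total_degrees[of f] by (subst Max_le_iff) auto

lemma total_degree_ge: "coeff (coeff f i) j \<noteq> 0 \<Longrightarrow> i + j \<le> total_degree f"
  using total_degree_le_iff by blast

lemma total_degree_mult_le: "total_degree (f * g) \<le> total_degree f + total_degree g"
  unfolding total_degree_le_iff
proof (intro allI impI)
  fix i j assume "coeff (coeff (f * g) i) j \<noteq> 0"
  then obtain i' where i': "i' \<le> i" "coeff (coeff f i' * coeff g (i - i')) j \<noteq> 0"
    by (auto simp: coeff_mult[of f g] coeff_sum elim!: sum.not_neutral_contains_not_neutral)
  then obtain j' where j': "j' \<le> j" "coeff (coeff f i') j' * coeff (coeff g (i - i')) (j - j') \<noteq> 0"
    by (auto simp: coeff_mult elim!: sum.not_neutral_contains_not_neutral)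
  have "i' + j' \<le> total_degree f" "(i - i') + (j - j') \<le> total_degree g"
    using j' by (intro total_degree_ge; simp)+
  then show "i + j \<le> total_degree f + total_degree g"
    using i'(1) j'(1) by linarith
qed

lemma total_degree_power_le: "total_degree (f ^ n) \<le> n * total_degree f"
proof (induction n)
  case 0
  show ?case
    unfolding total_degree_le_iff by (auto simp: one_pCons coeff_pCons split: nat.splits)
next
  case (Suc n)
  then show ?case
    using total_degree_mult_le[of f "f ^ n"] by simp
qed

lemma norm_real_pair: "(norm (z::real \<times> real))\<^sup>2 = (fst z)\<^sup>2 + (snd z)\<^sup>2"
  by (cases z) (simp add: norm_Pair)

lemma eval2_altdef:
  "eval2 f z = (\<Sum>i\<le>degree f. \<Sum>j\<le>degree (coeff f i). coeff (coeff f i) j * fst z ^ j * snd z ^ i)"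
  unfolding eval2_def poly_altdef[of f]
  by (simp add: poly_sum poly_altdef[of "coeff f _"] sum_distrib_right)

lemma abs_eval2_le:
  obtains C where "C \<ge> 0" "\<And>z. \<bar>eval2 f z\<bar> \<le> C * (1 + norm z) ^ total_degree f"
proof
  let ?C = "\<Sum>i\<le>degree f. \<Sum>j\<le>degree (coeff f i). \<bar>coeff (coeff f i) j\<bar>"
  show "?C \<ge> 0"
    by (intro sum_nonneg) auto
  fix z :: "real \<times> real"
  have "\<bar>coeff (coeff f i) j * fst z ^ j * snd z ^ i\<bar> \<le>
      \<bar>coeff (coeff f i) j\<bar> * (1 + norm z) ^ total_degree f" for i j
  proof (cases "coeff (coeff f i) j = 0")
    case False
    have "\<bar>fst z\<bar> \<le> 1 + norm z" "\<bar>snd z\<bar> \<le> 1 + norm z"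
      using norm_fst_le[of "fst z" "snd z"] norm_snd_le[of "snd z" "fst z"] by auto
    then have "\<bar>fst z ^ j * snd z ^ i\<bar> \<le> (1 + norm z) ^ j * (1 + norm z) ^ i"
      unfolding abs_mult power_abs by (intro mult_mono power_mono) auto
    also have "\<dots> \<le> (1 + norm z) ^ total_degree f"
      unfolding power_add[symmetric] using total_degree_ge[OF False]
      by (intro power_increasing) auto
    finally show ?thesis
      unfolding abs_mult mult.assoc by (intro mult_left_mono) auto
  qed simp
  then have "(\<Sum>i\<le>degree f. \<Sum>j\<le>degree (coeff f i). \<bar>coeff (coeff f i) j * fst z ^ j * snd z ^ i\<bar>) \<le>
      ?C * (1 + norm z) ^ total_degree f"
    unfolding sum_distrib_right by (intro sum_mono)
  moreover have "\<bar>eval2 f z\<bar> \<le>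
      (\<Sum>i\<le>degree f. \<Sum>j\<le>degree (coeff f i). \<bar>coeff (coeff f i) j * fst z ^ j * snd z ^ i\<bar>)"
    unfolding eval2_altdef by (rule order_trans[OF sum_abs sum_mono]) (rule sum_abs)
  ultimately show "\<bar>eval2 f z\<bar> \<le> ?C * (1 + norm z) ^ total_degree f"
    by (rule order_trans[rotated])
qed

text \<open>The comparison polynomial \<open>q\<close> can be traded for a power of the norm:
  \<open>q\<close> grows no faster than its degree allows, and conversely a multiple of a power of
  \<open>1 + x^2 + y^2\<close> is an admissible \<open>q\<close>.\<close>

lemma growth_space_iff:
  "p \<in> growth_space S d \<longleftrightarrow> (\<exists>C. \<forall>z\<in>S. \<bar>eval2 p z\<bar> \<le> C * (1 + norm z) ^ d)"
proof
  assume "p \<in> growth_space S d"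
  then obtain q where q: "total_degree q \<le> 2 * d" "\<And>z. z \<in> S \<Longrightarrow> (eval2 p z)\<^sup>2 \<le> eval2 q z"
    by (auto simp: growth_space_def)
  obtain C where C: "C \<ge> 0" "\<And>z. \<bar>eval2 q z\<bar> \<le> C * (1 + norm z) ^ total_degree q"
    using abs_eval2_le[of q] by metis
  show "\<exists>C. \<forall>z\<in>S. \<bar>eval2 p z\<bar> \<le> C * (1 + norm z) ^ d"
  proof (intro exI ballI)
    fix z assume z: "z \<in> S"
    have "(eval2 p z)\<^sup>2 \<le> C * (1 + norm z) ^ total_degree q"
      using q(2)[OF z] C(2)[of z] by linarith
    also have "\<dots> \<le> C * (1 + norm z) ^ (2 * d)"
      using q(1) C(1) by (intro mult_left_mono power_increasing) auto
    also have "\<dots> = (sqrt C * (1 + norm z) ^ d)\<^sup>2"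
      by (simp only: power_mult_distrib real_sqrt_pow2[OF C(1)] power_mult[symmetric] mult.commute[of 2 d])
    finally show "\<bar>eval2 p z\<bar> \<le> sqrt C * (1 + norm z) ^ d"
      using C(1) by (auto intro: power2_le_imp_le[of "\<bar>eval2 p z\<bar>"])
  qed
next
  assume "\<exists>C. \<forall>z\<in>S. \<bar>eval2 p z\<bar> \<le> C * (1 + norm z) ^ d"
  then obtain C where C: "\<And>z. z \<in> S \<Longrightarrow> \<bar>eval2 p z\<bar> \<le> C * (1 + norm z) ^ d"
    by blast
  define r :: "real poly poly" where "r = [:[:1, 0, 1:], 0, 1:]"
  \<comment> \<open>The factor \<open>2 ^ d\<close> comes from
    \<open>(1 + t)^2 \<le> 2 * (1 + t^2)\<close>, with \<open>t\<close> the norm.\<close>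
  define q where "q = [:[:C\<^sup>2 * 2 ^ d:]:] * r ^ d"
  have "total_degree r \<le> 2"
    unfolding total_degree_le_iff r_def by (auto simp: coeff_pCons split: nat.splits)
  then have "total_degree (r ^ d) \<le> 2 * d"
    using total_degree_power_le[of r d] by (metis mult.commute mult_le_mono2 order_trans)
  moreover have "total_degree [:[:C\<^sup>2 * 2 ^ d:]:] = 0"
    using total_degree_le_iff[of "[:[:C\<^sup>2 * 2 ^ d:]:]" 0] by (auto simp: coeff_pCons split: nat.splits)
  ultimately have "total_degree q \<le> 2 * d"
    using total_degree_mult_le[of "[:[:C\<^sup>2 * 2 ^ d:]:]" "r ^ d"] by (simp add: q_def)
  moreover have "(eval2 p z)\<^sup>2 \<le> eval2 q z" if z: "z \<in> S" for z
  proof -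
    have r: "eval2 r z = 1 + (norm z)\<^sup>2"
      using norm_real_pair[of z] by (simp add: r_def eval2_def power2_eq_square)
    have "(eval2 p z)\<^sup>2 \<le> (C * (1 + norm z) ^ d)\<^sup>2"
      using C[OF z] by (intro abs_le_square_iff[THEN iffD1]) auto
    also have "\<dots> = C\<^sup>2 * ((1 + norm z)\<^sup>2) ^ d"
      by (simp only: power_mult_distrib power_mult[symmetric] mult.commute[of 2 d])
    also have "\<dots> \<le> C\<^sup>2 * (2 * (1 + (norm z)\<^sup>2)) ^ d"
      using sum_squares_bound[of 1 "norm z"]
      by (intro mult_left_mono power_mono) (auto simp: power2_sum)
    also have "\<dots> = eval2 q z"
      unfolding q_def ring_morphismD(4)[OF ring_morphism_eval2] ring_morphism_power[OF ring_morphism_eval2] r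
        power_mult_distrib
      by (simp add: eval2_def)
    finally show ?thesis .
  qed
  ultimately show "p \<in> growth_space S d"
    by (auto simp: growth_space_def)
qed

lemma growth_degree_eqI:
  assumes "\<exists>C. \<forall>z\<in>S. \<bar>eval2 p z\<bar> \<le> C * (1 + norm z) ^ n"
    and "\<And>d C. (\<And>z. z \<in> S \<Longrightarrow> \<bar>eval2 p z\<bar> \<le> C * (1 + norm z) ^ d) \<Longrightarrow> n \<le> d"
  shows "growth_degree S p = n"
  unfolding growth_degree_def
proof (rule Least_equality)
  show "p \<in> growth_space S n"
    using assms(1) by (simp only: growth_space_iff)
  fix d assume "p \<in> growth_space S d"
  then obtain C where "\<forall>z\<in>S. \<bar>eval2 p z\<bar> \<le> C * (1 + norm z) ^ d"
    by (auto simp only: growth_space_iff)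
  then show "n \<le> d"
    by (intro assms(2)[of C d]) auto
qed


text \<open>The bound is uniform in \<open>\<xi>\<close> because the points of the tentacle at a
  given \<open>u\<close> fill an interval of parameters and not a single curve.\<close>

lemma norm_branch_eval_le:
  assumes "\<And>r. r \<in> Poly_Mapping.keys F \<Longrightarrow> r \<le> \<gamma>"
  obtains C where "C \<ge> 0"
    "\<And>u \<xi>. u \<ge> 1 \<Longrightarrow> \<bar>\<xi>\<bar> \<le> B \<Longrightarrow> norm (branch_eval u \<xi> F) \<le> C * u powr real_of_rat \<gamma>"
proof -
  have "\<exists>m>0. \<forall>z. norm z \<le> B \<longrightarrow> norm (poly p z) \<le> m" for p :: "complex poly"
    using poly_bound_exists[of B p] by blast
  then obtain m where m: "\<And>p::complex poly. m p > 0"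
    "\<And>(p::complex poly) z. norm z \<le> B \<Longrightarrow> norm (poly p z) \<le> m p"
    by metis
  show ?thesis
  proof
    show "(\<Sum>r\<in>Poly_Mapping.keys F. m (Poly_Mapping.lookup F r)) \<ge> 0"
      using m(1) by (intro sum_nonneg) (auto intro: less_imp_le)
    fix u \<xi> :: real assume u: "u \<ge> 1" and \<xi>: "\<bar>\<xi>\<bar> \<le> B"
    have "norm (branch_eval u \<xi> F) \<le>
        (\<Sum>r\<in>Poly_Mapping.keys F. m (Poly_Mapping.lookup F r) * u powr real_of_rat \<gamma>)"
      unfolding branch_eval_def keys_sum_def
    proof (rule sum_norm_le)
      fix r assume r: "r \<in> Poly_Mapping.keys F"
      have "real_of_rat r \<le> real_of_rat \<gamma>"
        using assms[OF r] by (simp add: of_rat_less_eq)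
      then show "norm (poly (Poly_Mapping.lookup F r) (complex_of_real \<xi>) * complex_of_real (u powr real_of_rat r))
          \<le> m (Poly_Mapping.lookup F r) * u powr real_of_rat \<gamma>"
        using u \<xi> m(1)[of "Poly_Mapping.lookup F r", THEN less_imp_le]
        unfolding norm_mult by (intro mult_mono m(2)) (auto intro: powr_mono)
    qed
    then show "norm (branch_eval u \<xi> F) \<le>
        (\<Sum>r\<in>Poly_Mapping.keys F. m (Poly_Mapping.lookup F r)) * u powr real_of_rat \<gamma>"
      by (simp add: sum_distrib_right)
  qed
qed

lemma powr_quotient_tendsto_0:
  assumes "r < s"
  shows "((\<lambda>u::real. u powr r / u powr s) \<longlongrightarrow> 0) at_top"
proof -
  have "((\<lambda>u::real. u powr (r - s)) \<longlongrightarrow> 0) at_top"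
    using assms by (intro tendsto_neg_powr filterlim_ident) auto
  then show ?thesis
    by (simp add: powr_diff)
qed

lemma tendsto_branch_eval:
  assumes le: "\<And>r. r \<in> Poly_Mapping.keys F \<Longrightarrow> r \<le> \<gamma>"
  shows "((\<lambda>u. branch_eval u \<xi> F / complex_of_real (u powr real_of_rat \<gamma>)) \<longlongrightarrow>
      poly (Poly_Mapping.lookup F \<gamma>) (complex_of_real \<xi>)) at_top"
proof -
  let ?p = "\<lambda>r. poly (Poly_Mapping.lookup F r) (complex_of_real \<xi>)"
  have "((\<lambda>u. \<Sum>r\<in>Poly_Mapping.keys F. ?p r * complex_of_real (u powr real_of_rat r / u powr real_of_rat \<gamma>))
      \<longlongrightarrow> (\<Sum>r\<in>Poly_Mapping.keys F. ?p r * complex_of_real (if r = \<gamma> then 1 else 0))) at_top"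
  proof (intro tendsto_intros)
    fix r assume r: "r \<in> Poly_Mapping.keys F"
    show "((\<lambda>u. u powr real_of_rat r / u powr real_of_rat \<gamma>) \<longlongrightarrow> (if r = \<gamma> then 1 else 0)) at_top"
    proof (cases "r = \<gamma>")
      case True
      have "\<forall>\<^sub>F u::real in at_top. u powr real_of_rat r / u powr real_of_rat \<gamma> = 1"
        using eventually_gt_at_top[of 0] by eventually_elim (simp add: True)
      then show ?thesis
        using True by (simp add: tendsto_eventually)
    next
      case False
      then have "real_of_rat r < real_of_rat \<gamma>"
        using le[OF r] by (simp add: of_rat_less)
      then show ?thesis
        using False powr_quotient_tendsto_0 by simp
    qed
  qed
  moreover have "(\<Sum>r\<in>Poly_Mapping.keys F. ?p r * complex_of_real (if r = \<gamma> then 1 else 0)) = ?p \<gamma>"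
    by (simp add: if_distrib in_keys_iff cong: if_cong)
  ultimately show ?thesis
    by (simp add: branch_eval_def keys_sum_def sum_divide_distrib)
qed

section \<open>Asymptotics of Puiseux series\<close>

lemma puiseux_gap:
  assumes "puiseux c"
  obtains \<omega>' where "\<omega>' < \<omega>" "\<And>q. c q \<noteq> 0 \<Longrightarrow> q < \<omega> \<Longrightarrow> q \<le> \<omega>'"
proof -
  obtain n :: nat where n: "n > 0" "\<And>q. c q \<noteq> 0 \<Longrightarrow> of_nat n * q \<in> \<int>"
    using assms by (auto simp: puiseux_def)
  \<comment> \<open>All exponents are multiples of \<open>1 / n\<close>, and \<open>?m / n\<close>
    is the largest such multiple strictly below \<open>\<omega>\<close>.\<close>
  let ?m = "\<lceil>of_nat n * \<omega>\<rceil> - 1"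
  show ?thesis
  proof
    have "of_int ?m < of_nat n * \<omega>"
      by linarith
    then show "of_int ?m / of_nat n < \<omega>"
      using n(1) by (simp add: field_simps)
    fix q assume q: "c q \<noteq> 0" "q < \<omega>"
    obtain k where k: "of_nat n * q = of_int k"
      using n(2)[OF q(1)] by (auto elim: Ints_cases)
    have "of_nat n * q < of_nat n * \<omega>"
      using q(2) n(1) by simp
    then have "k \<le> ?m"
      unfolding k by (simp add: less_ceiling_iff)
    then have "of_nat n * q \<le> of_int ?m"
      unfolding k by (simp only: of_int_le_iff)
    then show "q \<le> of_int ?m / of_nat n"
      using n(1) by (simp add: field_simps)
  qed
qed

text \<open>Once the terms with exponent at least \<open>\<omega>\<close> are removed, all exponents
  are at most some \<open>\<omega>' < \<omega>\<close>. The tail converges absolutely at one point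
  \<open>u0\<close>, and from \<open>u0\<close> to \<open>u\<close> each of its terms grows at most
  by the factor \<open>(u / u0)^\<omega>'\<close>; hence the tail is of smaller order than
  \<open>u^\<omega>\<close>.\<close>

lemma puiseux_asymptotics:
  assumes c: "puiseux c"
    and \<phi>: "\<And>q. Poly_Mapping.lookup \<phi> q = (if q > \<omega> then c q else 0)"
    and v: "\<forall>\<^sub>F u in at_top. puiseux_sums c u (v u)"
  shows "((\<lambda>u. (v u - branch_sum \<phi> u) / u powr real_of_rat \<omega>) \<longlongrightarrow> c \<omega>) at_top"
proof -
  let ?K = "insert \<omega> (Poly_Mapping.keys \<phi>)"
  obtain \<omega>' where \<omega>': "\<omega>' < \<omega>" "\<And>q. c q \<noteq> 0 \<Longrightarrow> q < \<omega> \<Longrightarrow> q \<le> \<omega>'"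
    using puiseux_gap[OF c] by blast
  obtain U where "\<And>u. u \<ge> U \<Longrightarrow> puiseux_sums c u (v u)"
    using v by (auto simp: eventually_at_top_linorder)
  then obtain u0 where u0: "u0 \<ge> 1" "\<And>u. u \<ge> u0 \<Longrightarrow> puiseux_sums c u (v u)"
    using that[of "max 1 U"] by auto
  define t where "t u = v u - branch_sum \<phi> u - c \<omega> * u powr real_of_rat \<omega>" for u
  have \<omega>_notin: "\<omega> \<notin> Poly_Mapping.keys \<phi>"
    by (simp add: in_keys_iff \<phi>)
  have tail: "((\<lambda>q. c q * u powr real_of_rat q) has_sum t u) (UNIV - ?K)" if "u \<ge> u0" for u
  proof -
    have "(\<Sum>q\<in>Poly_Mapping.keys \<phi>. c q * u powr real_of_rat q) = branch_sum \<phi> u"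
      unfolding branch_sum_def by (intro sum.cong) (auto simp: in_keys_iff \<phi> split: if_splits)
    then have "(\<Sum>q\<in>?K. c q * u powr real_of_rat q) = branch_sum \<phi> u + c \<omega> * u powr real_of_rat \<omega>"
      using \<omega>_notin by simp
    then have "((\<lambda>q. c q * u powr real_of_rat q) has_sum
        (branch_sum \<phi> u + c \<omega> * u powr real_of_rat \<omega>)) ?K"
      by (intro has_sum_finiteI) auto
    from has_sum_Diff[OF u0(2)[OF that, unfolded puiseux_sums_def] this]
    show ?thesis
      by (simp add: t_def algebra_simps)
  qed
  have small: "q \<le> \<omega>'" if "q \<notin> ?K" "c q \<noteq> 0" for q
    using that \<omega>'(2)[of q] by (auto simp: in_keys_iff \<phi> split: if_splits)
  let ?g = "\<lambda>q. \<bar>c q * u0 powr real_of_rat q\<bar>"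
  define M where "M = infsum ?g (UNIV - ?K)"
  have "(\<lambda>q. c q * u0 powr real_of_rat q) summable_on (UNIV - ?K)"
    using tail[of u0] by (auto simp: summable_on_def)
  then have M: "(?g has_sum M) (UNIV - ?K)"
    unfolding M_def by (subst (asm) summable_on_iff_abs_summable_on_real) (simp add: has_sum_infsum)
  have bound: "\<bar>t u\<bar> \<le> M * (u / u0) powr real_of_rat \<omega>'" if u: "u \<ge> u0" for u
  proof -
    have "norm (t u) \<le> M * (u / u0) powr real_of_rat \<omega>'"
    proof (rule norm_infsum_le[OF tail[OF u] has_sum_cmult_left[OF M]])
      fix q assume q: "q \<in> UNIV - ?K"
      show "norm (c q * u powr real_of_rat q) \<le> ?g q * (u / u0) powr real_of_rat \<omega>'"
      proof (cases "c q = 0")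
        case False
        then have "real_of_rat q \<le> real_of_rat \<omega>'"
          using small q by (simp add: of_rat_less_eq)
        then have "(u / u0) powr real_of_rat q \<le> (u / u0) powr real_of_rat \<omega>'"
          using u u0(1) by (intro powr_mono) auto
        then have "u0 powr real_of_rat q * (u / u0) powr real_of_rat q \<le>
            u0 powr real_of_rat q * (u / u0) powr real_of_rat \<omega>'"
          by (intro mult_left_mono) auto
        moreover have "u0 powr real_of_rat q * (u / u0) powr real_of_rat q = u powr real_of_rat q"
          using u u0(1) by (simp flip: powr_mult)
        ultimately show ?thesis
          by (simp add: abs_mult mult.assoc mult_left_mono)
      qed simp
    qed
    then show ?thesis
      by simp
  qed
  have "((\<lambda>u. t u / u powr real_of_rat \<omega>) \<longlongrightarrow> 0) at_top"
  proof (rule Lim_null_comparison)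
    show "\<forall>\<^sub>F u in at_top. norm (t u / u powr real_of_rat \<omega>) \<le>
        M * (1 / u0) powr real_of_rat \<omega>' * (u powr real_of_rat \<omega>' / u powr real_of_rat \<omega>)"
      using eventually_ge_at_top[of u0]
    proof eventually_elim
      case (elim u)
      have "(u / u0) powr real_of_rat \<omega>' = (1 / u0) powr real_of_rat \<omega>' * u powr real_of_rat \<omega>'"
        using elim u0(1) by (simp flip: powr_mult)
      then show ?case
        using bound[OF elim] by (simp add: divide_right_mono mult.assoc)
    qed
    have "((\<lambda>u. u powr real_of_rat \<omega>' / u powr real_of_rat \<omega>) \<longlongrightarrow> 0) at_top"
      using \<omega>'(1) by (intro powr_quotient_tendsto_0) (simp add: of_rat_less)
    then show "((\<lambda>u. M * (1 / u0) powr real_of_rat \<omega>' * (u powr real_of_rat \<omega>' / u powr real_of_rat \<omega>)) \<longlongrightarrow> 0) at_top"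
      by (rule tendsto_mult_right_zero)
  qed
  then have "((\<lambda>u. t u / u powr real_of_rat \<omega> + c \<omega>) \<longlongrightarrow> 0 + c \<omega>) at_top"
    by (intro tendsto_intros)
  moreover have "\<forall>\<^sub>F u in at_top. t u / u powr real_of_rat \<omega> + c \<omega> = (v u - branch_sum \<phi> u) / u powr real_of_rat \<omega>"
    using eventually_gt_at_top[of 0] by eventually_elim (simp add: t_def diff_divide_distrib)
  ultimately show ?thesis
    using tendsto_cong by fastforce
qed


section \<open>Growth along a tentacle with one point at infinity\<close>

lemma ceiling_of_rat: "\<lceil>real_of_rat q\<rceil> = \<lceil>q\<rceil>"
proof (rule ceiling_unique)
  show "of_int \<lceil>q\<rceil> - 1 < real_of_rat q"
    by (metis ceiling_correct of_rat_1 of_rat_diff of_rat_less of_rat_of_int_eq)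
  show "real_of_rat q \<le> of_int \<lceil>q\<rceil>"
    by (metis ceiling_correct of_rat_less_eq of_rat_of_int_eq)
qed

text \<open>Turns numerical bounds into bounds on formal exponents: for \<open>\<xi>\<close> off the
  roots of the top coefficient, the evaluation is asymptotic to a nonzero multiple of
  \<open>u^\<gamma>\<close>.\<close>

lemma branch_exponent_le:
  assumes le: "\<And>r. r \<in> Poly_Mapping.keys F \<Longrightarrow> r \<le> \<gamma>"
    and nz: "poly (Poly_Mapping.lookup F \<gamma>) (complex_of_real \<xi>) \<noteq> 0"
    and bound: "\<forall>\<^sub>F u in at_top. norm (branch_eval u \<xi> F) \<le> C * u powr d"
  shows "real_of_rat \<gamma> \<le> d"
proof (rule ccontr)
  assume "\<not> real_of_rat \<gamma> \<le> d"
  then have "((\<lambda>u. C * (u powr d / u powr real_of_rat \<gamma>)) \<longlongrightarrow> 0) at_top"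
    by (intro tendsto_mult_right_zero powr_quotient_tendsto_0) auto
  moreover have "\<forall>\<^sub>F u in at_top. norm (branch_eval u \<xi> F / complex_of_real (u powr real_of_rat \<gamma>)) \<le>
      C * (u powr d / u powr real_of_rat \<gamma>)"
    using bound by eventually_elim (simp add: norm_divide divide_right_mono)
  ultimately have "((\<lambda>u. branch_eval u \<xi> F / complex_of_real (u powr real_of_rat \<gamma>)) \<longlongrightarrow> 0) at_top"
    by (rule Lim_null_comparison[rotated])
  then show False
    using tendsto_unique[OF _ tendsto_branch_eval[OF le]] nz by fastforce
qed

lemma branching_data_D:
  assumes c: "puiseux c1" "puiseux c2" "c1 \<noteq> c2" and b: "branching_data c1 c2 \<phi> \<omega>"
  shows "c1 \<omega> \<noteq> c2 \<omega>" "\<omega> \<le> 1" "\<And>q. q \<in> Poly_Mapping.keys \<phi> \<Longrightarrow> q \<le> 1"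
    "\<And>q. Poly_Mapping.lookup \<phi> q = (if q > \<omega> then c1 q else 0)"
    "\<And>q. Poly_Mapping.lookup \<phi> q = (if q > \<omega> then c2 q else 0)"
proof -
  have agree: "c1 q = c2 q" if "q > \<omega>" for q
    using b that by (auto simp: branching_data_def)
  have min: "\<omega> \<le> w" if "\<And>q. q > w \<Longrightarrow> c1 q = c2 q" for w
    using b that by (auto simp: branching_data_def)
  have le1: "q \<le> 1" if "c1 q \<noteq> 0 \<or> c2 q \<noteq> 0" for q
    using c(1,2) that by (auto simp: puiseux_def)
  \<comment> \<open>Agreement at \<open>\<omega>\<close> would persist down to the next exponent
    occurring in either series, against the minimality of \<open>\<omega>\<close>.\<close>
  show "c1 \<omega> \<noteq> c2 \<omega>"
  proof
    assume eq: "c1 \<omega> = c2 \<omega>"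
    obtain w1 where w1: "w1 < \<omega>" "\<And>q. c1 q \<noteq> 0 \<Longrightarrow> q < \<omega> \<Longrightarrow> q \<le> w1"
      using puiseux_gap[OF c(1)] by blast
    obtain w2 where w2: "w2 < \<omega>" "\<And>q. c2 q \<noteq> 0 \<Longrightarrow> q < \<omega> \<Longrightarrow> q \<le> w2"
      using puiseux_gap[OF c(2)] by blast
    have "\<omega> \<le> max w1 w2"
    proof (rule min)
      fix q assume q: "q > max w1 w2"
      show "c1 q = c2 q"
        using agree[of q] eq w1(2)[of q] w2(2)[of q] q by (cases q \<omega> rule: linorder_cases) fastforce+
    qed
    then show False
      using w1(1) w2(1) by simp
  qed
  then show "\<omega> \<le> 1"
    using le1[of \<omega>] by auto
  show lookup1: "Poly_Mapping.lookup \<phi> q = (if q > \<omega> then c1 q else 0)" for q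
    using b by (auto simp: branching_data_def)
  then show "Poly_Mapping.lookup \<phi> q = (if q > \<omega> then c2 q else 0)" for q
    using agree by simp
  show "q \<le> 1" if "q \<in> Poly_Mapping.keys \<phi>" for q
    using that le1[of q] by (auto simp: in_keys_iff lookup1 split: if_splits)
qed

lemma powr_le_self: "q \<le> 1 \<Longrightarrow> u \<ge> 1 \<Longrightarrow> u powr real_of_rat q \<le> u"
  using powr_mono[of "real_of_rat q" 1 u] by simp

lemma abs_branch_sum_le:
  assumes "\<And>q. q \<in> Poly_Mapping.keys \<phi> \<Longrightarrow> q \<le> 1" "u \<ge> 1"
  shows "\<bar>branch_sum \<phi> u\<bar> \<le> (\<Sum>q\<in>Poly_Mapping.keys \<phi>. \<bar>Poly_Mapping.lookup \<phi> q\<bar>) * u"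
proof -
  have "\<bar>branch_sum \<phi> u\<bar> \<le> (\<Sum>q\<in>Poly_Mapping.keys \<phi>. \<bar>Poly_Mapping.lookup \<phi> q * u powr real_of_rat q\<bar>)"
    unfolding branch_sum_def by (rule sum_abs)
  also have "\<dots> \<le> (\<Sum>q\<in>Poly_Mapping.keys \<phi>. \<bar>Poly_Mapping.lookup \<phi> q\<bar> * u)"
    using assms powr_le_self by (intro sum_mono) (auto simp: abs_mult intro!: mult_left_mono)
  finally show ?thesis
    by (simp add: sum_distrib_right)
qed

lemma ex_nonroot_between:
  fixes p :: "complex poly" and a b :: real
  assumes "p \<noteq> 0" "a < b"
  obtains \<xi> where "a < \<xi>" "\<xi> < b" "poly p (complex_of_real \<xi>) \<noteq> 0"
proof -
  have "finite (complex_of_real -` {x. poly p x = 0})"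
    using assms(1) by (intro finite_vimageI poly_roots_finite) (auto intro: injI)
  then have "\<not> {a<..<b} \<subseteq> complex_of_real -` {x. poly p x = 0}"
    using assms(2) finite_subset infinite_Ioo by metis
  then obtain \<xi> where "\<xi> \<in> {a<..<b}" "\<xi> \<notin> complex_of_real -` {x. poly p x = 0}"
    by blast
  then show ?thesis
    using that[of \<xi>] by simp
qed

text \<open>Upper bound: the parameters of both branches converge, so far out all points of
  \<open>S\<close> have \<open>\<xi>\<close> in a bounded interval. Lower bound: a single curve
  inside \<open>S\<close> on which the top coefficient does not vanish.\<close>

lemma growth_degree_tentacle:
  assumes \<tau>: "linear \<tau>" "bij \<tau>"
    and along: "filterlim (\<lambda>z. fst (\<tau> z)) at_top (inf at_infinity (principal S))"
    and c: "puiseux c1" "puiseux c2" "c1 \<noteq> c2"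
    and bounded: "bounded_by_branches S \<tau> c1 c2" and data: "branching_data c1 c2 \<phi> \<omega>"
    and f: "f \<noteq> 0"
  shows "growth_degree S f = nat \<lceil>delta_star \<tau> \<phi> \<omega> f\<rceil>"
proof (rule growth_degree_eqI)
  define F where "F = subst_branch \<phi> \<omega> (in_coords \<tau> f)"
  define \<gamma> where "\<gamma> = delta_star \<tau> \<phi> \<omega> f"
  have \<gamma>: "\<gamma> = top_key F"
    by (simp add: \<gamma>_def F_def delta_star_def branch_degree_conv)
  have F: "Poly_Mapping.lookup F \<gamma> \<noteq> 0"
    using top_key_in[of F] subst_branch_in_coords_neq_0[OF \<tau> f] by (simp add: \<gamma> F_def in_keys_iff)
  have F_le: "r \<le> \<gamma>" if "r \<in> Poly_Mapping.keys F" for r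
    using that top_key_ge \<gamma> by blast
  note \<omega> = branching_data_D[OF c data]
  let ?s = "branch_sum \<phi>" and ?w = "\<lambda>u. u powr real_of_rat \<omega>"
  have "\<forall>\<^sub>F u in at_top. \<exists>v1 v2. puiseux_sums c1 u v1 \<and> puiseux_sums c2 u v2 \<and>
      open_segment v1 v2 \<subseteq> {v. (u, v) \<in> \<tau> ` S} \<and> {v. (u, v) \<in> \<tau> ` S} \<subseteq> closed_segment v1 v2"
    using bounded by (simp add: bounded_by_branches_def)
  then obtain v1 v2 where v: "\<forall>\<^sub>F u in at_top. puiseux_sums c1 u (v1 u) \<and> puiseux_sums c2 u (v2 u) \<and>
      open_segment (v1 u) (v2 u) \<subseteq> {v. (u, v) \<in> \<tau> ` S} \<and>
      {v. (u, v) \<in> \<tau> ` S} \<subseteq> closed_segment (v1 u) (v2 u)"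
    unfolding eventually_ex by blast
  define \<xi>1 \<xi>2 where "\<xi>1 u = (v1 u - ?s u) / ?w u" and "\<xi>2 u = (v2 u - ?s u) / ?w u" for u
  have \<xi>_lim: "(\<xi>1 \<longlongrightarrow> c1 \<omega>) at_top" "(\<xi>2 \<longlongrightarrow> c2 \<omega>) at_top"
    unfolding \<xi>1_def \<xi>2_def using c(1,2) \<omega>(4,5) v
    by (auto intro!: puiseux_asymptotics elim!: eventually_mono)
  have on_branch: "\<tau> z = (u, ?s u + \<xi> * ?w u) \<Longrightarrow> u > 0 \<Longrightarrow>
      branch_eval u \<xi> F = complex_of_real (eval2 f z)" for z u \<xi>
    using branch_eval_in_coords[OF \<tau>, of u \<xi> \<phi> \<omega> f] \<tau>(2) unfolding F_def
    by (metis bij_is_inj inv_f_f)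
  show "\<exists>C. \<forall>z\<in>S. \<bar>eval2 f z\<bar> \<le> C * (1 + norm z) ^ nat \<lceil>delta_star \<tau> \<phi> \<omega> f\<rceil>"
  proof -
    \<comment> \<open>The extra 1 leaves room for branch parameters that are only close to their
      limits \<open>c1 \<omega>\<close> and \<open>c2 \<omega>\<close>.\<close>
    define B where "B = \<bar>c1 \<omega>\<bar> + \<bar>c2 \<omega>\<bar> + 1"
    have "\<forall>\<^sub>F u in at_top. \<bar>\<xi>1 u\<bar> < B" "\<forall>\<^sub>F u in at_top. \<bar>\<xi>2 u\<bar> < B"
      using order_tendstoD(2)[OF tendsto_rabs[OF \<xi>_lim(1)], of B]
        order_tendstoD(2)[OF tendsto_rabs[OF \<xi>_lim(2)], of B] by (auto simp: B_def)
    then have "\<forall>\<^sub>F u in at_top. u \<ge> 1 \<and> (\<forall>v. (u, v) \<in> \<tau> ` S \<longrightarrow> \<bar>(v - ?s u) / ?w u\<bar> \<le> B)"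
      using v eventually_ge_at_top[of 1]
    proof eventually_elim
      case (elim u)
      have w: "?w u > 0"
        using elim by simp
      then have "v1 u \<in> cball (?s u) (B * ?w u)" "v2 u \<in> cball (?s u) (B * ?w u)"
        using elim(1,2) by (auto simp: \<xi>1_def \<xi>2_def dist_real_def abs_minus_commute field_simps)
      then have "closed_segment (v1 u) (v2 u) \<subseteq> cball (?s u) (B * ?w u)"
        by (intro closed_segment_subset convex_cball)
      then have "\<bar>v - ?s u\<bar> \<le> B * ?w u" if "(u, v) \<in> \<tau> ` S" for v
        using elim(3) that by (fastforce simp: dist_real_def abs_minus_commute)
      then show ?case
        using elim(4) w by (simp add: abs_divide field_simps)
    qed
    then obtain U where U: "\<And>u. u \<ge> U \<Longrightarrow> u \<ge> 1" "\<And>u v. u \<ge> U \<Longrightarrow> (u, v) \<in> \<tau> ` S \<Longrightarrow> \<bar>(v - ?s u) / ?w u\<bar> \<le> B"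
      unfolding eventually_at_top_linorder by blast
    have "\<forall>\<^sub>F z in inf at_infinity (principal S). fst (\<tau> z) \<ge> U"
      using along by (simp add: filterlim_at_top)
    then obtain R where R: "\<And>z. norm z \<ge> R \<Longrightarrow> z \<in> S \<Longrightarrow> fst (\<tau> z) \<ge> U"
      by (auto simp: eventually_inf_principal eventually_at_infinity)
    obtain C where C: "C \<ge> 0" "\<And>u \<xi>. u \<ge> 1 \<Longrightarrow> \<bar>\<xi>\<bar> \<le> B \<Longrightarrow> norm (branch_eval u \<xi> F) \<le> C * u powr real_of_rat \<gamma>"
      using norm_branch_eval_le[of F \<gamma> B] F_le by metis
    \<comment> \<open>The part of \<open>S\<close> with small \<open>u\<close> is bounded, since
      \<open>u\<close> tends to infinity along \<open>S\<close>; there the crude bound by the total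
      degree suffices.\<close>
    obtain K where K: "K \<ge> 0" "\<And>z. \<bar>eval2 f z\<bar> \<le> K * (1 + norm z) ^ total_degree f"
      using abs_eval2_le[of f] by metis
    obtain L where L: "L > 0" "\<And>z. norm (\<tau> z) \<le> norm z * L"
      using bounded_linear.pos_bounded[of \<tau>] \<tau>(1) by (auto simp: linear_conv_bounded_linear)
    let ?n = "nat \<lceil>\<gamma>\<rceil>"
    \<comment> \<open>\<open>nat\<close> replaces a negative ceiling by 0, which only weakens a
      bound for \<open>u \<ge> 1\<close>.\<close>
    have le: "real_of_rat \<gamma> \<le> real ?n"
        using real_nat_ceiling_ge[of "real_of_rat \<gamma>"] by (simp add: ceiling_of_rat)
    have bound: "\<bar>eval2 f z\<bar> \<le> (C * L ^ ?n + K * (1 + \<bar>R\<bar>) ^ total_degree f) * (1 + norm z) ^ ?n" if z: "z \<in> S" for z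
    proof (cases "fst (\<tau> z) \<ge> U")
      case True
      define u \<xi> where "u = fst (\<tau> z)" and "\<xi> = (snd (\<tau> z) - ?s u) / ?w u"
      have u: "u \<ge> 1"
        using U(1) True by (simp add: u_def)
      have "(u, snd (\<tau> z)) \<in> \<tau> ` S"
        using z by (simp add: u_def)
      then have \<xi>: "\<bar>\<xi>\<bar> \<le> B"
        using U(2)[of u] True by (simp add: \<xi>_def u_def)
      have "\<tau> z = (u, ?s u + \<xi> * ?w u)"
        using u by (simp add: \<xi>_def u_def)
      then have "\<bar>eval2 f z\<bar> = norm (branch_eval u \<xi> F)"
        using on_branch[of z u \<xi>] u by simp
      also have "\<dots> \<le> C * u powr real_of_rat \<gamma>"
        using C(2) u \<xi> by blast
      also have "\<dots> \<le> C * u ^ ?n"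
        using u C(1) le by (auto intro!: mult_left_mono powr_mono simp flip: powr_realpow)
      also have "\<dots> \<le> C * (L * (1 + norm z)) ^ ?n"
      proof -
        have "u \<le> norm (\<tau> z)"
          using norm_fst_le[of "fst (\<tau> z)" "snd (\<tau> z)"] by (simp add: u_def)
        also have "\<dots> \<le> L * (1 + norm z)"
          using L by (smt (verit) mult.commute mult_left_mono norm_ge_zero)
        finally show ?thesis
          using C(1) u by (intro mult_left_mono power_mono) auto
      qed
      also have "\<dots> \<le> (C * L ^ ?n + K * (1 + \<bar>R\<bar>) ^ total_degree f) * (1 + norm z) ^ ?n"
        unfolding power_mult_distrib mult.assoc[symmetric] using K(1) by (intro mult_right_mono) auto
      finally show ?thesis .
    next
      case False
      then have "norm z \<le> \<bar>R\<bar>"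
        using R[of z] z by (cases "norm z \<ge> R") auto
      then have "\<bar>eval2 f z\<bar> \<le> K * (1 + \<bar>R\<bar>) ^ total_degree f * 1"
        using K order_trans[OF K(2) mult_left_mono[OF power_mono, of "1 + norm z" "1 + \<bar>R\<bar>" K "total_degree f"]]
        by auto
      also have "\<dots> \<le> (C * L ^ ?n + K * (1 + \<bar>R\<bar>) ^ total_degree f) * (1 + norm z) ^ ?n"
        using C(1) L(1) K(1) by (intro mult_mono one_le_power) auto
      finally show ?thesis .
    qed
    then show ?thesis
      unfolding \<gamma>_def by blast
  qed
  fix d C assume C: "\<And>z. z \<in> S \<Longrightarrow> \<bar>eval2 f z\<bar> \<le> C * (1 + norm z) ^ d"
  \<comment> \<open>Strictly between the limits, so that for large \<open>u\<close> the curve with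
    parameter \<open>\<xi>\<close> runs between the two branches and therefore inside
    \<open>S\<close>.\<close>
  obtain \<xi> where \<xi>: "min (c1 \<omega>) (c2 \<omega>) < \<xi>" "\<xi> < max (c1 \<omega>) (c2 \<omega>)"
      "poly (Poly_Mapping.lookup F \<gamma>) (complex_of_real \<xi>) \<noteq> 0"
    using ex_nonroot_between[OF F, of "min (c1 \<omega>) (c2 \<omega>)" "max (c1 \<omega>) (c2 \<omega>)"] \<omega>(1)
    by (metis max_def min_def not_le order_le_imp_less_or_eq)
  obtain L where L: "L > 0" "\<And>z. norm (inv \<tau> z) \<le> norm z * L"
    using bounded_linear.pos_bounded[of "inv \<tau>"] inj_linear_imp_inv_linear[of \<tau>] \<tau>
    by (auto simp: linear_conv_bounded_linear bij_is_inj)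
  \<comment> \<open>No exponent in \<open>\<phi>\<close> exceeds 1, nor does
    \<open>\<omega>\<close>, so \<open>1 + norm z \<le> M * u\<close> on the curve, and a bound in
    \<open>norm z\<close> becomes a bound in \<open>u\<close>.\<close>
  define M where "M = 1 + L * (1 + (\<Sum>q\<in>Poly_Mapping.keys \<phi>. \<bar>Poly_Mapping.lookup \<phi> q\<bar>) + \<bar>\<xi>\<bar>)"
  have "\<forall>\<^sub>F u in at_top. min (\<xi>1 u) (\<xi>2 u) < \<xi>" "\<forall>\<^sub>F u in at_top. \<xi> < max (\<xi>1 u) (\<xi>2 u)"
    using order_tendstoD(2)[OF tendsto_min[OF \<xi>_lim] \<xi>(1)] order_tendstoD(1)[OF tendsto_max[OF \<xi>_lim] \<xi>(2)] .
  then have final_bound: "\<forall>\<^sub>F u in at_top. norm (branch_eval u \<xi> F) \<le> \<bar>C\<bar> * M ^ d * u powr real d"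
    using v eventually_ge_at_top[of 1]
  proof eventually_elim
    case (elim u)
    let ?v = "?s u + \<xi> * ?w u"
    have w: "?w u > 0"
      using elim(4) by simp
    have "min (v1 u) (v2 u) < ?v" "?v < max (v1 u) (v2 u)"
      using elim(1,2) w by (auto simp: \<xi>1_def \<xi>2_def min_less_iff_disj less_max_iff_disj field_simps)
    then have "?v \<in> open_segment (v1 u) (v2 u)"
      by (auto simp: open_segment_eq_real_ivl min_def max_def split: if_splits)
    then obtain z where z: "z \<in> S" "\<tau> z = (u, ?v)"
      using elim(3) by (metis (mono_tags, lifting) imageE mem_Collect_eq subsetD)
    then have "z = inv \<tau> (u, ?v)"
      using \<tau>(2) by (metis bij_is_inj inv_f_f)
    then have "norm z \<le> L * norm (u, ?v)"
      using L(2)[of "(u, ?v)"] by (simp add: mult.commute)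
    also have "\<dots> \<le> L * (\<bar>u\<bar> + \<bar>?v\<bar>)"
      using L(1) norm_Pair_le[of u ?v] by (intro mult_left_mono) auto
    also have "\<bar>?v\<bar> \<le> (\<Sum>q\<in>Poly_Mapping.keys \<phi>. \<bar>Poly_Mapping.lookup \<phi> q\<bar>) * u + \<bar>\<xi>\<bar> * u"
      using abs_branch_sum_le[OF \<omega>(3) elim(4)] powr_le_self[OF \<omega>(2) elim(4)]
        mult_left_mono[of "?w u" u "\<bar>\<xi>\<bar>"] w
      by (intro order_trans[OF abs_triangle_ineq] add_mono) (auto simp: abs_mult)
    finally have "norm z \<le> L * (u + ((\<Sum>q\<in>Poly_Mapping.keys \<phi>. \<bar>Poly_Mapping.lookup \<phi> q\<bar>) * u + \<bar>\<xi>\<bar> * u))"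
      using elim(4) L(1) by (simp add: mult_left_mono)
    then have "1 + norm z \<le> M * u"
      using elim(4) by (simp add: M_def algebra_simps)
    then have "(1 + norm z) ^ d \<le> M ^ d * u ^ d"
      unfolding power_mult_distrib[symmetric] by (intro power_mono) auto
    then have "\<bar>C\<bar> * (1 + norm z) ^ d \<le> \<bar>C\<bar> * (M ^ d * u ^ d)"
      by (intro mult_left_mono) auto
    moreover have "\<bar>eval2 f z\<bar> \<le> \<bar>C\<bar> * (1 + norm z) ^ d"
      using C[OF z(1)] by (intro order_trans[OF _ mult_right_mono[OF abs_ge_self]]) auto
    ultimately show ?case
      using on_branch[OF z(2)] elim(4) by (simp add: powr_realpow mult.assoc)
  qed
  have "real_of_rat \<gamma> \<le> real d"
    by (rule branch_exponent_le[OF _ \<xi>(3) final_bound]) (rule F_le)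
  then have "\<gamma> \<le> of_nat d"
    by (metis of_rat_less_eq of_rat_of_nat_eq)
  then show "nat \<lceil>delta_star \<tau> \<phi> \<omega> f\<rceil> \<le> d"
    unfolding \<gamma>_def[symmetric] by (simp add: ceiling_le_iff nat_le_iff)
qed

section \<open>The stable growth degree\<close>

lemma stable_growth_degree_eq:
  assumes \<tau>: "linear \<tau>" "bij \<tau>"
    and growth: "\<And>f. f \<noteq> 0 \<Longrightarrow> growth_degree S f = nat \<lceil>delta_star \<tau> \<phi> \<omega> f\<rceil>"
    and f: "f \<noteq> 0"
  shows "stable_growth_degree S f = max 0 (real_of_rat (delta_star \<tau> \<phi> \<omega> f))"
  unfolding stable_growth_degree_def
proof (rule limI)
  define x where "x = real_of_rat (delta_star \<tau> \<phi> \<omega> f)"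
  have gd: "real (growth_degree S (f ^ k)) = real (nat \<lceil>real k * x\<rceil>)" for k
  proof -
    have "\<lceil>delta_star \<tau> \<phi> \<omega> (f ^ k)\<rceil> = \<lceil>real_of_rat (delta_star \<tau> \<phi> \<omega> (f ^ k))\<rceil>"
      by (rule ceiling_of_rat[symmetric])
    then show ?thesis
      using growth[of "f ^ k"] f by (simp add: delta_star_power[OF \<tau> f] x_def of_rat_mult)
  qed
  \<comment> \<open>Rounding up costs at most 1, which disappears after division by
    \<open>k\<close>.\<close>
  have near: "max 0 y \<le> real (nat \<lceil>y\<rceil>) \<and> real (nat \<lceil>y\<rceil>) \<le> max 0 y + 1" for y :: real
    by linarith
  have "\<bar>real (growth_degree S (f ^ k)) / real k - max 0 x\<bar> \<le> 1 / real k" if k: "k > 0" for k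
  proof -
    have "max 0 (real k * x) = real k * max 0 x"
      using k by (simp add: max_def zero_le_mult_iff mult_le_0_iff)
    then have "real k * max 0 x \<le> real (growth_degree S (f ^ k))"
      "real (growth_degree S (f ^ k)) \<le> real k * max 0 x + 1"
      using near[of "real k * x"] unfolding gd by auto
    then have "\<bar>real (growth_degree S (f ^ k)) - real k * max 0 x\<bar> / real k \<le> 1 / real k"
      by (intro divide_right_mono) auto
    moreover have "real (growth_degree S (f ^ k)) / real k - max 0 x =
        (real (growth_degree S (f ^ k)) - real k * max 0 x) / real k"
      using k by (simp add: diff_divide_distrib)
    ultimately show ?thesis
      by (simp add: abs_divide)
  qed
  then have "((\<lambda>k. real (growth_degree S (f ^ k)) / real k - max 0 x) \<longlongrightarrow> 0) sequentially"
    by (intro Lim_null_comparison[OF _ lim_1_over_n]) (auto intro: eventually_mono[OF eventually_gt_at_top[of 0]])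
  then show "(\<lambda>k. real (growth_degree S (f ^ k)) / real k) \<longlonglongrightarrow> max 0 x"
    using LIM_zero_iff by blast
qed

text \<open>A negative value \<open>t\<close> of \<open>delta_star\<close> is detected by
  multiplying with the coordinate \<open>U\<close> of degree 1:
  \<open>max 0 (t + 1) = max 0 t + 1\<close> fails exactly for \<open>t < 0\<close>.\<close>

lemma semidegree_stable_growth_degree_iff:
  assumes \<tau>: "linear \<tau>" "bij \<tau>"
    and growth: "\<And>f. f \<noteq> 0 \<Longrightarrow> growth_degree S f = nat \<lceil>delta_star \<tau> \<phi> \<omega> f\<rceil>"
  shows "semidegree (stable_growth_degree S) \<longleftrightarrow> (\<forall>f. f \<noteq> 0 \<longrightarrow> delta_star \<tau> \<phi> \<omega> f \<ge> 0)"
proof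
  have stable: "stable_growth_degree S f = max 0 (real_of_rat (delta_star \<tau> \<phi> \<omega> f))" if "f \<noteq> 0" for f
    by (rule stable_growth_degree_eq[OF \<tau> _ that]) (rule growth)
  assume semi: "semidegree (stable_growth_degree S)"
  show "\<forall>f. f \<noteq> 0 \<longrightarrow> delta_star \<tau> \<phi> \<omega> f \<ge> 0"
  proof (intro allI impI)
    fix f :: "real poly poly" assume f: "f \<noteq> 0"
    obtain U where U: "in_coords \<tau> U = var_u"
      using coordinate_forms[OF \<tau>] by metis
    have U1: "delta_star \<tau> \<phi> \<omega> U = 1"
      by (simp add: delta_star_def U branch_degree_var_u)
    have U0: "U \<noteq> 0"
    proof
      assume "U = 0"
      then have "var_u = 0"
        using U ring_morphismD(1)[OF ring_morphism_in_coords, of \<tau>] by simp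
      then show False
        using branch_degree_var_u
        by (metis coeff_0 coeff_pCons_0 laurent_monom_def lookup_single_eq lookup_zero var_u_def zero_neq_one)
    qed
    have "stable_growth_degree S (f * U) = stable_growth_degree S f + stable_growth_degree S U"
      using semi f U0 by (auto simp: semidegree_def)
    then have "max 0 (real_of_rat (delta_star \<tau> \<phi> \<omega> f) + 1) = max 0 (real_of_rat (delta_star \<tau> \<phi> \<omega> f)) + 1"
      using f U0 by (simp add: stable delta_star_mult[OF \<tau>] U1 of_rat_add)
    then have "real_of_rat (delta_star \<tau> \<phi> \<omega> f) \<ge> 0"
      by (auto simp: max_def split: if_splits)
    then show "delta_star \<tau> \<phi> \<omega> f \<ge> 0"
      by simp
  qed
next
  have stable: "stable_growth_degree S f = max 0 (real_of_rat (delta_star \<tau> \<phi> \<omega> f))" if "f \<noteq> 0" for f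
    by (rule stable_growth_degree_eq[OF \<tau> _ that]) (rule growth)
  assume nonneg: "\<forall>f. f \<noteq> 0 \<longrightarrow> delta_star \<tau> \<phi> \<omega> f \<ge> 0"
  have stable': "stable_growth_degree S f = real_of_rat (delta_star \<tau> \<phi> \<omega> f)" if "f \<noteq> 0" for f
    using stable[OF that] nonneg that by simp
  have of_rat_max: "real_of_rat (max a b) = max (real_of_rat a) (real_of_rat b)" for a b
    by (simp add: max_def of_rat_less_eq)
  show "semidegree (stable_growth_degree S)"
    unfolding semidegree_def
  proof (intro allI impI conjI)
    fix f g :: "real poly poly" assume fg: "f \<noteq> 0" "g \<noteq> 0"
    show "stable_growth_degree S (f * g) = stable_growth_degree S f + stable_growth_degree S g"
      using fg by (simp add: stable' delta_star_mult[OF \<tau>] of_rat_add)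
    assume sum: "f + g \<noteq> 0"
    show "stable_growth_degree S (f + g) \<le> max (stable_growth_degree S f) (stable_growth_degree S g)"
      using fg sum delta_star_add(1)[OF \<tau> fg sum, of \<phi> \<omega>]
      by (simp add: stable' of_rat_less_eq flip: of_rat_max)
    assume "stable_growth_degree S f \<noteq> stable_growth_degree S g"
    then show "stable_growth_degree S (f + g) = max (stable_growth_degree S f) (stable_growth_degree S g)"
      using fg sum delta_star_add(2)[OF \<tau> fg sum, of \<phi> \<omega>]
      by (simp add: stable' flip: of_rat_max)
  qed
qed


section \<open>Growth along a tentacle with several points at infinity\<close>

text \<open>The restriction of \<open>f\<close> to the line \<open>y = \<xi> x\<close>, as a
  polynomial in \<open>x\<close>.\<close>

definition on_line :: "real poly poly \<Rightarrow> real \<Rightarrow> real poly" where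
  "on_line f \<xi> = poly f [:0, \<xi>:]"

lemma poly_on_line: "poly (on_line f \<xi>) t = eval2 f (t, \<xi> * t)"
  using ring_morphism_poly_apply[OF ring_morphism_poly, of f "[:0, \<xi>:]" t]
    ring_morphism_poly_apply[OF ring_morphism_poly, of f "[:\<xi> * t:]" t]
  by (simp add: on_line_def eval2_def mult.commute)

lemma coeff_on_line:
  "coeff (on_line f \<xi>) k = (\<Sum>i\<le>degree f. if i \<le> k then \<xi> ^ i * coeff (coeff f i) (k - i) else 0)"
proof -
  have "[:0, \<xi>:] ^ i = monom (\<xi> ^ i) i" for i
    by (simp add: monom_altdef flip: smult_power)
  then have "on_line f \<xi> = (\<Sum>i\<le>degree f. monom (\<xi> ^ i) i * coeff f i)"
    by (simp add: on_line_def poly_altdef mult.commute)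
  then show ?thesis
    by (auto simp: coeff_sum coeff_monom_mult intro!: sum.cong)
qed

text \<open>The homogeneous part of highest degree with \<open>x = 1\<close>, a polynomial in the
  slope. Its roots are the slopes along which the coefficient of highest degree is lost.\<close>

definition top_form :: "real poly poly \<Rightarrow> real poly" where
  "top_form f = (\<Sum>i\<le>degree f. if i \<le> total_degree f
      then monom (coeff (coeff f i) (total_degree f - i)) i else 0)"

lemma coeff_on_line_total_degree:
  "coeff (on_line f \<xi>) (total_degree f) = poly (top_form f) \<xi>"
  unfolding coeff_on_line top_form_def poly_sum
  by (intro sum.cong) (auto simp: poly_monom)

lemma degree_on_line:
  assumes "poly (top_form f) \<xi> \<noteq> 0"
  shows "degree (on_line f \<xi>) = total_degree f"
proof (rule antisym)
  show "degree (on_line f \<xi>) \<le> total_degree f"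
  proof (rule degree_le, intro allI impI)
    fix k assume k: "k > total_degree f"
    show "coeff (on_line f \<xi>) k = 0"
      unfolding coeff_on_line
    proof (intro sum.neutral ballI)
      fix i
      show "(if i \<le> k then \<xi> ^ i * coeff (coeff f i) (k - i) else 0) = 0"
        using total_degree_ge[of f i "k - i"] k by auto
    qed
  qed
  show "total_degree f \<le> degree (on_line f \<xi>)"
    using assms by (intro le_degree) (simp add: coeff_on_line_total_degree)
qed

lemma top_form_neq_0:
  assumes "f \<noteq> 0"
  shows "top_form f \<noteq> 0"
proof -
  have "\<exists>i j. coeff (coeff f i) j \<noteq> 0 \<and> i + j = total_degree f"
  \<comment> \<open>The value 0 may stem from the default in \<open>total_degree\<close>, so here an
    actual monomial has to be exhibited.\<close>
  proof (cases "total_degree f = 0")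
    case True
    have nz: "coeff (coeff f (degree f)) (degree (coeff f (degree f))) \<noteq> 0"
      using assms by simp
    then show ?thesis
      using total_degree_ge[OF nz] nz True by (intro exI conjI) auto
  next
    case False
    have "total_degree f \<in> insert 0 {i + j | i j. coeff (coeff f i) j \<noteq> 0}"
      unfolding total_degree_def using finite_total_degrees[of f] by (intro Max_in) auto
    then have "total_degree f \<in> {i + j | i j. coeff (coeff f i) j \<noteq> 0}"
      using False by (elim insertE) simp
    then obtain i j where "total_degree f = i + j" "coeff (coeff f i) j \<noteq> 0"
      by blast
    then show ?thesis
      by (intro exI[of _ i] exI[of _ j]) simp
  qed
  then obtain i where i: "i \<le> total_degree f" "coeff (coeff f i) (total_degree f - i) \<noteq> 0"
    by (metis add_diff_cancel_left' le_add1)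
  then have "i \<le> degree f"
    by (intro le_degree) auto
  moreover have "coeff (top_form f) i = (\<Sum>k\<le>degree f. if i = k then
      (if i \<le> total_degree f then coeff (coeff f i) (total_degree f - i) else 0) else 0)"
    unfolding top_form_def coeff_sum by (intro sum.cong) auto
  ultimately have "coeff (top_form f) i \<noteq> 0"
    using i by simp
  then show ?thesis
    by auto
qed

lemma finite_top_form_roots: "f \<noteq> 0 \<Longrightarrow> finite {\<xi>. poly (top_form f) \<xi> = 0}"
  by (intro poly_roots_finite top_form_neq_0)

text \<open>Stated for a filter because the points of \<open>S\<close> on a line need not contain a
  ray; \<open>G\<close> will be infinity restricted to the parameters of these points.\<close>

lemma degree_le_of_growth:
  fixes p :: "real poly"
  assumes G: "G \<le> at_infinity" "G \<noteq> bot"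
    and bound: "\<forall>\<^sub>F t in G. \<bar>poly p t\<bar> \<le> C * \<bar>t\<bar> ^ d"
  shows "degree p \<le> d"
proof (rule ccontr)
  assume "\<not> degree p \<le> d"
  then obtain e where e: "degree p = d + Suc e"
    by (metis add_Suc_right less_imp_Suc_add linorder_not_le)
  have "((\<lambda>t. poly p t / t ^ degree p) \<longlongrightarrow> lead_coeff p) G"
    using poly_divide_tendsto_aux[of p] G(1) by (rule tendsto_mono[rotated])
  moreover have "((\<lambda>t. poly p t / t ^ degree p) \<longlongrightarrow> 0) G"
  proof (rule Lim_null_comparison)
    have "\<forall>\<^sub>F t in G. \<bar>t::real\<bar> \<ge> 1"
      using G(1) eventually_at_infinity[of "\<lambda>t::real. \<bar>t\<bar> \<ge> 1"] by (auto simp: le_filter_def)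
    with bound show "\<forall>\<^sub>F t in G. norm (poly p t / t ^ degree p) \<le> \<bar>C\<bar> * (1 / \<bar>t\<bar>)"
    proof eventually_elim
      case (elim t)
      have "\<bar>poly p t\<bar> / \<bar>t\<bar> ^ degree p \<le> (C * \<bar>t\<bar> ^ d) / \<bar>t\<bar> ^ degree p"
        using elim by (intro divide_right_mono) auto
      also have "\<dots> = C / \<bar>t\<bar> ^ Suc e"
        using elim by (simp add: e power_add)
      also have "\<dots> \<le> \<bar>C\<bar> / \<bar>t\<bar> ^ 1"
        using elim by (intro frac_le power_increasing) auto
      finally show ?case
        by (simp add: power_abs)
    qed
    have "((\<lambda>t::real. 1 / \<bar>t\<bar>) \<longlongrightarrow> 0) at_infinity"
      using tendsto_norm_zero[OF tendsto_inverse_0[where 'a = real]] by (simp add: inverse_eq_divide)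
    then show "((\<lambda>t. \<bar>C\<bar> * (1 / \<bar>t\<bar>)) \<longlongrightarrow> 0) G"
      using G(1) by (intro tendsto_mult_right_zero) (rule tendsto_mono)
  qed
  ultimately have "lead_coeff p = 0"
    using tendsto_unique[OF G(2)] by blast
  then have "p = 0"
    by simp
  then show False
    using e by simp
qed

text \<open>On a line whose slope is not a root of \<open>top_form f\<close> the degree survives
  restriction, and a polynomial in one variable is controlled by its values on any unbounded
  set.\<close>

lemma total_degree_le_of_growth:
  assumes growth: "\<And>z. z \<in> S \<Longrightarrow> \<bar>eval2 f z\<bar> \<le> C * (1 + norm z) ^ d"
    and unbounded: "\<And>r. \<exists>z\<in>S. norm z \<ge> r \<and> snd z = \<xi> * fst z"
    and \<xi>: "poly (top_form f) \<xi> \<noteq> 0"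
  shows "total_degree f \<le> d"
proof -
  define T where "T = {t. (t, \<xi> * t) \<in> S}"
  let ?G = "inf at_infinity (principal T)"
  have norm_le: "norm (t, \<xi> * t) \<le> (1 + \<bar>\<xi>\<bar>) * \<bar>t\<bar>" for t :: real
    using norm_Pair_le[of t "\<xi> * t"] by (simp add: abs_mult algebra_simps)
  have "?G \<noteq> bot"
  proof
    assume "?G = bot"
    then have "eventually (\<lambda>t. False) ?G"
      by simp
    then obtain b where b: "\<And>t. \<bar>t\<bar> \<ge> b \<Longrightarrow> t \<notin> T"
      by (auto simp: eventually_inf_principal eventually_at_infinity)
    obtain z where z: "z \<in> S" "norm z \<ge> (1 + \<bar>\<xi>\<bar>) * \<bar>b\<bar>" "snd z = \<xi> * fst z"
      using unbounded by blast
    then have eq: "z = (fst z, \<xi> * fst z)"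
      by (simp add: prod_eq_iff)
    then have "fst z \<in> T"
      using z(1) by (simp add: T_def)
    moreover have "(1 + \<bar>\<xi>\<bar>) * \<bar>b\<bar> \<le> (1 + \<bar>\<xi>\<bar>) * \<bar>fst z\<bar>"
      using z(2) norm_le[of "fst z"] eq by simp
    then have "\<bar>fst z\<bar> \<ge> b"
      using mult_le_cancel_left_pos[of "1 + \<bar>\<xi>\<bar>" "\<bar>b\<bar>" "\<bar>fst z\<bar>"] by simp
    ultimately show False
      using b by blast
  qed
  moreover have "\<forall>\<^sub>F t in ?G. \<bar>poly (on_line f \<xi>) t\<bar> \<le> \<bar>C\<bar> * (2 + \<bar>\<xi>\<bar>) ^ d * \<bar>t\<bar> ^ d"
    unfolding eventually_inf_principal eventually_at_infinity
  proof (intro exI[of _ 1] allI impI)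
    fix t :: real assume t: "norm t \<ge> 1" "t \<in> T"
    have "\<bar>eval2 f (t, \<xi> * t)\<bar> \<le> \<bar>C\<bar> * (1 + norm (t, \<xi> * t)) ^ d"
      using t(2) growth[of "(t, \<xi> * t)"]
      by (intro order_trans[OF _ mult_right_mono[OF abs_ge_self]]) (auto simp: T_def)
    also have "\<dots> \<le> \<bar>C\<bar> * ((2 + \<bar>\<xi>\<bar>) * \<bar>t\<bar>) ^ d"
      using norm_le[of t] t(1) by (intro mult_left_mono power_mono) (auto simp: algebra_simps)
    finally show "\<bar>poly (on_line f \<xi>) t\<bar> \<le> \<bar>C\<bar> * (2 + \<bar>\<xi>\<bar>) ^ d * \<bar>t\<bar> ^ d"
      by (simp add: poly_on_line power_mult_distrib mult.assoc)
  qed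
  ultimately have "degree (on_line f \<xi>) \<le> d"
    by (intro degree_le_of_growth[of ?G]) auto
  then show ?thesis
    by (simp add: degree_on_line[OF \<xi>])
qed

text \<open>Both degrees are read off from the growth of the same function on a line
  \<open>y = \<xi> x\<close>, where \<open>\<xi>\<close> avoids the roots of both leading
  coefficients.\<close>

lemma delta_star_id_eq_total_degree:
  assumes f: "f \<noteq> 0"
  shows "delta_star id 0 1 f = of_nat (total_degree f)"
proof -
  define F where "F = subst_branch 0 1 (in_coords id f)"
  define \<gamma> where "\<gamma> = delta_star id 0 1 f"
  have \<tau>: "linear (id :: real \<times> real \<Rightarrow> _)" "bij (id :: real \<times> real \<Rightarrow> _)"
    by (auto simp: linear_id)
  have \<gamma>: "\<gamma> = top_key F"
    by (simp add: \<gamma>_def F_def delta_star_def branch_degree_conv)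
  have "F \<noteq> 0"
    using subst_branch_in_coords_neq_0[OF \<tau> f] by (simp add: F_def)
  then have F: "Poly_Mapping.lookup F \<gamma> \<noteq> 0"
    using top_key_in[of F] by (simp add: \<gamma> in_keys_iff)
  have F_le: "r \<le> \<gamma>" if "r \<in> Poly_Mapping.keys F" for r
    using that top_key_ge \<gamma> by blast
  have eval: "branch_eval u \<xi> F = complex_of_real (poly (on_line f \<xi>) u)" if "u > 0" for u \<xi>
    using branch_eval_in_coords[OF \<tau> that, of \<xi> 0 1 f] that
    by (simp add: F_def branch_sum_def poly_on_line)
  have "finite ({\<xi>. poly (top_form f) \<xi> = 0} \<union> complex_of_real -` {x. poly (Poly_Mapping.lookup F \<gamma>) x = 0})"
    using F f by (intro finite_UnI finite_vimageI poly_roots_finite finite_top_form_roots) (auto intro: injI)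
  then obtain \<xi> where "\<xi> \<notin> {\<xi>. poly (top_form f) \<xi> = 0} \<union> complex_of_real -` {x. poly (Poly_Mapping.lookup F \<gamma>) x = 0}"
    using ex_new_if_finite[OF infinite_UNIV_char_0] by blast
  then have \<xi>: "poly (top_form f) \<xi> \<noteq> 0" "poly (Poly_Mapping.lookup F \<gamma>) (complex_of_real \<xi>) \<noteq> 0"
    by auto
  let ?N = "total_degree f"
  obtain C where C: "C \<ge> 0" "\<And>z. \<bar>eval2 f z\<bar> \<le> C * (1 + norm z) ^ ?N"
    using abs_eval2_le[of f] by metis
  have "real_of_rat \<gamma> \<le> real ?N"
  proof (rule branch_exponent_le[OF _ \<xi>(2)])
    show "r \<in> Poly_Mapping.keys F \<Longrightarrow> r \<le> \<gamma>" for r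
      by (rule F_le)
    show "\<forall>\<^sub>F u in at_top. norm (branch_eval u \<xi> F) \<le> C * (2 + \<bar>\<xi>\<bar>) ^ ?N * u powr real ?N"
      using eventually_ge_at_top[of 1]
    proof eventually_elim
      case (elim u)
      have "norm (u, \<xi> * u) \<le> u + \<bar>\<xi>\<bar> * u"
        using norm_Pair_le[of u "\<xi> * u"] elim by (simp add: abs_mult)
      then have "1 + norm (u, \<xi> * u) \<le> (2 + \<bar>\<xi>\<bar>) * u"
        using elim by (simp add: algebra_simps)
      then have "C * (1 + norm (u, \<xi> * u)) ^ ?N \<le> C * ((2 + \<bar>\<xi>\<bar>) * u) ^ ?N"
        using C(1) by (intro mult_left_mono power_mono) auto
      then show ?case
        using C(2)[of "(u, \<xi> * u)"] elim
        by (simp add: eval poly_on_line power_mult_distrib powr_realpow mult.assoc)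
    qed
  qed
  then have le: "\<gamma> \<le> of_nat ?N"
    by (metis of_rat_less_eq of_rat_of_nat_eq)
  have "\<not> \<gamma> < of_nat ?N"
  proof
    assume "\<gamma> < of_nat ?N"
    then have less: "real_of_rat \<gamma> < real ?N"
      by (metis of_rat_less of_rat_of_nat_eq)
    obtain C where C: "C \<ge> 0" "\<And>u \<xi>'. u \<ge> 1 \<Longrightarrow> \<bar>\<xi>'\<bar> \<le> \<bar>\<xi>\<bar> \<Longrightarrow>
        norm (branch_eval u \<xi>' F) \<le> C * u powr real_of_rat \<gamma>"
      using norm_branch_eval_le[of F \<gamma> "\<bar>\<xi>\<bar>"] F_le by metis
    have "((\<lambda>u. poly (on_line f \<xi>) u / u ^ ?N) \<longlongrightarrow> 0) at_top"
    proof (rule Lim_null_comparison)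
      show "\<forall>\<^sub>F u in at_top. norm (poly (on_line f \<xi>) u / u ^ ?N) \<le>
          C * (u powr real_of_rat \<gamma> / u powr real ?N)"
        using eventually_ge_at_top[of 1]
      proof eventually_elim
        case (elim u)
        then show ?case
          using C(2)[of u \<xi>] eval[of u \<xi>] by (simp add: powr_realpow divide_right_mono)
      qed
      show "((\<lambda>u. C * (u powr real_of_rat \<gamma> / u powr real ?N)) \<longlongrightarrow> 0) at_top"
        using less by (intro tendsto_mult_right_zero powr_quotient_tendsto_0)
    qed
    moreover have "((\<lambda>u. poly (on_line f \<xi>) u / u ^ ?N) \<longlongrightarrow> poly (top_form f) \<xi>) at_top"
      using tendsto_mono[OF at_top_le_at_infinity poly_divide_tendsto_aux[of "on_line f \<xi>"]]
      by (simp add: degree_on_line[OF \<xi>(1)] coeff_on_line_total_degree)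
    ultimately show False
      using tendsto_unique[of "at_top :: real filter"] \<xi>(1) by fastforce
  qed
  then show ?thesis
    using le by (simp add: \<gamma>_def)
qed

section \<open>Directions at infinity and separating lines\<close>

lemma rp2_closure_at_infinity:
  fixes U :: "(real \<times> real) set"
  assumes P: "span {(0, a, b)} \<in> rp2_closure S" "(a, b) \<noteq> (0, 0)"
    and U: "open U" "(a, b) \<in> U" "\<And>w c. w \<in> U \<Longrightarrow> c \<noteq> 0 \<Longrightarrow> c *\<^sub>R w \<in> U"
  shows "\<exists>z\<in>S. norm z > r \<and> z \<in> U"
proof -
  \<comment> \<open>A neighbourhood of the point at infinity in homogeneous coordinates, cut out by
    conditions invariant under scaling. For an affine point \<open>(1, z)\<close> the second
    condition says that \<open>norm z\<close> exceeds the absolute value of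
    \<open>r\<close>.\<close>
  define W where "W = {w :: real \<times> real \<times> real. snd w \<in> U \<and> \<bar>r\<bar> * \<bar>fst w\<bar> < norm (snd w)}"
  define V where "V = {span {w} | w. w \<in> W}"
  have nz: "w \<noteq> 0" if "w \<in> W" for w
    using that by (auto simp: W_def)
  have scale: "c *\<^sub>R w \<in> W" if "w \<in> W" "c \<noteq> 0" for c w
    using that U(3)[of "snd w" c] mult_strict_left_mono[of "\<bar>r\<bar> * \<bar>fst w\<bar>" "norm (snd w)" "\<bar>c\<bar>"]
    by (simp add: W_def abs_mult mult.left_commute)
  have in_W: "w \<in> W" if "w \<noteq> 0" "span {w} \<in> V" for w
  proof -
    obtain w' where w': "span {w} = span {w'}" "w' \<in> W"
      using \<open>span {w} \<in> V\<close> by (auto simp: V_def)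
    have "w \<in> span {w'}"
      using w'(1) span_base[of w "{w}"] by auto
    then obtain c where "w = c *\<^sub>R w'"
      by (auto simp: span_singleton)
    then show ?thesis
      using scale[OF w'(2)] that(1) by auto
  qed
  have "span {w} \<in> V" if "w \<in> W" for w
    unfolding V_def using that by blast
  then have "{w. w \<noteq> 0 \<and> span {w} \<in> V} = W"
    using in_W nz by blast
  moreover have "open W"
  proof -
    have "W = snd -` U \<inter> {w. \<bar>r\<bar> * \<bar>fst w\<bar> < norm (snd w)}"
      by (auto simp: W_def)
    then show ?thesis
      using U(1) by (auto intro!: open_Int open_vimage open_Collect_less continuous_intros)
  qed
  moreover have "V \<subseteq> rp2"
    unfolding V_def rp2_def using nz by blast
  ultimately have "openin rp2_topology V"
    by (simp add: openin_rp2_topology)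
  moreover have "(0, a, b) \<in> W"
    using U(2) P(2) by (simp add: W_def zero_prod_def)
  then have "span {(0, a, b)} \<in> V"
    by (auto simp: V_def)
  ultimately obtain z where z: "z \<in> S" "affine_to_rp2 z \<in> V"
    using P(1) by (auto simp: rp2_closure_def in_closure_of)
  then have "(1, z) \<in> W"
    using in_W[of "(1, z)"] by (simp add: affine_to_rp2_def zero_prod_def)
  then show ?thesis
    using z(1) by (intro bexI[of _ z]) (auto simp: W_def)
qed

lemma connected_tentacle:
  assumes "card (tentacles_at S r) = 1"
  shows "connected (S - ball 0 r)"
proof -
  obtain T where T: "components (S - ball 0 r) = {T}"
    using assms by (auto simp: tentacles_at_def card_1_singleton_iff)
  then have "S - ball 0 r = T"
    using Union_components[of "S - ball 0 r"] by simp
  then show ?thesis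
    using in_components_connected[of T "S - ball 0 r"] T by simp
qed

text \<open>As a function of the slope \<open>x\<close> the product has a simple zero at
  \<open>b / a\<close>, because the two directions are not proportional; it changes sign
  there.\<close>

lemma slope_product_sign_change:
  fixes a b c d :: real
  assumes "a \<noteq> 0" "a * d \<noteq> b * c"
  shows "\<exists>x. (b - x * a) * (d - x * c) > 0" "\<exists>x. (b - x * a) * (d - x * c) < 0"
proof -
  define D where "D = a * d - b * c"
  \<comment> \<open>At \<open>x = b / a + e\<close> the product equals
    \<open>- e * D + e^2 * (a * c)\<close>; for \<open>e\<close> equal to plus or minus
    \<open>k * D\<close> the linear term dominates, as
    \<open>k * \<bar>a * c\<bar> < 1\<close>.\<close>
  define k where "k = 1 / (1 + \<bar>a * c\<bar>)"
  have k: "k > 0" "k * \<bar>a * c\<bar> < 1"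
    by (auto simp: k_def field_simps)
  have D: "D\<^sup>2 > 0"
    using assms(2) by (simp add: D_def)
  have val: "(b - (b / a + e) * a) * (d - (b / a + e) * c) = - e * D + e\<^sup>2 * (a * c)" for e
    using assms(1) by (simp add: D_def field_simps power2_eq_square)
  have "(b - (b / a + - k * D) * a) * (d - (b / a + - k * D) * c) = k * D\<^sup>2 * (1 + k * (a * c))"
    unfolding val by (simp add: power2_eq_square algebra_simps)
  moreover have "k * \<bar>a * c\<bar> = \<bar>k * (a * c)\<bar>"
    using k(1) by (simp add: abs_mult)
  then have kac: "\<bar>k * (a * c)\<bar> < 1"
    using k(2) by simp
  then have "k * D\<^sup>2 * (1 + k * (a * c)) > 0"
    using k(1) D by (intro mult_pos_pos) auto
  ultimately show "\<exists>x. (b - x * a) * (d - x * c) > 0"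
    by metis
  have "(b - (b / a + k * D) * a) * (d - (b / a + k * D) * c) = - (k * D\<^sup>2 * (1 - k * (a * c)))"
    unfolding val by (simp add: power2_eq_square algebra_simps)
  moreover have "k * D\<^sup>2 * (1 - k * (a * c)) > 0"
    using k(1) D kac by (intro mult_pos_pos) auto
  ultimately show "\<exists>x. (b - x * a) * (d - x * c) < 0"
    by (metis neg_less_0_iff_less)
qed

text \<open>The lines of slopes \<open>x\<close> and \<open>y\<close> separate the directions
  \<open>(a, b)\<close> and \<open>(c, d)\<close> in the projective line. Either sign of
  \<open>?g\<close> occurs on a nonempty open set of slopes, which leaves room to avoid
  \<open>R\<close>.\<close>

lemma separating_slopes:
  fixes a b c d :: real
  assumes "a * d \<noteq> b * c" and fin: "finite R"
  obtains x y where "x \<notin> R" "y \<notin> R"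
    "((b - x * a) * (b - y * a)) * ((d - x * c) * (d - y * c)) < 0"
proof -
  let ?g = "\<lambda>x. (b - x * a) * (d - x * c)"
  have "a \<noteq> 0 \<or> c \<noteq> 0"
    using assms(1) by auto
  then have ex: "\<exists>x. ?g x > 0" "\<exists>x. ?g x < 0"
    using slope_product_sign_change[of a d b c] slope_product_sign_change[of c b d a] assms(1)
    by (auto simp: mult.commute)
  have "open {x. ?g x > 0}" "open {x. ?g x < 0}"
    by (auto intro!: open_Collect_less continuous_intros)
  then have "infinite {x. ?g x > 0}" "infinite {x. ?g x < 0}"
    using ex finite_imp_not_open by blast+
  then obtain x y where "x \<notin> R" "?g x > 0" "y \<notin> R" "?g y < 0"
    using fin by (metis (mono_tags, lifting) finite_subset mem_Collect_eq subsetI)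
  then show ?thesis
    using that[of x y] mult_pos_neg[of "?g x" "?g y"] by (simp add: ac_simps)
qed

lemma growth_degree_several_points_at_infinity:
  assumes one: "one_tentacle S"
    and PQ: "P \<noteq> Q" "{P, Q} \<subseteq> rp2_closure S \<inter> line_at_infinity" and f: "f \<noteq> 0"
  shows "growth_degree S f = total_degree f"
proof (rule growth_degree_eqI)
  show "\<exists>C. \<forall>z\<in>S. \<bar>eval2 f z\<bar> \<le> C * (1 + norm z) ^ total_degree f"
    using abs_eval2_le[of f] by metis
  fix e C assume growth: "\<And>z. z \<in> S \<Longrightarrow> \<bar>eval2 f z\<bar> \<le> C * (1 + norm z) ^ e"
  obtain a b where P: "P = span {(0, a, b)}" "(a, b) \<noteq> (0, 0)"
    using PQ(2) by (auto simp: line_at_infinity_def)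
  obtain c d where Q: "Q = span {(0, c, d)}" "(c, d) \<noteq> (0, 0)"
    using PQ(2) by (auto simp: line_at_infinity_def)
  \<comment> \<open>Proportional directions would span the same point at infinity.\<close>
  have "a * d \<noteq> b * c"
  proof
    assume eq: "a * d = b * c"
    obtain t where t: "t \<noteq> 0" "(0, c, d) = t *\<^sub>R (0::real, a, b)"
    proof (cases "a = 0")
      case True
      then have "b \<noteq> 0" "c = 0"
        using P(2) eq by auto
      then show ?thesis
        using that[of "d / b"] True Q(2) by auto
    next
      case False
      then have "d = c / a * b" "c \<noteq> 0"
        using eq Q(2) by (auto simp: field_simps)
      then show ?thesis
        using that[of "c / a"] False by auto
    qed
    have "span {t *\<^sub>R (0::real, a, b)} = span {(0, a, b)}"
      using span_image_scale[of "{(0::real, a, b)}" "\<lambda>_. t"] t(1) by simp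
    then show False
      using P(1) Q(1) PQ(1) t(2) by metis
  qed
  then obtain x y where xy: "poly (top_form f) x \<noteq> 0" "poly (top_form f) y \<noteq> 0"
      "((b - x * a) * (b - y * a)) * ((d - x * c) * (d - y * c)) < 0"
    using separating_slopes[OF _ finite_top_form_roots[OF f]] by (metis (mono_tags, lifting) mem_Collect_eq)
  \<comment> \<open>A form of even degree, so its sign at a point at infinity is well defined. It
    has opposite signs at \<open>P\<close> and \<open>Q\<close> and vanishes exactly on the two
    chosen lines.\<close>
  define h where "h z = (snd z - x * fst z) * (snd z - y * fst z)" for z :: "real \<times> real"
  have h_cont: "continuous_on A h" for A
    unfolding h_def by (intro continuous_intros)
  have h_scale: "h (t *\<^sub>R z) = t\<^sup>2 * h z" for t z
    by (simp add: h_def power2_eq_square algebra_simps)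
  have pos: "\<exists>z\<in>S. norm z > r \<and> h z > 0" and neg: "\<exists>z\<in>S. norm z > r \<and> h z < 0" for r
  proof -
    have *: "\<exists>z\<in>S. norm z > r \<and> s * h z > 0"
      if "span {(0, a', b')} \<in> rp2_closure S" "(a', b') \<noteq> (0, 0)" "s * h (a', b') > 0" for a' b' s
    proof -
      have "\<exists>z\<in>S. norm z > r \<and> z \<in> {z. s * h z > 0}"
      proof (rule rp2_closure_at_infinity[OF that(1,2)])
        show "open {z. 0 < s * h z}"
          by (intro open_Collect_less continuous_intros h_cont)
        show "(a', b') \<in> {z. 0 < s * h z}"
          using that(3) by simp
        show "t *\<^sub>R w \<in> {z. 0 < s * h z}" if "w \<in> {z. 0 < s * h z}" "t \<noteq> 0" for w t
          using that mult_pos_pos[of "t\<^sup>2" "s * h w"] by (simp add: h_scale mult.left_commute)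
      qed
      then show ?thesis
        by simp
    qed
    have hPQ: "h (a, b) * h (c, d) < 0"
      using xy(3) by (simp add: h_def)
    have clP: "span {(0, a, b)} \<in> rp2_closure S" and clQ: "span {(0, c, d)} \<in> rp2_closure S"
      using PQ(2) P(1) Q(1) by auto
    show "\<exists>z\<in>S. norm z > r \<and> h z > 0"
    proof (cases "h (a, b) > 0")
      case True
      then show ?thesis using *[OF clP P(2), of 1] by simp
    next
      case False
      then have "h (c, d) > 0"
        using hPQ by (auto simp: mult_less_0_iff)
      then show ?thesis using *[OF clQ Q(2), of 1] by simp
    qed
    show "\<exists>z\<in>S. norm z > r \<and> h z < 0"
    proof (cases "h (a, b) < 0")
      case True
      then show ?thesis using *[OF clP P(2), of "- 1"] by simp
    next
      case False
      then have "h (c, d) < 0"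
        using hPQ by (auto simp: mult_less_0_iff)
      then show ?thesis using *[OF clQ Q(2), of "- 1"] by simp
    qed
  qed
  obtain R where R: "\<And>r. r \<ge> R \<Longrightarrow> card (tentacles_at S r) = 1"
    using one by (auto simp: one_tentacle_def eventually_at_top_linorder)
  \<comment> \<open>Outside a large ball \<open>S\<close> is connected and \<open>h\<close> takes
    both signs, so \<open>h\<close> has a zero there.\<close>
  have on_lines: "\<exists>z\<in>S. norm z \<ge> r \<and> (snd z = x * fst z \<or> snd z = y * fst z)" for r
  proof -
    let ?r = "max r R"
    have conn: "connected (h ` (S - ball 0 ?r))"
      by (intro connected_continuous_image h_cont connected_tentacle R) simp
    obtain z1 where z1: "z1 \<in> S - ball 0 ?r" "h z1 > 0"
      using pos[of ?r] by fastforce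
    obtain z2 where z2: "z2 \<in> S - ball 0 ?r" "h z2 < 0"
      using neg[of ?r] by fastforce
    have "0 \<in> h ` (S - ball 0 ?r)"
      using connectedD_interval[OF conn imageI[OF z2(1)] imageI[OF z1(1)]] z1(2) z2(2) by simp
    then obtain z where "z \<in> S - ball 0 ?r" "h z = 0"
      by auto
    then show ?thesis
      by (intro bexI[of _ z]) (auto simp: h_def)
  qed
  \<comment> \<open>Which line is met may depend on the radius, but one of the two is met at
    arbitrarily large radii.\<close>
  have "(\<forall>r. \<exists>z\<in>S. norm z \<ge> r \<and> snd z = x * fst z) \<or> (\<forall>r. \<exists>z\<in>S. norm z \<ge> r \<and> snd z = y * fst z)"
  proof (rule ccontr)
    assume "\<not> ?thesis"
    then obtain r1 r2 where "\<And>z. z \<in> S \<Longrightarrow> norm z \<ge> r1 \<Longrightarrow> snd z \<noteq> x * fst z"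
      "\<And>z. z \<in> S \<Longrightarrow> norm z \<ge> r2 \<Longrightarrow> snd z \<noteq> y * fst z"
      by metis
    then show False
      using on_lines[of "max r1 r2"] by auto
  qed
  then show "total_degree f \<le> e"
  proof
    assume "\<forall>r. \<exists>z\<in>S. norm z \<ge> r \<and> snd z = x * fst z"
    then show ?thesis
      by (intro total_degree_le_of_growth[OF growth _ xy(1)]) auto
  next
    assume "\<forall>r. \<exists>z\<in>S. norm z \<ge> r \<and> snd z = y * fst z"
    then show ?thesis
      by (intro total_degree_le_of_growth[OF growth _ xy(2)]) auto
  qed
qed

lemma growth_degree_eq_delta_star:
  assumes "one_tentacle S" "delta_star_data S \<tau> \<phi> \<omega>" "f \<noteq> 0"
  shows "growth_degree S f = nat \<lceil>delta_star \<tau> \<phi> \<omega> f\<rceil>"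
  using assms(2) unfolding delta_star_data_def
proof (elim disjE exE conjE)
  fix P Q assume "P \<noteq> Q" "{P, Q} \<subseteq> rp2_closure S \<inter> line_at_infinity" "\<tau> = id" "\<phi> = 0" "\<omega> = 1"
  then show ?thesis
    using growth_degree_several_points_at_infinity[OF assms(1) _ _ assms(3)]
      delta_star_id_eq_total_degree[OF assms(3)] by simp
next
  fix c1 c2 assume "linear \<tau>" "bij \<tau>" "filterlim (\<lambda>z. fst (\<tau> z)) at_top (inf at_infinity (principal S))"
    "puiseux c1" "puiseux c2" "c1 \<noteq> c2" "bounded_by_branches S \<tau> c1 c2" "branching_data c1 c2 \<phi> \<omega>"
  then show ?thesis
    using growth_degree_tentacle assms(3) by blast
qed


section \<open>Expansion in monomials of the key forms\<close>

lemma homogeneous_system_nontrivial_solution: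
  fixes a :: "'y \<Rightarrow> 'x \<Rightarrow> 'f::field"
  assumes "finite Y" "finite X" "card Y < card X"
  shows "\<exists>x. (\<exists>p\<in>X. x p \<noteq> 0) \<and> (\<forall>q\<in>Y. (\<Sum>p\<in>X. a q p * x p) = 0)"
  using assms
proof (induction Y arbitrary: X a rule: finite_induct)
  case empty
  then have "X \<noteq> {}"
    by auto
  then show ?case
    by (auto intro!: exI[of _ "\<lambda>_. 1"])
next
  case (insert q Y)
  show ?case
  proof (cases "\<forall>p\<in>X. a q p = 0")
    case True
    have "card Y < card X"
      using insert by simp
    then obtain x where "\<exists>p\<in>X. x p \<noteq> 0" "\<forall>r\<in>Y. (\<Sum>p\<in>X. a r p * x p) = 0"
      using insert.IH[OF insert.prems(1)] by blast
    then show ?thesis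
      using True by (intro exI[of _ x]) auto
  next
    case False
    then obtain p0 where p0: "p0 \<in> X" "a q p0 \<noteq> 0"
      by blast
    define X' where "X' = X - {p0}"
    have X': "finite X'" "card Y < card X'"
      using insert p0(1) by (auto simp: X'_def)
    \<comment> \<open>Gaussian elimination: equation \<open>q\<close> is solved for the unknown
      \<open>p0\<close>, and the result is substituted into the other equations.\<close>
    obtain x' where x': "\<exists>p\<in>X'. x' p \<noteq> 0"
      "\<forall>r\<in>Y. (\<Sum>p\<in>X'. (a r p - a r p0 * a q p / a q p0) * x' p) = 0"
      using insert.IH[OF X', of "\<lambda>r p. a r p - a r p0 * a q p / a q p0"] by blast
    define x where "x p = (if p = p0 then - (\<Sum>p\<in>X'. a q p * x' p) / a q p0 else x' p)" for p
    have sum: "(\<Sum>p\<in>X. a r p * x p) = a r p0 * x p0 + (\<Sum>p\<in>X'. a r p * x' p)" for r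
    proof -
      have "(\<Sum>p\<in>X'. a r p * x p) = (\<Sum>p\<in>X'. a r p * x' p)"
        by (intro sum.cong) (auto simp: x_def X'_def)
      then show ?thesis
        using sum.remove[OF insert.prems(1) p0(1), of "\<lambda>p. a r p * x p"] by (simp add: X'_def)
    qed
    have "(\<Sum>p\<in>X. a q p * x p) = 0"
      unfolding sum using p0(2) by (simp add: x_def)
    moreover have "(\<Sum>p\<in>X. a r p * x p) = 0" if "r \<in> Y" for r
    proof -
      have "0 = (\<Sum>p\<in>X'. (a r p - a r p0 * a q p / a q p0) * x' p)"
        using x'(2) that by simp
      also have "\<dots> = (\<Sum>p\<in>X'. a r p * x' p) - (\<Sum>p\<in>X'. (a r p0 / a q p0) * (a q p * x' p))"
        by (simp add: left_diff_distrib sum_subtractf mult.assoc)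
      also have "\<dots> = (\<Sum>p\<in>X. a r p * x p)"
        unfolding sum sum_distrib_left[symmetric] by (simp add: x_def)
      finally show ?thesis
        by simp
    qed
    moreover have "\<exists>p\<in>X. x p \<noteq> 0"
      using x'(1) by (auto simp: x_def X'_def)
    ultimately show ?thesis
      by (intro exI[of _ x]) auto
  qed
qed

lemma laurent_monom_mult: "laurent_monom c k * laurent_monom c' k' = laurent_monom (c * c') (k + k')"
  by (simp add: laurent_monom_def mult_single ac_simps)

lemma pCons_eq_sum_laurent_monom:
  "[:p:] = (\<Sum>k\<in>Poly_Mapping.keys p. laurent_monom (Poly_Mapping.lookup p k) k)"
proof -
  have "(\<Sum>k\<in>A. [:h k:]) = [:\<Sum>k\<in>A. h k:]" for A and h :: "_ \<Rightarrow> int \<Rightarrow>\<^sub>0 complex"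
    by (induction A rule: infinite_finite_induct) auto
  then show ?thesis
    unfolding laurent_monom_def using poly_mapping_sum_single[of p] by metis
qed

text \<open>For the last index \<open>i\<close> with \<open>b i \<noteq> 0\<close>, only
  \<open>e i\<close> reaches degree \<open>i\<close>, and its leading coefficient is 1.\<close>

lemma triangular_sum_lead_coeff:
  fixes e :: "nat \<Rightarrow> 'a::comm_ring_1 poly"
  assumes e: "\<And>i. i < n \<Longrightarrow> degree (e i) = i" "\<And>i. i < n \<Longrightarrow> coeff (e i) i = 1"
    and b: "i0 < n" "b i0 \<noteq> 0"
  shows "\<exists>i<n. b i \<noteq> 0 \<and> lead_coeff (\<Sum>i<n. smult (b i) (e i)) = b i"
proof -
  let ?g = "\<Sum>i<n. smult (b i) (e i)"
  let ?I = "{i. i < n \<and> b i \<noteq> 0}"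
  define i where "i = Max ?I"
  have "i \<in> ?I"
    unfolding i_def using b by (intro Max_in) auto
  then have i: "i < n" "b i \<noteq> 0"
    by auto
  have gt: "b k = 0" if "k > i" "k < n" for k
    using that Max_ge[of ?I k] unfolding i_def by fastforce
  have zero: "b j * coeff (e j) k = 0" if "j < n" "k \<ge> i" "k \<noteq> i \<or> j \<noteq> i" for j k
  proof (cases "j > i")
    case False
    then have "k > degree (e j)"
      using that e(1)[of j] by auto
    then show ?thesis
      by (simp add: coeff_eq_0)
  qed (use gt that in auto)
  have "coeff ?g i = (\<Sum>j<n. if j = i then b i else 0)"
    unfolding coeff_sum using zero[where k = i] e(2) i(1) by (intro sum.cong) auto
  then have coeff_i: "coeff ?g i = b i"
    using i(1) by simp
  moreover have "degree ?g \<le> i"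
    using zero by (intro degree_le) (auto simp: coeff_sum intro!: sum.neutral)
  ultimately have "degree ?g = i"
    using i(2) by (intro antisym le_degree) auto
  then show ?thesis
    using i coeff_i by auto
qed

text \<open>The recursion (i) of the key forms with bare numbers as weights. The degree function
  enters later, through bounds on the exponents of the \<open>f j\<close> and through
  representations of minimal weight.\<close>

locale key_form_sequence =
  fixes f :: "nat \<Rightarrow> laurent" and l :: nat and w :: "nat \<Rightarrow> rat"
    and \<alpha> :: "nat \<Rightarrow> nat" and \<beta> :: "nat \<Rightarrow> nat \<Rightarrow> int" and \<theta> :: "nat \<Rightarrow> complex"
  assumes l_ge_1: "l \<ge> 1" and f_1: "f 1 = var_v" and w_0: "w 0 = 1"
    and \<alpha>_pos: "\<And>j. 1 \<le> j \<Longrightarrow> j < l \<Longrightarrow> \<alpha> j > 0"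
    and weight: "\<And>j. 1 \<le> j \<Longrightarrow> j < l \<Longrightarrow> of_nat (\<alpha> j) * w j = (\<Sum>i<j. of_int (\<beta> j i) * w i)"
    and \<beta>_bounds: "\<And>i j. 1 \<le> j \<Longrightarrow> j < l \<Longrightarrow> 1 \<le> i \<Longrightarrow> i < j \<Longrightarrow> 0 \<le> \<beta> j i \<and> \<beta> j i < int (\<alpha> i)"
    and f_Suc: "\<And>j. 1 \<le> j \<Longrightarrow> j < l \<Longrightarrow>
      f (Suc j) = f j ^ \<alpha> j - laurent_monom (\<theta> j) (\<beta> j 0) * (\<Prod>i\<in>{1..<j}. f i ^ nat (\<beta> j i))"
    and w_Suc: "\<And>j. 1 \<le> j \<Longrightarrow> j < l \<Longrightarrow> w (Suc j) < of_nat (\<alpha> j) * w j"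
begin

text \<open>The degree of \<open>f j\<close> in \<open>v\<close>, see \<open>f_monic\<close>, and at
  the same time the value of place \<open>j\<close> in the mixed radix system with radices
  \<open>\<alpha>\<close>.\<close>

definition d :: "nat \<Rightarrow> nat" where "d j = (\<Prod>i\<in>{1..<j}. \<alpha> i)"

definition monomial :: "(nat \<Rightarrow> nat) \<Rightarrow> laurent" where "monomial m = (\<Prod>j\<in>{1..l}. f j ^ m j)"

definition monomial_weight :: "(nat \<Rightarrow> nat) \<Rightarrow> rat" where
  "monomial_weight m = (\<Sum>j\<in>{1..l}. of_nat (m j) * w j)"

definition monomial_degree :: "(nat \<Rightarrow> nat) \<Rightarrow> nat" where
  "monomial_degree m = (\<Sum>j\<in>{1..l}. m j * d j)"

text \<open>The exponents are digits for the radices \<open>\<alpha>\<close>; the exponent of the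
  last form \<open>f l\<close> stays free, since no recursion step rewrites its powers.\<close>

definition restricted :: "(nat \<Rightarrow> nat) \<Rightarrow> bool" where
  "restricted m \<longleftrightarrow> (\<forall>j. 1 \<le> j \<longrightarrow> j < l \<longrightarrow> m j < \<alpha> j)"

section \<open>Degrees in \<open>v\<close> as mixed radix numbers\<close>

lemma d_1 [simp]: "d (Suc 0) = 1"
  by (simp add: d_def)

lemma d_Suc: "1 \<le> j \<Longrightarrow> d (Suc j) = \<alpha> j * d j"
  by (simp add: d_def atLeastLessThanSuc mult.commute)

lemma d_pos: "1 \<le> j \<Longrightarrow> j \<le> l \<Longrightarrow> d j > 0"
  using \<alpha>_pos by (auto simp: d_def intro!: prod_pos)

text \<open>All places below \<open>j\<close> together are worth less than one unit of place
  \<open>j\<close>, as 99 < 100 in decimal.\<close>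

lemma digit_sum_less:
  assumes "1 \<le> j" "j \<le> l" "\<And>i. 1 \<le> i \<Longrightarrow> i < j \<Longrightarrow> m i < \<alpha> i"
  shows "(\<Sum>i\<in>{1..<j}. m i * d i) < d j"
  using assms
proof (induction j rule: dec_induct)
  case base
  show ?case by simp
next
  case (step j)
  have "(\<Sum>i\<in>{1..<j}. m i * d i) < d j"
    using step by simp
  then have "(\<Sum>i\<in>{1..<Suc j}. m i * d i) < d j + m j * d j"
    using step.hyps by (simp add: atLeastLessThanSuc)
  also have "\<dots> = Suc (m j) * d j"
    by simp
  also have "\<dots> \<le> \<alpha> j * d j"
    using step by (intro mult_right_mono) (auto simp: Suc_le_eq)
  finally show ?case
    using step.hyps by (simp add: d_Suc)
qed

text \<open>In the step from \<open>i\<close> to \<open>Suc i\<close> the bounds on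
  \<open>\<beta>\<close> make the exponents of the subtracted product digits of places below
  \<open>i\<close>. Its degree is thus below \<open>d i\<close>, and the leading term comes from
  \<open>f i ^ \<alpha> i\<close>.\<close>

lemma f_monic: "1 \<le> j \<Longrightarrow> j \<le> l \<Longrightarrow> degree (f j) = d j \<and> lead_coeff (f j) = 1"
proof (induction j rule: less_induct)
  case (less j)
  show ?case
  proof (cases "j = 1")
    case True
    then show ?thesis
      using f_1 by (simp add: var_v_def)
  next
    case False
    then obtain i where i: "j = Suc i" "1 \<le> i" "i < l"
      using less.prems by (cases j) auto
    have IH: "degree (f k) = d k" "lead_coeff (f k) = 1" if "1 \<le> k" "k \<le> i" for k
      using less.IH[of k] that i by auto
    let ?r = "laurent_monom (\<theta> i) (\<beta> i 0) * (\<Prod>k\<in>{1..<i}. f k ^ nat (\<beta> i k))"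
    have "degree (\<Prod>k\<in>{1..<i}. f k ^ nat (\<beta> i k)) \<le> (\<Sum>k\<in>{1..<i}. nat (\<beta> i k) * d k)"
    proof (rule order_trans[OF degree_prod_sum_le])
      show "sum (degree \<circ> (\<lambda>k. f k ^ nat (\<beta> i k))) {1..<i} \<le> (\<Sum>k\<in>{1..<i}. nat (\<beta> i k) * d k)"
      proof (rule sum_mono)
        fix k assume "k \<in> {1..<i}"
        then show "(degree \<circ> (\<lambda>k. f k ^ nat (\<beta> i k))) k \<le> nat (\<beta> i k) * d k"
          using degree_power_le[of "f k" "nat (\<beta> i k)"] IH(1)[of k] by (simp add: mult.commute)
      qed
    qed simp
    also have "\<dots> < d i"
      using \<beta>_bounds[of i] i by (intro digit_sum_less) (auto simp: nat_less_iff)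
    finally have "degree ?r < d i"
      using degree_mult_le[of "laurent_monom (\<theta> i) (\<beta> i 0)"]
      by (simp add: laurent_monom_def)
    also have "d i \<le> \<alpha> i * d i"
      using \<alpha>_pos[of i] i by simp
    finally have r: "degree ?r < \<alpha> i * d i" .
    have "f i \<noteq> 0"
      using IH[of i] i by fastforce
    then have p: "degree (f i ^ \<alpha> i) = \<alpha> i * d i"
      using IH(1)[of i] i by (simp add: degree_power_eq)
    have "lead_coeff (f i ^ \<alpha> i) = 1"
      using IH(2)[of i] i by (metis lead_coeff_power order_refl power_one)
    then have lc: "coeff (f i ^ \<alpha> i) (\<alpha> i * d i) = 1"
      by (simp only: p)
    have f_j: "f j = f i ^ \<alpha> i + - ?r"
      unfolding i(1) f_Suc[OF i(2,3)] by simp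
    have "degree (f j) = \<alpha> i * d i"
      unfolding f_j using degree_add_eq_left[of "- ?r" "f i ^ \<alpha> i"] p r by simp
    moreover have "coeff (f j) (\<alpha> i * d i) = 1"
      unfolding f_j using lc coeff_eq_0[OF r] by simp
    ultimately have "degree (f j) = \<alpha> i * d i" "lead_coeff (f j) = 1"
      by simp_all
    then show ?thesis
      using i by (simp add: d_Suc)
  qed
qed

lemma monomial_monic: "degree (monomial m) = monomial_degree m" "coeff (monomial m) (monomial_degree m) = 1"
proof -
  have nz: "f j \<noteq> 0" if "j \<in> {1..l}" for j
    using f_monic[of j] that by fastforce
  show deg: "degree (monomial m) = monomial_degree m"
    unfolding monomial_def monomial_degree_def using nz f_monic
    by (subst degree_prod_eq_sum_degree) (auto intro!: sum.cong simp: degree_power_eq)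
  have "lead_coeff (f j) ^ m j = 1" if "j \<in> {1..l}" for j
    using f_monic[of j] that by (metis atLeastAtMost_iff power_one)
  then have "lead_coeff (monomial m) = 1"
    unfolding monomial_def lead_coeff_prod lead_coeff_power by (intro prod.neutral) blast
  then show "coeff (monomial m) (monomial_degree m) = 1"
    by (simp add: deg)
qed

lemma monomial_add: "monomial (\<lambda>i. m i + n i) = monomial m * monomial n"
  by (simp add: monomial_def power_add prod.distrib)

lemma monomial_weight_add:
  "monomial_weight (\<lambda>i. m i + n i) = monomial_weight m + monomial_weight n"
  by (simp add: monomial_weight_def distrib_right sum.distrib)

lemma monomial_degree_add:
  "monomial_degree (\<lambda>i. m i + n i) = monomial_degree m + monomial_degree n"
  by (simp add: monomial_degree_def distrib_right sum.distrib)

text \<open>Mixed radix; the last digit is unbounded.\<close>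

definition digits :: "nat \<Rightarrow> nat \<Rightarrow> nat" where
  "digits i j = (if j = l then i div d l else i div d j mod \<alpha> j)"

lemma monomial_degree_split: "monomial_degree m = (\<Sum>j\<in>{1..<l}. m j * d j) + m l * d l"
  using l_ge_1 by (simp add: monomial_degree_def atLeastLessThanSuc flip: atLeastLessThanSuc_atLeastAtMost)

lemma monomial_degree_digits: "monomial_degree (digits i) = i"
proof -
  have "(\<Sum>j\<in>{1..<k}. i div d j mod \<alpha> j * d j) = i mod d k" if "1 \<le> k" for k
    using that
  proof (induction k rule: dec_induct)
    case (step k)
    have "(\<Sum>j\<in>{1..<Suc k}. i div d j mod \<alpha> j * d j) = i mod d k + d k * (i div d k mod \<alpha> k)"
      using step by (simp add: atLeastLessThanSuc mult.commute)
    also have "\<dots> = i mod d (Suc k)"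
      using mod_mult2_eq[of i "d k" "\<alpha> k"] step(1) by (simp add: d_Suc mult.commute)
    finally show ?case .
  qed simp
  moreover have "(\<Sum>j\<in>{1..<l}. digits i j * d j) = (\<Sum>j\<in>{1..<l}. i div d j mod \<alpha> j * d j)"
    by (intro sum.cong) (auto simp: digits_def)
  ultimately show ?thesis
    using l_ge_1 by (simp add: monomial_degree_split digits_def mod_div_mult_eq)
qed

lemma restricted_digits: "restricted (digits i)"
  using \<alpha>_pos by (auto simp: restricted_def digits_def)

text \<open>The highest differing digit decides, because the lower digits of \<open>m\<close> cannot
  make up for one unit of place \<open>j\<close>.\<close>

lemma restricted_less:
  assumes m: "restricted m" and j: "1 \<le> j" "j \<le> l"
    and eq: "\<And>i. j < i \<Longrightarrow> i \<le> l \<Longrightarrow> m i = n i" and less: "m j < n j"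
  shows "monomial_degree m < monomial_degree n"
proof -
  have split: "monomial_degree k = (\<Sum>i\<in>{1..<j}. k i * d i) + k j * d j + (\<Sum>i\<in>{Suc j..l}. k i * d i)" for k
  proof -
    have *: "{1..l} = {1..<j} \<union> ({j} \<union> {Suc j..l})"
      using j by auto
    have "monomial_degree k = (\<Sum>i\<in>{1..<j}. k i * d i) + (\<Sum>i\<in>{j} \<union> {Suc j..l}. k i * d i)"
      unfolding monomial_degree_def * by (rule sum.union_disjoint) auto
    also have "(\<Sum>i\<in>{j} \<union> {Suc j..l}. k i * d i) = k j * d j + (\<Sum>i\<in>{Suc j..l}. k i * d i)"
      by (subst sum.union_disjoint) auto
    finally show ?thesis
      by simp
  qed
  have "(\<Sum>i\<in>{1..<j}. m i * d i) < d j"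
    using m j by (intro digit_sum_less) (auto simp: restricted_def)
  then have "(\<Sum>i\<in>{1..<j}. m i * d i) + m j * d j < Suc (m j) * d j"
    by simp
  also have "\<dots> \<le> n j * d j"
    using less by (intro mult_right_mono) auto
  finally have "(\<Sum>i\<in>{1..<j}. m i * d i) + m j * d j < (\<Sum>i\<in>{1..<j}. n i * d i) + n j * d j"
    by linarith
  moreover have "(\<Sum>i\<in>{Suc j..l}. m i * d i) = (\<Sum>i\<in>{Suc j..l}. n i * d i)"
    using eq by (intro sum.cong) auto
  ultimately show ?thesis
    unfolding split by simp
qed

lemma restricted_unique:
  assumes "restricted m" "restricted n" "monomial_degree m = monomial_degree n" "1 \<le> j" "j \<le> l"
  shows "m j = n j"
proof (rule ccontr)
  let ?J = "{j. 1 \<le> j \<and> j \<le> l \<and> m j \<noteq> n j}"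
  define k where "k = Max ?J"
  assume "m j \<noteq> n j"
  then have "k \<in> ?J"
    unfolding k_def using assms(4,5) by (intro Max_in) auto
  moreover have "m i = n i" if "k < i" "i \<le> l" for i
    using that Max_ge[of ?J i] unfolding k_def by fastforce
  ultimately show False
    using restricted_less[of m k n] restricted_less[of n k m] assms(1-3)
    by (cases "m k < n k") auto
qed

section \<open>The basis indexed by the degree in \<open>v\<close>, and combinations of negative
  weight\<close>

abbreviation basis :: "nat \<Rightarrow> laurent" where "basis i \<equiv> monomial (digits i)"

abbreviation basis_weight :: "nat \<Rightarrow> rat" where "basis_weight i \<equiv> monomial_weight (digits i)"

lemma restricted_monomial:
  assumes "restricted m"
  shows "monomial m = basis (monomial_degree m)" "monomial_weight m = basis_weight (monomial_degree m)"
proof -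
  have eq: "m j = digits (monomial_degree m) j" if "1 \<le> j" "j \<le> l" for j
    by (rule restricted_unique[OF assms restricted_digits _ that]) (simp only: monomial_degree_digits)
  show "monomial m = basis (monomial_degree m)"
    unfolding monomial_def[of m] monomial_def[of "digits _"]
    by (rule prod.cong[OF refl]) (metis eq atLeastAtMost_iff)
  show "monomial_weight m = basis_weight (monomial_degree m)"
    unfolding monomial_weight_def[of m] monomial_weight_def[of "digits _"]
    by (rule sum.cong[OF refl]) (metis eq atLeastAtMost_iff)
qed

lemma basis_monic: "degree (basis i) = i" "coeff (basis i) i = 1"
  using monomial_monic[of "digits i"] by (simp_all add: monomial_degree_digits)

text \<open>An algebraic stand-in for negative degree. Elements of negative degree are put into this
  set by rewriting a representation of minimal weight; conversely, after substitution its elements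
  have only negative exponents of \<open>u\<close>.\<close>

definition negative_span :: "laurent set" where
  "negative_span = {\<Sum>i<n. smult (b i) (basis i) | n b.
     \<forall>i<n. \<forall>k\<in>Poly_Mapping.keys (b i). of_int k + basis_weight i < 0}"

lemma negative_span_0: "0 \<in> negative_span"
  unfolding negative_span_def by (auto intro!: exI[of _ "0::nat"])

lemma negative_span_add:
  assumes "g \<in> negative_span" "h \<in> negative_span"
  shows "g + h \<in> negative_span"
proof -
  have pad: "\<exists>b'. g = (\<Sum>i<N. smult (b' i) (basis i)) \<and>
      (\<forall>i. \<forall>k\<in>Poly_Mapping.keys (b' i). of_int k + basis_weight i < 0)"
    if "g = (\<Sum>i<n. smult (b i) (basis i))"
      "\<forall>i<n. \<forall>k\<in>Poly_Mapping.keys (b i). of_int k + basis_weight i < 0" "n \<le> N" for g n b N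
  proof (intro exI[of _ "\<lambda>i. if i < n then b i else 0"] conjI)
    show "g = (\<Sum>i<N. smult (if i < n then b i else 0) (basis i))"
      unfolding that(1) using that(3) by (intro sum.mono_neutral_cong_left) auto
  qed (use that(2) in auto)
  obtain n b where g: "g = (\<Sum>i<n. smult (b i) (basis i))"
      "\<forall>i<n. \<forall>k\<in>Poly_Mapping.keys (b i). of_int k + basis_weight i < 0"
    using assms(1) by (auto simp: negative_span_def)
  obtain n' b' where h: "h = (\<Sum>i<n'. smult (b' i) (basis i))"
      "\<forall>i<n'. \<forall>k\<in>Poly_Mapping.keys (b' i). of_int k + basis_weight i < 0"
    using assms(2) by (auto simp: negative_span_def)
  define N where "N = max n n'"
  obtain c where c: "g = (\<Sum>i<N. smult (c i) (basis i))"
      "\<And>i k. k \<in> Poly_Mapping.keys (c i) \<Longrightarrow> of_int k + basis_weight i < 0"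
    using pad[OF g, of N] by (auto simp: N_def)
  obtain c' where c': "h = (\<Sum>i<N. smult (c' i) (basis i))"
      "\<And>i k. k \<in> Poly_Mapping.keys (c' i) \<Longrightarrow> of_int k + basis_weight i < 0"
    using pad[OF h, of N] by (auto simp: N_def)
  have "g + h = (\<Sum>i<N. smult (c i + c' i) (basis i))"
    by (simp add: c(1) c'(1) smult_add_left sum.distrib)
  moreover have "of_int k + basis_weight i < 0" if "k \<in> Poly_Mapping.keys (c i + c' i)" for i k
    using that c(2) c'(2) Poly_Mapping.keys_add[of "c i" "c' i"] by blast
  ultimately show ?thesis
    unfolding negative_span_def by (intro CollectI exI[of _ N] exI[of _ "\<lambda>i. c i + c' i"]) blast
qed

lemma negative_span_sum: "(\<And>i. i \<in> I \<Longrightarrow> g i \<in> negative_span) \<Longrightarrow> sum g I \<in> negative_span"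
  by (induction I rule: infinite_finite_induct) (auto intro: negative_span_0 negative_span_add)

lemma negative_span_basis:
  assumes "of_int k + basis_weight i < 0"
  shows "laurent_monom c k * basis i \<in> negative_span"
proof -
  let ?b = "\<lambda>j. if j = i then Poly_Mapping.single k c else 0"
  have "laurent_monom c k * basis i = (\<Sum>j<Suc i. smult (?b j) (basis j))"
    by (simp add: laurent_monom_def if_distrib[where f = "\<lambda>p. smult p _"] cong: if_cong)
  moreover have "\<forall>j<Suc i. \<forall>k\<in>Poly_Mapping.keys (?b j). of_int k + basis_weight j < 0"
    using assms by (auto split: if_splits)
  ultimately show ?thesis
    unfolding negative_span_def by (intro CollectI exI[of _ "Suc i"] exI[of _ ?b]) blast
qed

text \<open>Trading \<open>f\<^sub>j\<^bsup>\<alpha>\<^sub>j\<^esup>\<close> for \<open>f\<^bsub>j+1\<^esub> + \<theta>\<^sub>j \<Prod> f\<^sub>i\<^bsup>\<beta>\<^sub>j\<^sub>i\<^esup>\<close> never increases the weight;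
  the first summand keeps the degree in \<open>v\<close> but moves exponents to higher indices,
  the second one has smaller degree in \<open>v\<close>.\<close>

lemma negative_span_monomial:
  assumes "of_int k + monomial_weight m < 0"
  shows "laurent_monom c k * monomial m \<in> negative_span"
  using assms
\<comment> \<open>The second measure weighs index \<open>j\<close> by \<open>Suc l - j\<close>, so
  moving from \<open>f j\<close> to \<open>f (Suc j)\<close> lowers it even if
  \<open>\<alpha> j = 1\<close>, when the number of factors does not drop.\<close>
proof (induction m arbitrary: k c rule: wf_induct_rule[OF wf_measures[of
      "[monomial_degree, \<lambda>m. \<Sum>j\<in>{1..l}. m j * (Suc l - j)]"]])
  case (1 m)
  let ?N = "\<lambda>m. \<Sum>j\<in>{1..l}. m j * (Suc l - j)"
  show ?case
  proof (cases "restricted m")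
    case True
    then show ?thesis
      using negative_span_basis "1.prems" restricted_monomial by metis
  next
    case False
    then obtain j where j: "1 \<le> j" "j < l" "m j \<ge> \<alpha> j"
      by (auto simp: restricted_def not_less)
    \<comment> \<open>Here \<open>a\<close> stands for \<open>f j ^ \<alpha> j\<close>, and
      \<open>s\<close> and \<open>b\<close> for the two terms by which the recursion replaces it.
      The power of \<open>u\<close> that belongs to index 0 is carried by
      \<open>laurent_monom\<close> instead.\<close>
    define m0 where "m0 = m(j := m j - \<alpha> j)"
    define a where "a = (\<lambda>i. if i = j then \<alpha> j else 0)"
    define s where "s = (\<lambda>i. if i = Suc j then 1 else 0 :: nat)"
    define b where "b = (\<lambda>i. if 1 \<le> i \<and> i < j then nat (\<beta> j i) else 0)"
    have m: "m = (\<lambda>i. m0 i + a i)"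
      using j(3) by (auto simp: m0_def a_def)
    have a: "monomial a = f j ^ \<alpha> j" "monomial_weight a = of_nat (\<alpha> j) * w j"
      "monomial_degree a = \<alpha> j * d j" "?N a = \<alpha> j * (Suc l - j)"
      using j by (auto simp: monomial_def monomial_weight_def monomial_degree_def a_def
          if_distrib if_distribR prod.delta cong: if_cong)
    have s: "monomial s = f (Suc j)" "monomial_weight s = w (Suc j)"
      "monomial_degree s = d (Suc j)" "?N s = l - j"
      using j by (auto simp: monomial_def monomial_weight_def monomial_degree_def s_def
          if_distrib if_distribR prod.delta cong: if_cong)
    have sub: "{1..<j} \<subseteq> {1..l}"
      using j by auto
    have "monomial b = (\<Prod>i\<in>{1..<j}. f i ^ nat (\<beta> j i))"
      unfolding monomial_def using sub by (intro prod.mono_neutral_cong_right) (auto simp: b_def)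
    then have rel: "monomial a = monomial s + laurent_monom (\<theta> j) (\<beta> j 0) * monomial b"
      using f_Suc[OF j(1,2)] by (simp add: a s)
    have "monomial_weight b = (\<Sum>i\<in>{1..<j}. of_int (\<beta> j i) * w i)"
      unfolding monomial_weight_def using sub \<beta>_bounds[OF j(1,2)]
      by (intro sum.mono_neutral_cong_right) (auto simp: b_def)
    moreover have "{..<j} = insert 0 {1..<j}"
      using j by auto
    ultimately have wt_b: "of_int (\<beta> j 0) + monomial_weight b = of_nat (\<alpha> j) * w j"
      using weight[OF j(1,2)] w_0 by simp
    have "monomial_degree b = (\<Sum>i\<in>{1..<j}. b i * d i)"
      unfolding monomial_degree_def using sub
      by (intro sum.mono_neutral_cong_right) (auto simp: b_def)
    also have "\<dots> < d j"
      using j \<beta>_bounds[OF j(1,2)] by (intro digit_sum_less) (auto simp: b_def nat_less_iff)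
    also have "\<dots> \<le> \<alpha> j * d j"
      using \<alpha>_pos[OF j(1,2)] by simp
    finally have deg_b: "monomial_degree b < monomial_degree a"
      by (simp add: a)
    let ?m1 = "\<lambda>i. m0 i + s i" and ?m2 = "\<lambda>i. m0 i + b i"
    have N_add: "?N (\<lambda>i. x i + y i) = ?N x + ?N y" for x y
      by (simp add: distrib_right sum.distrib)
    have "?N s < ?N a"
    proof -
      have "1 * (Suc l - j) \<le> \<alpha> j * (Suc l - j)"
        using \<alpha>_pos[OF j(1,2)] by (intro mult_right_mono) auto
      then show ?thesis
        unfolding a s using j by linarith
    qed
    moreover have "monomial_degree ?m1 = monomial_degree m"
      unfolding m monomial_degree_add by (simp add: a s d_Suc[OF j(1)])
    ultimately have "(?m1, m) \<in> measures [monomial_degree, ?N]"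
      unfolding in_measures m N_add by (simp add: m[symmetric])
    moreover have "of_int k + monomial_weight ?m1 < 0"
      using "1.prems" w_Suc[OF j(1,2)] unfolding m monomial_weight_add by (simp add: a s)
    ultimately have 1: "laurent_monom c k * monomial ?m1 \<in> negative_span"
      by (rule "1.IH")
    have "(?m2, m) \<in> measures [monomial_degree, ?N]"
      using deg_b unfolding in_measures m monomial_degree_add by simp
    moreover have "of_int (k + \<beta> j 0) + monomial_weight ?m2 < 0"
      using "1.prems" wt_b unfolding m monomial_weight_add by (simp add: a)
    ultimately have 2: "laurent_monom (c * \<theta> j) (k + \<beta> j 0) * monomial ?m2 \<in> negative_span"
      by (rule "1.IH")
    have "laurent_monom c k * monomial m =
        laurent_monom c k * monomial ?m1 + laurent_monom (c * \<theta> j) (k + \<beta> j 0) * monomial ?m2"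
      unfolding m monomial_add rel laurent_monom_mult[symmetric] by (simp add: algebra_simps)
    then show ?thesis
      using negative_span_add[OF 1 2] by simp
  qed
qed

text \<open>Downward induction: \<open>w (Suc j) < \<alpha> j * w j\<close> passes nonnegativity on
  to the preceding index.\<close>

lemma weights_nonneg:
  assumes "w l \<ge> 0" "1 \<le> j" "j \<le> l"
  shows "w j \<ge> 0"
  using assms(3,2)
proof (induction j rule: inc_induct)
  case base
  then show ?case using assms by simp
next
  case (step j)
  then have "0 < of_nat (\<alpha> j) * w j"
    using w_Suc[of j] by fastforce
  then show ?case
    by (simp add: zero_less_mult_iff)
qed

lemma negative_span_lead_coeff:
  assumes "w l \<ge> 0" "g \<in> negative_span" "g \<noteq> 0"
  shows "\<exists>k\<in>Poly_Mapping.keys (lead_coeff g). k < 0"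
proof -
  obtain n b where g: "g = (\<Sum>i<n. smult (b i) (basis i))"
      "\<forall>i<n. \<forall>k\<in>Poly_Mapping.keys (b i). of_int k + basis_weight i < 0"
    using assms(2) by (auto simp: negative_span_def)
  obtain i0 where "i0 < n" "b i0 \<noteq> 0"
    using assms(3) g(1) by (metis (no_types, lifting) lessThan_iff smult_0_left sum.neutral)
  then have "\<exists>i<n. b i \<noteq> 0 \<and> lead_coeff g = b i"
    unfolding g(1) by (intro triangular_sum_lead_coeff basis_monic)
  then obtain i where i: "i < n" "b i \<noteq> 0" "lead_coeff g = b i"
    by blast
  obtain k where k: "k \<in> Poly_Mapping.keys (b i)"
    using i(2) by (metis ex_in_conv keys_eq_empty)
  have "basis_weight i \<ge> 0"
    unfolding monomial_weight_def using weights_nonneg[OF assms(1)]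
    by (intro sum_nonneg mult_nonneg_nonneg) auto
  then have "of_int k < (0::rat)"
    using g(2) i(1) k by fastforce
  then show ?thesis
    using k i(3) by auto
qed

end


section \<open>Polynomials of negative degree\<close>

text \<open>The subring \<open>C[u,v]\<close> of \<open>C[u,u^-1,v]\<close>.\<close>

definition nonneg_exponents :: "laurent \<Rightarrow> bool" where
  "nonneg_exponents g \<longleftrightarrow> (\<forall>i. \<forall>k\<in>Poly_Mapping.keys (coeff g i). k \<ge> 0)"

lemma nonneg_exponents_add: "nonneg_exponents g \<Longrightarrow> nonneg_exponents h \<Longrightarrow> nonneg_exponents (g + h)"
  using Poly_Mapping.keys_add by (fastforce simp: nonneg_exponents_def)

lemma nonneg_exponents_mult:
  assumes "nonneg_exponents g" "nonneg_exponents h"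
  shows "nonneg_exponents (g * h)"
  unfolding nonneg_exponents_def
proof (intro allI ballI)
  fix i k assume "k \<in> Poly_Mapping.keys (coeff (g * h) i)"
  then obtain j where "k \<in> Poly_Mapping.keys (coeff g j * coeff h (i - j))"
    unfolding coeff_mult using Poly_Mapping.keys_sum by fastforce
  then obtain a b where "a \<in> Poly_Mapping.keys (coeff g j)" "b \<in> Poly_Mapping.keys (coeff h (i - j))" "k = a + b"
    using Poly_Mapping.keys_mult by blast
  then show "k \<ge> 0"
    using assms by (auto simp: nonneg_exponents_def)
qed

lemma nonneg_exponents_laurent_monom: "k \<ge> 0 \<Longrightarrow> nonneg_exponents (laurent_monom c k)"
  by (auto simp: nonneg_exponents_def laurent_monom_def coeff_pCons split: nat.splits if_splits)

lemma ring_morphism_poly_poly_closed: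
  assumes h: "ring_morphism h"
    and base: "\<And>c. P (h [:[:c:]:])" "P (h [:[:0, 1:]:])" "P (h [:0, 1:])"
    and add: "\<And>x y. P x \<Longrightarrow> P y \<Longrightarrow> P (x + y)" and mult: "\<And>x y. P x \<Longrightarrow> P y \<Longrightarrow> P (x * y)"
  shows "P (h f)"
proof -
  have 0: "P (h 0)"
    using base(1)[of 0] by simp
  have "P (h [:p:])" for p
  proof (induction p)
    case (pCons a p)
    have "h [:pCons a p:] = h ([:[:a:]:] + [:[:0, 1:]:] * [:p:])"
      by simp
    also have "\<dots> = h [:[:a:]:] + h [:[:0, 1:]:] * h [:p:]"
      by (simp only: ring_morphismD[OF h])
    finally show ?case
      using base pCons.IH add mult by simp
  qed (use 0 in simp)
  note const = this
  show ?thesis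
  proof (induction f)
    case (pCons a p)
    show ?case
      unfolding ring_morphism_pCons[OF h, of a p] by (intro add mult const base pCons.IH)
  qed (use 0 in simp)
qed

lemma nonneg_exponents_var_v: "nonneg_exponents var_v"
  by (auto simp: nonneg_exponents_def var_v_def coeff_pCons split: nat.splits)

lemma nonneg_exponents_in_coords: "nonneg_exponents (in_coords \<tau> f)"
  by (rule ring_morphism_poly_poly_closed[OF ring_morphism_in_coords])
     (simp_all add: in_coords_simps var_u_def nonneg_exponents_var_v
      nonneg_exponents_laurent_monom nonneg_exponents_add nonneg_exponents_mult)

text \<open>Monomials in \<open>u\<close> and \<open>v\<close> come from real polynomials, so only
  the complex coefficients have to be split.\<close>

lemma nonneg_exponents_real_imag:
  assumes \<tau>: "linear \<tau>" "bij \<tau>" and g: "nonneg_exponents g"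
  obtains f1 f2 where "g = in_coords \<tau> f1 + laurent_monom \<i> 0 * in_coords \<tau> f2"
proof -
  define Q where "Q g \<longleftrightarrow> (\<exists>f1 f2. g = in_coords \<tau> f1 + laurent_monom \<i> 0 * in_coords \<tau> f2)" for g
  obtain U V where UV: "in_coords \<tau> U = var_u" "in_coords \<tau> V = var_v"
    using coordinate_forms[OF \<tau>] by metis
  note hom = ring_morphismD[OF ring_morphism_in_coords[of \<tau>]] ring_morphism_power[OF ring_morphism_in_coords[of \<tau>]]
  have Q_add: "Q (g + h)" if gh: "Q g" "Q h" for g h
  proof -
    obtain f1 f2 h1 h2 where "g = in_coords \<tau> f1 + laurent_monom \<i> 0 * in_coords \<tau> f2"
      "h = in_coords \<tau> h1 + laurent_monom \<i> 0 * in_coords \<tau> h2"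
      using gh by (auto simp: Q_def)
    then have "g + h = in_coords \<tau> (f1 + h1) + laurent_monom \<i> 0 * in_coords \<tau> (f2 + h2)"
      by (simp add: hom algebra_simps)
    then show ?thesis
      unfolding Q_def by blast
  qed
  have Q_sum: "Q (sum h I)" if "\<And>i. i \<in> I \<Longrightarrow> Q (h i)" for h and I :: "'i set"
    using that
  proof (induction I rule: infinite_finite_induct)
    case (insert i I)
    then show ?case
      using Q_add by simp
  qed (auto simp: Q_def intro!: exI[of _ 0] simp: hom)
  have var_u_power: "var_u ^ n = laurent_monom 1 (int n)" for n
  proof (induction n)
    case 0
    show ?case
      by (simp add: laurent_monom_def one_pCons)
  next
    case (Suc n)
    then show ?case
      by (simp add: var_u_def laurent_monom_mult)
  qed
  have Q_monom: "Q (laurent_monom c k * var_v ^ i)" if "k \<ge> 0" for c k i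
  proof -
    have "laurent_monom c k = (const_laurent (Re c) + laurent_monom \<i> 0 * const_laurent (Im c)) * var_u ^ nat k"
    proof -
      have "laurent_monom c 0 = const_laurent (Re c) + laurent_monom \<i> 0 * const_laurent (Im c)"
        unfolding laurent_monom_mult by (simp add: laurent_monom_def flip: single_add complex_eq)
      moreover have "laurent_monom c k = laurent_monom c 0 * var_u ^ nat k"
        using that by (simp add: var_u_power laurent_monom_mult)
      ultimately show ?thesis
        by simp
    qed
    then have "laurent_monom c k * var_v ^ i =
        in_coords \<tau> ([:[:Re c:]:] * U ^ nat k * V ^ i) + laurent_monom \<i> 0 * in_coords \<tau> ([:[:Im c:]:] * U ^ nat k * V ^ i)"
      by (simp only: hom in_coords_simps UV) (simp only: algebra_simps)
    then show ?thesis
      unfolding Q_def by blast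
  qed
  have g_eq: "g = (\<Sum>i\<le>degree g. [:coeff g i:] * var_v ^ i)"
  proof -
    have "var_v ^ i = monom 1 i" for i
      by (simp add: var_v_def monom_altdef)
    then show ?thesis
      using poly_as_sum_of_monoms[of g] by (simp add: smult_monom)
  qed
  have "Q g"
  proof (subst g_eq, rule Q_sum)
    fix i
    have "Q (\<Sum>k\<in>Poly_Mapping.keys (coeff g i). laurent_monom (Poly_Mapping.lookup (coeff g i) k) k * var_v ^ i)"
      using g by (intro Q_sum Q_monom) (auto simp: nonneg_exponents_def)
    then show "Q ([:coeff g i:] * var_v ^ i)"
      by (subst pCons_eq_sum_laurent_monom) (simp only: sum_distrib_right)
  qed
  then show ?thesis
    using that unfolding Q_def by blast
qed

section \<open>The dimension count\<close>

lemma lookup_single_times: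
  fixes p :: "'k::ab_group_add \<Rightarrow>\<^sub>0 'a::comm_ring_1"
  shows "Poly_Mapping.lookup (Poly_Mapping.single k c * p) k' = c * Poly_Mapping.lookup p (k' - k)"
proof -
  have "Poly_Mapping.lookup (Poly_Mapping.single k c * p) k' =
      (\<Sum>j\<in>Poly_Mapping.keys p. c * Poly_Mapping.lookup p j when k + j = k')"
  proof (cases "c = 0")
    case False
    then show ?thesis
      by (subst times_poly_mapping_sum) (simp add: lookup_sum lookup_single)
  qed (simp add: when_def)
  also have "\<dots> = (\<Sum>j\<in>Poly_Mapping.keys p. if j = k' - k then c * Poly_Mapping.lookup p j else 0)"
    by (intro sum.cong) (auto simp: when_def)
  also have "\<dots> = c * Poly_Mapping.lookup p (k' - k)"
    by (simp add: in_keys_iff)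
  finally show ?thesis .
qed

text \<open>Only the last digit of \<open>i\<close> is unbounded, and it multiplies the negative
  weight \<open>w l\<close>; the other digits contribute at most \<open>C\<close>. The threshold -1
  lets each later basis element gain at least one unknown.\<close>

lemma (in key_form_sequence) basis_weight_eventually_le:
  assumes "w l < 0"
  obtains i0 where "\<And>i. i \<ge> i0 \<Longrightarrow> basis_weight i \<le> - 1"
proof -
  define C where "C = (\<Sum>j\<in>{1..<l}. of_nat (\<alpha> j) * \<bar>w j\<bar>)"
  obtain q :: nat where q: "C + 1 \<le> of_nat q * (- w l)"
    using ex_less_of_nat_mult[of "- w l" "C + 1"] assms by (metis less_imp_le neg_0_less_iff_less)
  show ?thesis
  proof
    fix i assume i: "i \<ge> q * d l"
    have "(\<Sum>j\<in>{1..<l}. of_nat (digits i j) * w j) \<le> C"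
      unfolding C_def
    proof (rule sum_mono)
      fix j assume "j \<in> {1..<l}"
      then have "digits i j \<le> \<alpha> j"
        using restricted_digits[of i] by (auto simp: restricted_def less_imp_le)
      then show "of_nat (digits i j) * w j \<le> of_nat (\<alpha> j) * \<bar>w j\<bar>"
        by (intro order_trans[OF mult_left_mono[OF abs_ge_self] mult_right_mono]) auto
    qed
    moreover have "q \<le> digits i l"
      using i d_pos[of l] l_ge_1 by (simp add: digits_def less_eq_div_iff_mult_less_eq)
    then have "of_nat (digits i l) * w l \<le> of_nat q * w l"
      using assms by (intro mult_right_mono_neg) auto
    moreover have "basis_weight i = (\<Sum>j\<in>{1..<l}. of_nat (digits i j) * w j) + of_nat (digits i l) * w l"
      using l_ge_1 by (simp add: monomial_weight_def atLeastLessThanSuc flip: atLeastLessThanSuc_atLeastAtMost)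
    ultimately show "basis_weight i \<le> - 1"
      using q by simp
  qed
qed

text \<open>A dimension count. The unknowns are the coefficients of \<open>b\<^sub>i \<in> span {u\<^sup>k | s i - K \<le> k < - w(e\<^sub>i)}\<close>
  for the basis elements \<open>e\<^sub>i\<close>, \<open>i < N\<close>; the equations say that \<open>\<Sum> b\<^sub>i e\<^sub>i\<close> has no negative powers
  of \<open>u\<close>. As \<open>e\<^sub>i\<close> is monic, for large \<open>s\<close> only the coefficients of \<open>u\<^sup>k v\<^sup>i\<close> with
  \<open>s i - K \<le> k < 0\<close> can be nonzero, so there are \<open>\<Sum> \<lceil>- w(e\<^sub>i)\<rceil>\<close> more unknowns than equations.\<close>

lemma (in key_form_sequence) negative_span_nonneg_exponents:
  assumes "w l < 0"
  obtains g where "g \<in> negative_span" "nonneg_exponents g" "g \<noteq> 0"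
proof -
  \<comment> \<open>For an integer \<open>k\<close>, \<open>k < c i\<close> is equivalent to
    \<open>k + basis_weight i < 0\<close>, with strictness preserved.\<close>
  define c where "c i = \<lceil>- basis_weight i\<rceil>" for i
  obtain i0 where i0: "\<And>i. i \<ge> i0 \<Longrightarrow> basis_weight i \<le> - 1"
    using basis_weight_eventually_le[OF assms] by blast
  have c_ge: "c i \<ge> 1" if "i \<ge> i0" for i
    using i0[OF that] unfolding c_def by (simp add: one_le_ceiling)
  \<comment> \<open>Each index from \<open>i0\<close> on adds at least 1, so \<open>T + 1\<close> of
    them outweigh any deficit of the first \<open>i0\<close> indices.\<close>
  define T where "T = nat \<bar>\<Sum>i<i0. c i\<bar>"
  define N where "N = i0 + T + 1"
  have split: "{..<N} = {..<i0} \<union> {i0..<N}"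
    by (auto simp: N_def)
  have "(\<Sum>i<N. c i) = (\<Sum>i<i0. c i) + (\<Sum>i\<in>{i0..<N}. c i)"
    unfolding split by (rule sum.union_disjoint) auto
  moreover have "(\<Sum>i\<in>{i0..<N}. 1) \<le> (\<Sum>i\<in>{i0..<N}. c i)"
    using c_ge by (intro sum_mono) auto
  moreover have "(\<Sum>i\<in>{i0..<N}. 1) = int T + 1"
    by (simp add: N_def)
  moreover have "- (\<Sum>i<i0. c i) \<le> int T"
    by (simp add: T_def)
  ultimately have pos: "(\<Sum>i<N. c i) > 0"
    by linarith
  define A where "A = (\<Union>i<N. \<Union>j<N. Poly_Mapping.keys (coeff (basis i) j))"
  have "finite A"
    by (auto simp: A_def)
  \<comment> \<open>Larger than the absolute value of every exponent of \<open>u\<close> in the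
    basis elements, and positive even if all of these are 0. The lower ends \<open>s * i - K\<close>
    thus rise faster than the coefficients of \<open>basis i\<close> can push exponents
    down.\<close>
  define s where "s = (\<Sum>k\<in>A. \<bar>k\<bar>) + 1"
  have s_ge: "- s < k" if "k \<in> A" for k
    using member_le_sum[of k A "\<lambda>k. \<bar>k\<bar>"] that \<open>finite A\<close> by (simp add: s_def)
  have s_pos: "s > 0"
    unfolding s_def by (simp add: sum_nonneg add_nonneg_pos)
  \<comment> \<open>Large enough that no interval of exponents has negative length, so the
    cardinalities are the differences of the end points.\<close>
  define K where "K = (\<Sum>i<N. \<bar>s * int i\<bar> + \<bar>c i\<bar>)"
  have K: "s * int i - K \<le> 0" "s * int i - K \<le> c i" if "i < N" for i
    using member_le_sum[of i "{..<N}" "\<lambda>i. \<bar>s * int i\<bar> + \<bar>c i\<bar>"] that by (auto simp: K_def)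
  define X where "X = Sigma {..<N} (\<lambda>i. {s * int i - K..<c i})"
  define Y where "Y = Sigma {..<N} (\<lambda>i. {s * int i - K..<0})"
  have "int (card X) = (\<Sum>i<N. c i - (s * int i - K))"
    unfolding X_def using K(2) by (subst card_SigmaI) (auto intro!: sum.cong)
  moreover have "int (card Y) = (\<Sum>i<N. 0 - (s * int i - K))"
    unfolding Y_def using K(1) by (subst card_SigmaI) (auto intro!: sum.cong)
  ultimately have "card Y < card X"
    using pos by (simp add: sum_subtractf)
  moreover have "finite X" "finite Y"
    by (auto simp: X_def Y_def)
  ultimately obtain x where x: "\<exists>p\<in>X. x p \<noteq> 0"
    "\<And>j k'. (j, k') \<in> Y \<Longrightarrow> (\<Sum>p\<in>X. Poly_Mapping.lookup (coeff (basis (fst p)) j) (k' - snd p) * x p) = 0"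
    using homogeneous_system_nontrivial_solution[of Y X
        "\<lambda>q p. Poly_Mapping.lookup (coeff (basis (fst p)) (fst q)) (snd q - snd p)"] by fastforce
  define b where "b i = (\<Sum>k\<in>{s * int i - K..<c i}. Poly_Mapping.single k (x (i, k)))" for i
  define g where "g = (\<Sum>i<N. smult (b i) (basis i))"
  have lookup_b: "Poly_Mapping.lookup (b i) k = (x (i, k) when k \<in> {s * int i - K..<c i})" for i k
    unfolding b_def lookup_sum lookup_single by (simp add: when_def)
  have keys_b: "k \<in> {s * int i - K..<c i}" if "k \<in> Poly_Mapping.keys (b i)" for i k
    using that by (auto simp: in_keys_iff lookup_b when_def split: if_splits)
  have lookup_b_times: "Poly_Mapping.lookup (b i * p) k' =
      (\<Sum>k\<in>{s * int i - K..<c i}. Poly_Mapping.lookup p (k' - k) * x (i, k))" for i p k'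
    unfolding b_def sum_distrib_right lookup_sum lookup_single_times
    by (intro sum.cong refl mult.commute)
  have lookup_g: "Poly_Mapping.lookup (coeff g j) k' =
      (\<Sum>p\<in>X. Poly_Mapping.lookup (coeff (basis (fst p)) j) (k' - snd p) * x p)" for j k'
  proof -
    have "Poly_Mapping.lookup (coeff g j) k' = (\<Sum>i<N. \<Sum>k\<in>{s * int i - K..<c i}.
        Poly_Mapping.lookup (coeff (basis i) j) (k' - k) * x (i, k))"
      by (simp add: g_def coeff_sum lookup_sum lookup_b_times)
    also have "\<dots> = (\<Sum>p\<in>X. Poly_Mapping.lookup (coeff (basis (fst p)) j) (k' - snd p) * x p)"
      unfolding X_def by (subst sum.Sigma) (auto intro!: sum.cong)
    finally show ?thesis .
  qed
  show ?thesis
  proof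
    show "g \<in> negative_span"
      unfolding negative_span_def g_def
    proof (intro CollectI exI[of _ N] exI[of _ b] conjI refl allI impI ballI)
      fix i k assume "k \<in> Poly_Mapping.keys (b i)"
      then have "k < c i"
        using keys_b by force
      then have "of_int k < - basis_weight i"
        by (simp add: c_def less_ceiling_iff)
      then show "of_int k + basis_weight i < 0"
        by simp
    qed
    obtain i k where ik: "(i, k) \<in> X" "x (i, k) \<noteq> 0"
      using x(1) by auto
    then have "b i \<noteq> 0"
      using lookup_b[of i k] by (auto simp: X_def)
    then have "\<exists>i<N. b i \<noteq> 0 \<and> lead_coeff g = b i"
      using ik(1) unfolding g_def by (intro triangular_sum_lead_coeff basis_monic) (auto simp: X_def)
    then show "g \<noteq> 0"
      by auto
    show "nonneg_exponents g"
      unfolding nonneg_exponents_def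
    proof (intro allI ballI, rule ccontr)
      fix j k' assume k': "k' \<in> Poly_Mapping.keys (coeff g j)" "\<not> 0 \<le> k'"
      have "Poly_Mapping.lookup (coeff g j) k' = 0"
      proof (cases "(j, k') \<in> Y")
        case True
        then show ?thesis
          by (simp add: lookup_g x(2))
      next
        case False
        show ?thesis
          unfolding lookup_g
        proof (intro sum.neutral ballI)
          fix p assume "p \<in> X"
          then obtain i k where p: "p = (i, k)" "i < N" "s * int i - K \<le> k"
            by (auto simp: X_def)
          have "Poly_Mapping.lookup (coeff (basis i) j) (k' - k) = 0"
          proof (cases i j rule: linorder_cases)
            case less
            then show ?thesis
              using coeff_eq_0[of "basis i" j] by (simp add: basis_monic)
          next
            \<comment> \<open>The coefficient of \<open>v^i\<close> in \<open>basis i\<close> is 1,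
              so only \<open>k = k'\<close> could contribute; but \<open>k'\<close> lies below the
              range of \<open>k\<close>.\<close>
            case equal
            then have "k' \<noteq> k"
              using False p k' by (auto simp: Y_def)
            then show ?thesis
              using equal by (simp add: basis_monic lookup_one)
          next
            \<comment> \<open>To reach an exponent below \<open>s * j - K\<close>,
              \<open>basis i\<close> would need an exponent of \<open>u\<close> below
              \<open>- s\<close>.\<close>
            case greater
            then have "j < N" "k' < s * int j - K"
              using False p k' by (auto simp: Y_def)
            moreover have "s * int j + s \<le> s * int i"
              using greater s_pos mult_left_mono[of "int j + 1" "int i" s] by (simp add: distrib_left)
            ultimately have "k' - k < - s" "j < N"
              using p(3) by linarith+
            then have "k' - k \<notin> Poly_Mapping.keys (coeff (basis i) j)"
              using s_ge[of "k' - k"] p(2) by (fastforce simp: A_def)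
            then show ?thesis
              by (simp add: in_keys_iff)
          qed
          then show "Poly_Mapping.lookup (coeff (basis (fst p)) j) (k' - snd p) * x p = 0"
            by (simp add: p(1))
        qed
      qed
      then show False
        using k'(1) by (simp add: in_keys_iff)
    qed
  qed
qed

section \<open>From negative weight to negative degree\<close>

lemma keys_le_times:
  fixes F G :: "rat \<Rightarrow>\<^sub>0 complex poly"
  assumes "\<And>r. r \<in> Poly_Mapping.keys F \<Longrightarrow> r \<le> a" "\<And>r. r \<in> Poly_Mapping.keys G \<Longrightarrow> r \<le> b"
    and "r \<in> Poly_Mapping.keys (F * G)"
  shows "r \<le> a + b"
proof -
  obtain i j where "i \<in> Poly_Mapping.keys F" "j \<in> Poly_Mapping.keys G" "r = i + j"
    using assms(3) Poly_Mapping.keys_mult[of F G] by blast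
  then show ?thesis
    using assms(1,2) add_mono by blast
qed

lemma keys_le_power:
  fixes F :: "rat \<Rightarrow>\<^sub>0 complex poly"
  assumes "\<And>r. r \<in> Poly_Mapping.keys F \<Longrightarrow> r \<le> a" and "r \<in> Poly_Mapping.keys (F ^ n)"
  shows "r \<le> of_nat n * a"
  using assms(2)
proof (induction n arbitrary: r)
  case (Suc n)
  then have "r \<le> a + of_nat n * a"
    using keys_le_times[of F a "F ^ n" "of_nat n * a" r] assms(1) by simp
  then show ?case
    by (simp add: distrib_right)
qed simp

lemma keys_le_prod:
  fixes F :: "'i \<Rightarrow> rat \<Rightarrow>\<^sub>0 complex poly"
  assumes "finite I" "\<And>i r. i \<in> I \<Longrightarrow> r \<in> Poly_Mapping.keys (F i) \<Longrightarrow> r \<le> a i"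
    and "r \<in> Poly_Mapping.keys (prod F I)"
  shows "r \<le> sum a I"
  using assms
proof (induction I arbitrary: r rule: finite_induct)
  case (insert i I)
  then show ?case
    using keys_le_times[of "F i" "a i" "prod F I" "sum a I" r] by simp
qed simp

lemma keys_rational_exponents: "Poly_Mapping.keys (rational_exponents p) \<subseteq> of_int ` Poly_Mapping.keys p"
proof
  fix r assume "r \<in> Poly_Mapping.keys (rational_exponents p)"
  then have "r \<in> (\<Union>k\<in>Poly_Mapping.keys p.
      Poly_Mapping.keys (Poly_Mapping.single (of_int k :: rat) [:Poly_Mapping.lookup p k:]))"
    unfolding rational_exponents_def by (rule subsetD[OF Poly_Mapping.keys_sum])
  then show "r \<in> of_int ` Poly_Mapping.keys p"
    by (auto split: if_splits)
qed

lemma subst_branch_const: "subst_branch \<phi> \<omega> [:p:] = rational_exponents p"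
  by (simp add: subst_branch_def map_poly_pCons ring_morphismD[OF ring_morphism_rational_exponents])

text \<open>Upper bounds for the exponents of the \<open>f j\<close> propagate to monomials and to
  sums; cancellation can only remove exponents.\<close>

lemma (in key_form_sequence) keys_subst_negative_span:
  assumes f_le: "\<And>j r. 1 \<le> j \<Longrightarrow> j \<le> l \<Longrightarrow> r \<in> Poly_Mapping.keys (subst_branch \<phi> \<omega> (f j)) \<Longrightarrow> r \<le> w j"
    and g: "g \<in> negative_span" and r: "r \<in> Poly_Mapping.keys (subst_branch \<phi> \<omega> g)"
  shows "r < 0"
proof -
  note hom = ring_morphismD[OF ring_morphism_subst_branch[of \<phi> \<omega>]]
    ring_morphism_sum[OF ring_morphism_subst_branch[of \<phi> \<omega>]]
    ring_morphism_prod[OF ring_morphism_subst_branch[of \<phi> \<omega>]]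
    ring_morphism_power[OF ring_morphism_subst_branch[of \<phi> \<omega>]]
  have monomial_le: "r \<le> monomial_weight m" if "r \<in> Poly_Mapping.keys (subst_branch \<phi> \<omega> (monomial m))" for r m
    unfolding monomial_weight_def
  proof (rule keys_le_prod)
    show "r \<in> Poly_Mapping.keys (\<Prod>j\<in>{1..l}. subst_branch \<phi> \<omega> (f j) ^ m j)"
      using that by (simp add: monomial_def hom)
    show "r \<le> of_nat (m j) * w j" if "j \<in> {1..l}" "r \<in> Poly_Mapping.keys (subst_branch \<phi> \<omega> (f j) ^ m j)" for j r
      using that f_le[of j] by (intro keys_le_power[where F = "subst_branch \<phi> \<omega> (f j)"]) auto
  qed simp
  obtain n b where gb: "g = (\<Sum>i<n. smult (b i) (basis i))"
      "\<forall>i<n. \<forall>k\<in>Poly_Mapping.keys (b i). of_int k + basis_weight i < 0"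
    using g by (auto simp: negative_span_def)
  have "g = (\<Sum>i<n. [:b i:] * basis i)"
    by (simp add: gb(1))
  then have eq: "subst_branch \<phi> \<omega> g = (\<Sum>i<n. rational_exponents (b i) * subst_branch \<phi> \<omega> (basis i))"
    by (simp only: hom subst_branch_const)
  have "r \<in> (\<Union>i<n. Poly_Mapping.keys (rational_exponents (b i) * subst_branch \<phi> \<omega> (basis i)))"
    using r unfolding eq by (rule subsetD[OF Poly_Mapping.keys_sum])
  then obtain i where i: "i < n" "r \<in> Poly_Mapping.keys (rational_exponents (b i) * subst_branch \<phi> \<omega> (basis i))"
    by blast
  then obtain a c where ac: "a \<in> Poly_Mapping.keys (rational_exponents (b i))"
      "c \<in> Poly_Mapping.keys (subst_branch \<phi> \<omega> (basis i))" "r = a + c"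
    using Poly_Mapping.keys_mult by blast
  obtain k where "k \<in> Poly_Mapping.keys (b i)" "a = of_int k"
    using ac(1) keys_rational_exponents by blast
  then have "a + basis_weight i < 0"
    using gb(2) i(1) by blast
  then show ?thesis
    using monomial_le[OF ac(2)] ac(3) by linarith
qed

lemma (in key_form_sequence) ex_negative_delta_star:
  assumes \<tau>: "linear \<tau>" "bij \<tau>"
    and f_le: "\<And>j r. 1 \<le> j \<Longrightarrow> j \<le> l \<Longrightarrow> r \<in> Poly_Mapping.keys (subst_branch \<phi> \<omega> (f j)) \<Longrightarrow> r \<le> w j"
    and "w l < 0"
  shows "\<exists>p. p \<noteq> 0 \<and> delta_star \<tau> \<phi> \<omega> p < 0"
proof -
  obtain g where g: "g \<in> negative_span" "nonneg_exponents g" "g \<noteq> 0"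
    using negative_span_nonneg_exponents[OF assms(4)] .
  obtain p1 p2 where p12: "g = in_coords \<tau> p1 + laurent_monom \<i> 0 * in_coords \<tau> p2"
    using nonneg_exponents_real_imag[OF \<tau> g(2)] .
  let ?G = "subst_branch \<phi> \<omega> g"
  have neg: "r < 0" if "r \<in> Poly_Mapping.keys ?G" for r
    using keys_subst_negative_span[OF _ g(1) that] f_le by blast
  \<comment> \<open>The entry -1 supplies a negative bound even if the support is empty.\<close>
  define \<rho> where "\<rho> = Max (insert (- 1) (Poly_Mapping.keys ?G))"
  have \<rho>: "\<rho> < 0" "\<And>r. r \<in> Poly_Mapping.keys ?G \<Longrightarrow> r \<le> \<rho>"
    using neg by (auto simp: \<rho>_def)
  have "delta_star \<tau> \<phi> \<omega> p < 0"
    if p: "p \<noteq> 0" "p = p1 \<or> p = p2" for p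
  proof -
    define F where "F = subst_branch \<phi> \<omega> (in_coords \<tau> p)"
    define \<gamma> where "\<gamma> = delta_star \<tau> \<phi> \<omega> p"
    have \<gamma>: "\<gamma> = top_key F"
      by (simp add: \<gamma>_def F_def delta_star_def branch_degree_conv)
    have F: "Poly_Mapping.lookup F \<gamma> \<noteq> 0"
      using top_key_in[of F] subst_branch_in_coords_neq_0[OF \<tau> p(1)] by (simp add: \<gamma> F_def in_keys_iff)
    \<comment> \<open>The interval is arbitrary: growth is measured here in the whole plane and not
      on \<open>S\<close>.\<close>
    obtain \<xi> where \<xi>: "0 < \<xi>" "\<xi> < 1" "poly (Poly_Mapping.lookup F \<gamma>) (complex_of_real \<xi>) \<noteq> 0"
      using ex_nonroot_between[OF F, of 0 1] by auto
    obtain C where C: "C \<ge> 0" "\<And>u \<xi>. u \<ge> 1 \<Longrightarrow> \<bar>\<xi>\<bar> \<le> 1 \<Longrightarrow> norm (branch_eval u \<xi> ?G) \<le> C * u powr real_of_rat \<rho>"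
      using norm_branch_eval_le[of ?G \<rho> 1] \<rho>(2) by metis
    have "real_of_rat \<gamma> \<le> real_of_rat \<rho>"
    proof (rule branch_exponent_le[OF _ \<xi>(3)])
      show "r \<in> Poly_Mapping.keys F \<Longrightarrow> r \<le> \<gamma>" for r
        using \<gamma> top_key_ge by blast
      show "\<forall>\<^sub>F u in at_top. norm (branch_eval u \<xi> F) \<le> C * u powr real_of_rat \<rho>"
        using eventually_ge_at_top[of 1]
      proof eventually_elim
        case (elim u)
        define z where "z = inv \<tau> (u, branch_sum \<phi> u + \<xi> * u powr real_of_rat \<omega>)"
        have u: "u > 0"
          using elim by simp
        have eval: "branch_eval u \<xi> (subst_branch \<phi> \<omega> (in_coords \<tau> q)) = complex_of_real (eval2 q z)" for q
          unfolding z_def by (rule branch_eval_in_coords[OF \<tau> u])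
        have "branch_eval u \<xi> ?G = complex_of_real (eval2 p1 z) + \<i> * complex_of_real (eval2 p2 z)"
          using u by (simp add: p12 ring_morphismD[OF ring_morphism_subst_branch] eval
              ring_morphismD[OF ring_morphism_branch_eval] branch_eval_laurent_monom)
        then have "Re (branch_eval u \<xi> ?G) = eval2 p1 z" "Im (branch_eval u \<xi> ?G) = eval2 p2 z"
          by simp_all
        then have "\<bar>eval2 p z\<bar> \<le> norm (branch_eval u \<xi> ?G)"
          using p(2) abs_Re_le_cmod abs_Im_le_cmod by metis
        also have "\<dots> \<le> C * u powr real_of_rat \<rho>"
          using C(2)[OF elim, of \<xi>] \<xi> by simp
        finally show ?case
          by (simp add: F_def eval)
      qed
    qed
    then show ?thesis
      using \<rho>(1) unfolding \<gamma>_def by (simp add: of_rat_less_eq)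
  qed
  moreover have "p1 \<noteq> 0 \<or> p2 \<noteq> 0"
    using g(3) p12 ring_morphismD(1)[OF ring_morphism_in_coords[of \<tau>]] by auto
  ultimately show ?thesis
    by blast
qed

section \<open>Key forms and the sign of \<open>delta_star\<close>\<close>

lemma le_weighted_degree:
  assumes "m \<in> Poly_Mapping.keys G" "k \<in> Poly_Mapping.keys (Poly_Mapping.lookup G m)"
  shows "of_int k * w 0 + (\<Sum>j\<in>Poly_Mapping.keys m. of_nat (Poly_Mapping.lookup m j) * w j) \<le> weighted_degree w G"
  unfolding weighted_degree_def
proof (rule Max_ge)
  have "{of_int k * w 0 + (\<Sum>j\<in>Poly_Mapping.keys m. of_nat (Poly_Mapping.lookup m j) * w j) | m k.
      m \<in> Poly_Mapping.keys G \<and> k \<in> Poly_Mapping.keys (Poly_Mapping.lookup G m)} \<subseteq>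
    (\<lambda>(m, k). of_int k * w 0 + (\<Sum>j\<in>Poly_Mapping.keys m. of_nat (Poly_Mapping.lookup m j) * w j)) `
      Sigma (Poly_Mapping.keys G) (\<lambda>m. Poly_Mapping.keys (Poly_Mapping.lookup G m))"
    by auto
  then show "finite {of_int k * w 0 + (\<Sum>j\<in>Poly_Mapping.keys m. of_nat (Poly_Mapping.lookup m j) * w j) | m k.
      m \<in> Poly_Mapping.keys G \<and> k \<in> Poly_Mapping.keys (Poly_Mapping.lookup G m)}"
    by (rule finite_subset) auto
qed (use assms in blast)

text \<open>\<open>G\<close> is split into single terms, each of weight at most the weighted degree
  of \<open>G\<close>, and each term is rewritten in the basis separately.\<close>

lemma (in key_form_sequence) subst_y_in_negative_span:
  assumes fs: "\<And>j. fs ! j = f j" and G: "G \<in> polys_in_y l" and neg: "weighted_degree w G < 0"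
  shows "subst_y fs G \<in> negative_span"
  unfolding subst_y_def
proof (rule negative_span_sum)
  fix m assume m: "m \<in> Poly_Mapping.keys G"
  then have keys_m: "Poly_Mapping.keys m \<subseteq> {1..l}"
    using G by (auto simp: polys_in_y_def)
  have prod: "(\<Prod>j\<in>Poly_Mapping.keys m. fs ! j ^ Poly_Mapping.lookup m j) = monomial (Poly_Mapping.lookup m)"
    unfolding monomial_def fs using keys_m by (intro prod.mono_neutral_left) (auto simp: in_keys_iff)
  have wt: "(\<Sum>j\<in>Poly_Mapping.keys m. of_nat (Poly_Mapping.lookup m j) * w j) = monomial_weight (Poly_Mapping.lookup m)"
    unfolding monomial_weight_def using keys_m by (intro sum.mono_neutral_left) (auto simp: in_keys_iff)
  have "(\<Sum>k\<in>Poly_Mapping.keys (Poly_Mapping.lookup G m).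
      laurent_monom (Poly_Mapping.lookup (Poly_Mapping.lookup G m) k) k * monomial (Poly_Mapping.lookup m)) \<in> negative_span"
  proof (intro negative_span_sum negative_span_monomial)
    fix k assume "k \<in> Poly_Mapping.keys (Poly_Mapping.lookup G m)"
    from le_weighted_degree[OF m this, of w]
    show "of_int k + monomial_weight (Poly_Mapping.lookup m) < 0"
      using neg by (simp add: wt w_0)
  qed
  then show "[:Poly_Mapping.lookup G m:] * (\<Prod>j\<in>Poly_Mapping.keys m. fs ! j ^ Poly_Mapping.lookup m j) \<in> negative_span"
    unfolding prod by (subst pCons_eq_sum_laurent_monom) (simp only: sum_distrib_right)
qed

text \<open>A \<open>LEAST\<close> needs a witness. The denominator of \<open>w j\<close> is one,
  because every integer is a multiple of \<open>w 0 = 1\<close>.\<close>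

lemma key_alpha_pos:
  assumes "w 0 = 1" "1 \<le> j"
  shows "key_alpha w j > 0"
proof -
  obtain p q where "quotient_of (w j) = (p, q)"
    by fastforce
  then have q: "q > 0" "w j = of_int p / of_int q"
    using quotient_of_denom_pos quotient_of_div by blast+
  have "(\<Sum>i<j. of_int (if i = 0 then p else 0) * w i) = (\<Sum>i<j. if i = 0 then of_int p else 0)"
    using assms(1) by (intro sum.cong) auto
  also have "\<dots> = of_int p"
    using assms(2) by simp
  finally have "(\<Sum>i<j. of_int (if i = 0 then p else 0) * w i) = of_int p" .
  moreover have "of_nat (nat q) * w j = of_int p"
    using q by simp
  ultimately have "\<exists>a. a > 0 \<and> (\<exists>\<beta>::nat \<Rightarrow> int. of_nat a * w j = (\<Sum>i<j. of_int (\<beta> i) * w i))"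
    using q(1) by (intro exI[of _ "nat q"] conjI exI[of _ "\<lambda>i. if i = 0 then p else 0"]) auto
  from LeastI_ex[OF this] show ?thesis
    by (simp add: key_alpha_def)
qed

lemma delta_star_nonneg_iff:
  assumes \<tau>: "linear \<tau>" "bij \<tau>" and key: "key_forms (branch_degree \<phi> \<omega>) fs"
  shows "(\<forall>f. f \<noteq> 0 \<longrightarrow> delta_star \<tau> \<phi> \<omega> f \<ge> 0) \<longleftrightarrow> branch_degree \<phi> \<omega> (last fs) \<ge> 0"
proof -
  define w where "w = (\<lambda>j. branch_degree \<phi> \<omega> (fs ! j))"
  define \<alpha> where "\<alpha> = key_alpha w"
  obtain l where l: "l \<ge> 1" "length fs = Suc l" "0 \<notin> set fs" "fs ! 0 = var_u" "fs ! 1 = var_v"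
    and step: "\<forall>j\<in>{1..<l}. \<exists>(\<beta>::nat \<Rightarrow> int) \<theta>.
            of_nat (\<alpha> j) * w j = (\<Sum>i<j. of_int (\<beta> i) * w i) \<and>
            (\<forall>i\<in>{1..<j}. 0 \<le> \<beta> i \<and> \<beta> i < int (\<alpha> i)) \<and>
            \<theta> \<noteq> 0 \<and>
            fs ! Suc j = (fs ! j) ^ \<alpha> j - laurent_monom \<theta> (\<beta> 0) * (\<Prod>i\<in>{1..<j}. (fs ! i) ^ nat (\<beta> i)) \<and>
            w (Suc j) < of_nat (\<alpha> j) * w j"
    and rep: "\<forall>g. g \<noteq> 0 \<longrightarrow>
            (\<exists>G\<in>polys_in_y l. subst_y fs G = g \<and> weighted_degree w G = branch_degree \<phi> \<omega> g) \<and>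
            (\<forall>G\<in>polys_in_y l. subst_y fs G = g \<longrightarrow> branch_degree \<phi> \<omega> g \<le> weighted_degree w G)"
    using key unfolding key_forms_def Let_def
    by (elim exE conjE) (rule that, assumption+, (unfold w_def \<alpha>_def, assumption+))
  obtain \<beta> \<theta> where \<beta>\<theta>: "\<And>j. j \<in> {1..<l} \<Longrightarrow>
            of_nat (\<alpha> j) * w j = (\<Sum>i<j. of_int (\<beta> j i :: int) * w i) \<and>
            (\<forall>i\<in>{1..<j}. 0 \<le> \<beta> j i \<and> \<beta> j i < int (\<alpha> i)) \<and>
            \<theta> j \<noteq> 0 \<and>
            fs ! Suc j = (fs ! j) ^ \<alpha> j - laurent_monom (\<theta> j) (\<beta> j 0) * (\<Prod>i\<in>{1..<j}. (fs ! i) ^ nat (\<beta> j i)) \<and>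
            w (Suc j) < of_nat (\<alpha> j) * w j"
  proof -
    obtain \<beta> where "\<forall>j\<in>{1..<l}. \<exists>\<theta>.
            of_nat (\<alpha> j) * w j = (\<Sum>i<j. of_int (\<beta> j i :: int) * w i) \<and>
            (\<forall>i\<in>{1..<j}. 0 \<le> \<beta> j i \<and> \<beta> j i < int (\<alpha> i)) \<and>
            \<theta> \<noteq> 0 \<and>
            fs ! Suc j = (fs ! j) ^ \<alpha> j - laurent_monom \<theta> (\<beta> j 0) * (\<Prod>i\<in>{1..<j}. (fs ! i) ^ nat (\<beta> j i)) \<and>
            w (Suc j) < of_nat (\<alpha> j) * w j"
      using bchoice[OF step] by blast
    from bchoice[OF this] show ?thesis
      by (elim exE) (rule that, drule (1) bspec, assumption)
  qed
  have w_0: "w 0 = 1"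
    by (simp add: w_def l(4) branch_degree_var_u)
  interpret key_form_sequence "\<lambda>j. fs ! j" l w \<alpha> \<beta> \<theta>
  proof
    show "1 \<le> l" "fs ! 1 = var_v" "w 0 = 1"
      by (fact l w_0)+
    show "\<alpha> j > 0" if "1 \<le> j" "j < l" for j
      unfolding \<alpha>_def using w_0 that(1) by (rule key_alpha_pos)
    fix j assume "1 \<le> j" "j < l"
    then have "j \<in> {1..<l}"
      by simp
    note step_j = \<beta>\<theta>[OF this]
    show "of_nat (\<alpha> j) * w j = (\<Sum>i<j. of_int (\<beta> j i) * w i)"
      "fs ! Suc j = fs ! j ^ \<alpha> j - laurent_monom (\<theta> j) (\<beta> j 0) * (\<Prod>i\<in>{1..<j}. fs ! i ^ nat (\<beta> j i))"
      "w (Suc j) < of_nat (\<alpha> j) * w j"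
      using step_j by blast+
    show "0 \<le> \<beta> j i \<and> \<beta> j i < int (\<alpha> i)" if "1 \<le> i" "i < j" for i
      using step_j that by simp
  qed
  have "last fs = fs ! l"
    using l(2) by (cases fs rule: rev_cases) auto
  then have last: "branch_degree \<phi> \<omega> (last fs) = w l"
    by (simp add: w_def)
  have "delta_star \<tau> \<phi> \<omega> p \<ge> 0" if nonneg: "w l \<ge> 0" and p: "p \<noteq> 0" for p
  proof (rule ccontr)
    assume neg: "\<not> delta_star \<tau> \<phi> \<omega> p \<ge> 0"
    let ?g = "in_coords \<tau> p"
    \<comment> \<open>Any branch detects that \<open>?g\<close> is nonzero, for instance the one
      with \<open>\<phi> = 0\<close> and \<open>\<omega> = 0\<close>.\<close>
    have g: "?g \<noteq> 0"
      using subst_branch_in_coords_neq_0[OF \<tau> p, of 0 0] ring_morphismD(1)[OF ring_morphism_subst_branch] by metis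
    \<comment> \<open>Property (ii) gives a representation whose weight is the degree itself, so all
      its terms have negative weight.\<close>
    then obtain G where G: "G \<in> polys_in_y l" "subst_y fs G = ?g" "weighted_degree w G = branch_degree \<phi> \<omega> ?g"
      using rep by blast
    then have "?g \<in> negative_span"
      using subst_y_in_negative_span[of fs G] neg by (simp add: delta_star_def)
    then obtain k where "k \<in> Poly_Mapping.keys (lead_coeff ?g)" "k < 0"
      using negative_span_lead_coeff[OF nonneg _ g] by blast
    then show False
      using nonneg_exponents_in_coords[of \<tau> p] by (force simp: nonneg_exponents_def)
  qed
  moreover have "\<exists>p. p \<noteq> 0 \<and> delta_star \<tau> \<phi> \<omega> p < 0" if "w l < 0"
  proof (rule ex_negative_delta_star[OF \<tau> _ that])
    show "r \<le> w j" if "r \<in> Poly_Mapping.keys (subst_branch \<phi> \<omega> (fs ! j))" for j r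
      using that top_key_ge by (simp add: w_def branch_degree_conv)
  qed
  ultimately show ?thesis
    unfolding last by (meson linorder_not_le)
qed

lemma delta_star_data_linear:
  assumes "delta_star_data S \<tau> \<phi> \<omega>"
  shows "linear \<tau>" "bij \<tau>"
  using assms by (auto simp: delta_star_data_def linear_id)

theorem proposition4p16:
  fixes S :: "(real \<times> real) set"
    and \<tau> :: "real \<times> real \<Rightarrow> real \<times> real"
    and \<phi> :: "rat \<Rightarrow>\<^sub>0 real"
    and \<omega> :: rat
    and fs :: "laurent list"
  assumes "semialgebraic S"
    and "one_tentacle S"
    and "all_tentacles_regular S"
    and "delta_star_data S \<tau> \<phi> \<omega>"
    and "key_forms (branch_degree \<phi> \<omega>) fs"
  shows "(semidegree (stable_growth_degree S) \<longleftrightarrow>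
            (\<forall>f. f \<noteq> 0 \<longrightarrow> delta_star \<tau> \<phi> \<omega> f \<ge> 0)) \<and>
         ((\<forall>f. f \<noteq> 0 \<longrightarrow> delta_star \<tau> \<phi> \<omega> f \<ge> 0) \<longleftrightarrow>
            branch_degree \<phi> \<omega> (last fs) \<ge> 0)"
proof
  note \<tau> = delta_star_data_linear[OF assms(4)]
  show "semidegree (stable_growth_degree S) \<longleftrightarrow> (\<forall>f. f \<noteq> 0 \<longrightarrow> delta_star \<tau> \<phi> \<omega> f \<ge> 0)"
    using semidegree_stable_growth_degree_iff[OF \<tau> growth_degree_eq_delta_star[OF assms(2,4)]] .
  show "(\<forall>f. f \<noteq> 0 \<longrightarrow> delta_star \<tau> \<phi> \<omega> f \<ge> 0) \<longleftrightarrow> branch_degree \<phi> \<omega> (last fs) \<ge> 0"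
    by (rule delta_star_nonneg_iff[OF \<tau> assms(5)])
qed

end
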